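(* The set $\mathrm{Spec}(J_1,\dots,J_n)$, the set $\mathrm{Cont}_m(n)$ and the set of standard $m$-tableaux of size $n$ are in bijection.
   Context: Parameters. Let $m,n\ge 1$. Either $K=\mathbb{C}(q,v_1,\dots,v_m)$ with $q,v_1,\dots,v_m$ indeterminates, or $K=\mathbb{C}$ and $q,v_1,\dots,v_m\in\mathbb{C}$, $q\neq0$, satisfy: $1+q^2+\dots+q^{2N}\neq0$ for all non-negative integers $N<n$; $q^{2i}v_j-v_k\neq0$ for all $i,j,k$ with $j\neq k$ and $-n<i<n$; $v_j\neq0$ for all $j=1,\dots,m$. Cyclotomic Hecke algebra. $H(m,1,n)$ is the associative unital $K$-algebra generated by $\tau,\sigma_1,\dots,\sigma_{n-1}$ with defining relations $\sigma_i\sigma_{i+1}\sigma_i=\sigma_{i+1}\sigma_i\sigma_{i+1}$; $\sigma_i\sigma_j=\sigma_j\sigma_i$ if $|i-j|>1$; $\tau\sigma_1\tau\sigma_1=\sigma_1\tau\sigma_1\tau$; $\tau\sigma_i=\sigma_i\tau$ for $i>1$; $\sigma_i^2=(q-q^{-1})\sigma_i+1$; $(\tau-v_1)\cdots(\tau-v_m)=0$. The Jucys--Murphy elements are $J_1=\tau$, $J_{i+1}=\sigma_iJ_i\sigma_i$; they commute with each other. $C$-representations. A representation of $H(m,1,n)$ over $K$ is a $C$-representation if $J_1,\dots,J_n$ act by diagonalizable operators and, for every $i=1,\dots,n-1$, the action of the subalgebra generated by $J_i,J_{i+1},\sigma_i$ is completely reducible. $\mathrm{Spec}(J_1,\dots,J_n)$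 is the set of strings $(a_1,\dots,a_n)$ for which there is a nonzero vector $e$ in the space of some $C$-representation with $J_i(e)=a_ie$ for all $i=1,\dots,n$. Content strings. A content string $(a_1,\dots,a_n)$ is a string of numbers (elements of $K$) satisfying the following conditions: (c1) $a_1\in\{v_1,\dots,v_m\}$; (c2) for all $j>1$: if $a_j=v_kq^{2z}$ for some $k$ and some integer $z\neq0$, then $\{v_kq^{2(z-1)},v_kq^{2(z+1)}\}\cap\{a_1,\dots,a_{j-1}\}\neq\varnothing$; (c3) if $a_i=a_j=v_kq^{2z}$ with $i<j$ for some $k$ and some integer $z$, then $\{v_kq^{2(z-1)},v_kq^{2(z+1)}\}\subset\{a_{i+1},\dots,a_{j-1}\}$. $\mathrm{Cont}_m(n)$ is the set of content strings of length $n$. Tableaux. An $m$-partition of $n$ is an $m$-tuple of partitions (Young diagrams) of total size $n$. A standard $m$-tableau of size $n$ is a bijective filling with $1,\dots,n$ of the nodes of an $m$-partition of $n$ such that in every diagram the numbers increase along rows (to the right) and columns (downwards).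
   Formalization: In (c2), a_j must have the form v_k q^{2z} with the condition required for some such presentation (literal (c2) makes Cont infinite for n≥2); for complex parameters q²≠1 is added when n≥2 (false at q=±1); representations are taken finite-dimensional. *)

theory Defs
  imports
    Complex_Main
    "HOL-Library.FuncSet"
    "HOL-Library.Poly_Mapping"
    "HOL-Computational_Algebra.Polynomial"
    "HOL-Computational_Algebra.Fraction_Field"
    "HOL-Algebra.Ring"
    "HOL-Algebra.Module"
    "Jordan_Normal_Form.Matrix"
    "Jordan_Normal_Form.VS_Connect"
begin

section \<open>Unital associative algebras given by generators and relations\<close>

text \<open>
  The algebra with generators \<open>G\<close> and defining relations \<open>R\<close> is the quotient of the set of
  formal expressions over \<open>G\<close> by the least congruence that contains \<open>R\<close> and all
  identities of unital associative algebras over the field \<open>'k\<close>.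
\<close>

datatype (dead 'k, gens: 'g) aterm =
    Scalar 'k
  | Gen 'g
  | Plus "('k, 'g) aterm" "('k, 'g) aterm"  (infixl \<open>\<^bold>+\<close> 65)
  | Times "('k, 'g) aterm" "('k, 'g) aterm"  (infixl \<open>\<^bold>*\<close> 70)

definition aterms :: "'g set \<Rightarrow> ('k, 'g) aterm set" where
  "aterms G = {t. gens t \<subseteq> G}"

inductive_set alg_cong ::
  "'g set \<Rightarrow> (('k::field, 'g) aterm \<times> ('k, 'g) aterm) set \<Rightarrow> (('k, 'g) aterm \<times> ('k, 'g) aterm) set"
  for G :: "'g set" and R :: "(('k::field, 'g) aterm \<times> ('k, 'g) aterm) set"
where
  relation: "(x, y) \<in> R \<Longrightarrow> x \<in> aterms G \<Longrightarrow> y \<in> aterms G \<Longrightarrow> (x, y) \<in> alg_cong G R"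
| refl: "x \<in> aterms G \<Longrightarrow> (x, x) \<in> alg_cong G R"
| sym: "(x, y) \<in> alg_cong G R \<Longrightarrow> (y, x) \<in> alg_cong G R"
| trans: "(x, y) \<in> alg_cong G R \<Longrightarrow> (y, z) \<in> alg_cong G R \<Longrightarrow> (x, z) \<in> alg_cong G R"
| plus_cong: "(x, x') \<in> alg_cong G R \<Longrightarrow> (y, y') \<in> alg_cong G R
    \<Longrightarrow> (x \<^bold>+ y, x' \<^bold>+ y') \<in> alg_cong G R"
| times_cong: "(x, x') \<in> alg_cong G R \<Longrightarrow> (y, y') \<in> alg_cong G R
    \<Longrightarrow> (x \<^bold>* y, x' \<^bold>* y') \<in> alg_cong G R"
| plus_assoc: "x \<in> aterms G \<Longrightarrow> y \<in> aterms G \<Longrightarrow> z \<in> aterms G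
    \<Longrightarrow> (x \<^bold>+ y \<^bold>+ z, x \<^bold>+ (y \<^bold>+ z)) \<in> alg_cong G R"
| plus_comm: "x \<in> aterms G \<Longrightarrow> y \<in> aterms G \<Longrightarrow> (x \<^bold>+ y, y \<^bold>+ x) \<in> alg_cong G R"
| plus_zero: "x \<in> aterms G \<Longrightarrow> (Scalar 0 \<^bold>+ x, x) \<in> alg_cong G R"
| plus_inverse: "x \<in> aterms G \<Longrightarrow> (Scalar (- 1) \<^bold>* x \<^bold>+ x, Scalar 0) \<in> alg_cong G R"
| times_assoc: "x \<in> aterms G \<Longrightarrow> y \<in> aterms G \<Longrightarrow> z \<in> aterms G
    \<Longrightarrow> (x \<^bold>* y \<^bold>* z, x \<^bold>* (y \<^bold>* z)) \<in> alg_cong G R"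
| times_one: "x \<in> aterms G \<Longrightarrow> (Scalar 1 \<^bold>* x, x) \<in> alg_cong G R"
| distrib_right: "x \<in> aterms G \<Longrightarrow> y \<in> aterms G \<Longrightarrow> z \<in> aterms G
    \<Longrightarrow> ((x \<^bold>+ y) \<^bold>* z, x \<^bold>* z \<^bold>+ y \<^bold>* z) \<in> alg_cong G R"
| distrib_left: "x \<in> aterms G \<Longrightarrow> y \<in> aterms G \<Longrightarrow> z \<in> aterms G
    \<Longrightarrow> (z \<^bold>* (x \<^bold>+ y), z \<^bold>* x \<^bold>+ z \<^bold>* y) \<in> alg_cong G R"
| scalar_plus: "(Scalar a \<^bold>+ Scalar b, Scalar (a + b)) \<in> alg_cong G R"
| scalar_times: "(Scalar a \<^bold>* Scalar b, Scalar (a * b)) \<in> alg_cong G R"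
| scalar_central: "x \<in> aterms G \<Longrightarrow> (Scalar a \<^bold>* x, x \<^bold>* Scalar a) \<in> alg_cong G R"

definition presented_algebra ::
  "'g set \<Rightarrow> (('k::field, 'g) aterm \<times> ('k, 'g) aterm) set \<Rightarrow> ('k, ('k, 'g) aterm set) module" where
  "presented_algebra G R = \<lparr>
     carrier = aterms G // alg_cong G R,
     mult = (\<lambda>X Y. \<Union>x\<in>X. \<Union>y\<in>Y. alg_cong G R `` {x \<^bold>* y}),
     one = alg_cong G R `` {Scalar 1},
     zero = alg_cong G R `` {Scalar 0},
     add = (\<lambda>X Y. \<Union>x\<in>X. \<Union>y\<in>Y. alg_cong G R `` {x \<^bold>+ y}),
     smult = (\<lambda>c X. \<Union>x\<in>X. alg_cong G R `` {Scalar c \<^bold>* x}) \<rparr>"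

lemma aterms_simps [simp]:
  "Scalar a \<in> aterms G" "Gen g \<in> aterms G \<longleftrightarrow> g \<in> G"
  "x \<^bold>+ y \<in> aterms G \<longleftrightarrow> x \<in> aterms G \<and> y \<in> aterms G"
  "x \<^bold>* y \<in> aterms G \<longleftrightarrow> x \<in> aterms G \<and> y \<in> aterms G"
  by (auto simp: aterms_def)

lemma alg_cong_closed:
  assumes "(x, y) \<in> alg_cong G R"
  shows "x \<in> aterms G \<and> y \<in> aterms G"
  using assms by induction auto

lemma equiv_alg_cong: "equiv (aterms G) (alg_cong G R)"
proof (rule equivI)
  show "alg_cong G R \<subseteq> aterms G \<times> aterms G"
    by (auto dest: alg_cong_closed)
  show "refl_on (aterms G) (alg_cong G R)"
    by (auto simp: refl_on_def intro: alg_cong.refl)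
  show "Relation.sym (alg_cong G R)"
    by (rule symI) (rule alg_cong.sym)
  show "Relation.trans (alg_cong G R)"
    by (rule transI) (rule alg_cong.trans)
qed

lemma alg_class_eq_iff:
  assumes "x \<in> aterms G" "y \<in> aterms G"
  shows "alg_cong G R `` {x} = alg_cong G R `` {y} \<longleftrightarrow> (x, y) \<in> alg_cong G R"
  using eq_equiv_class_iff[OF equiv_alg_cong assms] .

lemma presented_algebra_one: "\<one>\<^bsub>presented_algebra G R\<^esub> = alg_cong G R `` {Scalar 1}"
  and presented_algebra_zero: "\<zero>\<^bsub>presented_algebra G R\<^esub> = alg_cong G R `` {Scalar 0}"
  and presented_algebra_carrier: "carrier (presented_algebra G R) = aterms G // alg_cong G R"
  by (simp_all add: presented_algebra_def)

lemma presented_algebra_mult: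
  assumes "x \<in> aterms G" "y \<in> aterms G"
  shows "alg_cong G R `` {x} \<otimes>\<^bsub>presented_algebra G R\<^esub> alg_cong G R `` {y}
    = alg_cong G R `` {x \<^bold>* y}"
proof -
  have "(\<lambda>x y. alg_cong G R `` {x \<^bold>* y}) respects2 alg_cong G R"
    by (rule congruent2I'; rule equiv_class_eq[OF equiv_alg_cong]; rule alg_cong.times_cong)
  from UN_equiv_class2[OF equiv_alg_cong equiv_alg_cong this assms]
  show ?thesis by (simp add: presented_algebra_def)
qed

lemma presented_algebra_add:
  assumes "x \<in> aterms G" "y \<in> aterms G"
  shows "alg_cong G R `` {x} \<oplus>\<^bsub>presented_algebra G R\<^esub> alg_cong G R `` {y}
    = alg_cong G R `` {x \<^bold>+ y}"
proof -
  have "(\<lambda>x y. alg_cong G R `` {x \<^bold>+ y}) respects2 alg_cong G R"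
    by (rule congruent2I'; rule equiv_class_eq[OF equiv_alg_cong]; rule alg_cong.plus_cong)
  from UN_equiv_class2[OF equiv_alg_cong equiv_alg_cong this assms]
  show ?thesis by (simp add: presented_algebra_def)
qed

lemma presented_algebra_smult:
  assumes "x \<in> aterms G"
  shows "c \<odot>\<^bsub>presented_algebra G R\<^esub> alg_cong G R `` {x} = alg_cong G R `` {Scalar c \<^bold>* x}"
proof -
  have "(\<lambda>x. alg_cong G R `` {Scalar c \<^bold>* x}) respects alg_cong G R"
    by (auto intro!: congruentI equiv_class_eq[OF equiv_alg_cong] alg_cong.times_cong alg_cong.refl)
  from UN_equiv_class[OF equiv_alg_cong this assms]
  show ?thesis by (simp add: presented_algebra_def)
qed

lemma presented_algebra_ring: "ring (presented_algebra G R)"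
proof -
  let ?A = "presented_algebra G R" and ?c = "\<lambda>x. alg_cong G R `` {x}"
  have rep: "\<exists>x\<in>aterms G. X = ?c x" if "X \<in> carrier ?A" for X
    using that by (auto simp: presented_algebra_carrier elim: quotientE)
  have cl: "?c x \<in> carrier ?A" if "x \<in> aterms G" for x
    using that by (auto simp: presented_algebra_carrier intro: quotientI)
  note ops = presented_algebra_mult presented_algebra_add presented_algebra_one
    presented_algebra_zero cl
  note eqI = equiv_class_eq[OF equiv_alg_cong]
  have one_r: "(x \<^bold>* Scalar 1, x) \<in> alg_cong G R" if "x \<in> aterms G" for x
    using alg_cong.trans[OF alg_cong.sym[OF alg_cong.scalar_central] alg_cong.times_one] that by blast
  note eqs = eqI[OF alg_cong.plus_assoc] eqI[OF alg_cong.plus_zero] eqI[OF alg_cong.times_assoc]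
    eqI[OF alg_cong.times_one] eqI[OF alg_cong.distrib_right] eqI[OF alg_cong.distrib_left]
    eqI[OF one_r]
  show ?thesis
  proof (intro ringI abelian_groupI monoidI)
    fix X assume "X \<in> carrier ?A"
    then obtain x where x: "x \<in> aterms G" "X = ?c x" using rep by blast
    show "\<exists>Y\<in>carrier ?A. Y \<oplus>\<^bsub>?A\<^esub> X = \<zero>\<^bsub>?A\<^esub>"
    proof (rule bexI)
      show "?c (Scalar (- 1) \<^bold>* x) \<oplus>\<^bsub>?A\<^esub> X = \<zero>\<^bsub>?A\<^esub>"
        using x by (simp add: ops eqI[OF alg_cong.plus_inverse])
    qed (use x in \<open>simp add: cl\<close>)
  next
    fix X Y assume "X \<in> carrier ?A" "Y \<in> carrier ?A"
    then obtain x y where "x \<in> aterms G" "X = ?c x" "y \<in> aterms G" "Y = ?c y"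
      using rep by meson
    then show "X \<oplus>\<^bsub>?A\<^esub> Y = Y \<oplus>\<^bsub>?A\<^esub> X"
      by (simp add: ops eqI[OF alg_cong.plus_comm[of x G y]])
  qed (auto dest!: rep simp: ops eqs)
qed

section \<open>The cyclotomic Hecke algebra\<close>

datatype hecke_gen = Tau | Sigma nat

definition hecke_gens :: "nat \<Rightarrow> hecke_gen set" where
  "hecke_gens n = insert Tau (Sigma ` {1..<n})"

abbreviation \<tau>\<^sub>t :: "('k, hecke_gen) aterm" where
  "\<tau>\<^sub>t \<equiv> Gen Tau"

abbreviation \<sigma>\<^sub>t :: "nat \<Rightarrow> ('k, hecke_gen) aterm" where
  "\<sigma>\<^sub>t i \<equiv> Gen (Sigma i)"

definition cyclotomic_term :: "('m::{finite,linorder} \<Rightarrow> 'k::field) \<Rightarrow> ('k, hecke_gen) aterm" where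
  "cyclotomic_term v =
     foldr (\<lambda>k t. (\<tau>\<^sub>t \<^bold>+ Scalar (- v k)) \<^bold>* t) (sorted_list_of_set UNIV) (Scalar 1)"

definition hecke_rels :: "nat \<Rightarrow> 'k::field \<Rightarrow> ('m::{finite,linorder} \<Rightarrow> 'k)
    \<Rightarrow> (('k, hecke_gen) aterm \<times> ('k, hecke_gen) aterm) set" where
  "hecke_rels n q v =
     {(\<sigma>\<^sub>t i \<^bold>* \<sigma>\<^sub>t (i + 1) \<^bold>* \<sigma>\<^sub>t i, \<sigma>\<^sub>t (i + 1) \<^bold>* \<sigma>\<^sub>t i \<^bold>* \<sigma>\<^sub>t (i + 1)) | i. 1 \<le> i \<and> i + 1 < n}
   \<union> {(\<sigma>\<^sub>t i \<^bold>* \<sigma>\<^sub>t j, \<sigma>\<^sub>t j \<^bold>* \<sigma>\<^sub>t i) | i j.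
        i \<in> {1..<n} \<and> j \<in> {1..<n} \<and> \<bar>int i - int j\<bar> > 1}
   \<union> {(\<tau>\<^sub>t \<^bold>* \<sigma>\<^sub>t 1 \<^bold>* \<tau>\<^sub>t \<^bold>* \<sigma>\<^sub>t 1, \<sigma>\<^sub>t 1 \<^bold>* \<tau>\<^sub>t \<^bold>* \<sigma>\<^sub>t 1 \<^bold>* \<tau>\<^sub>t) | i. i = 1 \<and> i < n}
   \<union> {(\<tau>\<^sub>t \<^bold>* \<sigma>\<^sub>t i, \<sigma>\<^sub>t i \<^bold>* \<tau>\<^sub>t) | i. 1 < i \<and> i < n}
   \<union> {(\<sigma>\<^sub>t i \<^bold>* \<sigma>\<^sub>t i, Scalar (q - inverse q) \<^bold>* \<sigma>\<^sub>t i \<^bold>+ Scalar 1) | i. i \<in> {1..<n}}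
   \<union> {(cyclotomic_term v, Scalar 0)}"

type_synonym 'k hecke_elem = "('k, hecke_gen) aterm set"

definition hecke_algebra ::
  "nat \<Rightarrow> 'k::field \<Rightarrow> ('m::{finite,linorder} \<Rightarrow> 'k) \<Rightarrow> ('k, 'k hecke_elem) module" where
  "hecke_algebra n q v = presented_algebra (hecke_gens n) (hecke_rels n q v)"

definition hecke_tau :: "nat \<Rightarrow> 'k::field \<Rightarrow> ('m::{finite,linorder} \<Rightarrow> 'k) \<Rightarrow> 'k hecke_elem" where
  "hecke_tau n q v = alg_cong (hecke_gens n) (hecke_rels n q v) `` {\<tau>\<^sub>t}"

definition hecke_sigma ::
  "nat \<Rightarrow> 'k::field \<Rightarrow> ('m::{finite,linorder} \<Rightarrow> 'k) \<Rightarrow> nat \<Rightarrow> 'k hecke_elem" where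
  "hecke_sigma n q v i = alg_cong (hecke_gens n) (hecke_rels n q v) `` {\<sigma>\<^sub>t i}"

text \<open>The value at index \<open>0\<close> is a dummy; only the indices \<open>1, \<dots>, n\<close> are used.\<close>

fun jucys_murphy ::
  "nat \<Rightarrow> 'k::field \<Rightarrow> ('m::{finite,linorder} \<Rightarrow> 'k) \<Rightarrow> nat \<Rightarrow> 'k hecke_elem" where
  "jucys_murphy n q v 0 = \<one>\<^bsub>hecke_algebra n q v\<^esub>"
| "jucys_murphy n q v (Suc 0) = hecke_tau n q v"
| "jucys_murphy n q v (Suc (Suc i)) =
     hecke_sigma n q v (Suc i) \<otimes>\<^bsub>hecke_algebra n q v\<^esub> jucys_murphy n q v (Suc i)
       \<otimes>\<^bsub>hecke_algebra n q v\<^esub> hecke_sigma n q v (Suc i)"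

section \<open>Representations\<close>

definition representation :: "('k::field, 'h) module \<Rightarrow> nat \<Rightarrow> ('h \<Rightarrow> 'k mat) \<Rightarrow> bool" where
  "representation A d \<rho> \<longleftrightarrow> \<rho> \<in> Ring.ring_hom A (ring_mat TYPE('k) d ()) \<and>
     (\<forall>c. \<forall>x\<in>carrier A. \<rho> (c \<odot>\<^bsub>A\<^esub> x) = c \<cdot>\<^sub>m \<rho> x)"

definition diagonalizable :: "'k::field mat \<Rightarrow> bool" where
  "diagonalizable A \<longleftrightarrow> (\<exists>D. diagonal_mat D \<and> similar_mat A D)"

inductive_set subalgebra_generated :: "('k, 'h) module \<Rightarrow> 'h set \<Rightarrow> 'h set"
  for A :: "('k, 'h) module" and S :: "'h set"
where
  one: "\<one>\<^bsub>A\<^esub> \<in> subalgebra_generated A S"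
| incl: "x \<in> S \<Longrightarrow> x \<in> subalgebra_generated A S"
| add: "x \<in> subalgebra_generated A S \<Longrightarrow> y \<in> subalgebra_generated A S
    \<Longrightarrow> x \<oplus>\<^bsub>A\<^esub> y \<in> subalgebra_generated A S"
| mult: "x \<in> subalgebra_generated A S \<Longrightarrow> y \<in> subalgebra_generated A S
    \<Longrightarrow> x \<otimes>\<^bsub>A\<^esub> y \<in> subalgebra_generated A S"
| smult: "x \<in> subalgebra_generated A S \<Longrightarrow> c \<odot>\<^bsub>A\<^esub> x \<in> subalgebra_generated A S"

definition invariant_subspace :: "nat \<Rightarrow> 'k::field mat set \<Rightarrow> 'k vec set \<Rightarrow> bool" where
  "invariant_subspace d \<A> W \<longleftrightarrow> VectorSpace.subspace class_ring W (module_vec TYPE('k) d) \<and>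
     (\<forall>X\<in>\<A>. \<forall>w\<in>W. X *\<^sub>v w \<in> W)"

definition completely_reducible :: "nat \<Rightarrow> 'k::field mat set \<Rightarrow> bool" where
  "completely_reducible d \<A> \<longleftrightarrow>
     (\<forall>W. invariant_subspace d \<A> W \<longrightarrow>
        (\<exists>W'. invariant_subspace d \<A> W' \<and> W \<inter> W' = {0\<^sub>v d} \<and>
              {w + w' | w w'. w \<in> W \<and> w' \<in> W'} = carrier_vec d))"

definition C_representation :: "nat \<Rightarrow> 'k::field \<Rightarrow> ('m::{finite,linorder} \<Rightarrow> 'k)
    \<Rightarrow> nat \<Rightarrow> ('k hecke_elem \<Rightarrow> 'k mat) \<Rightarrow> bool" where
  "C_representation n q v d \<rho> \<longleftrightarrow>
     representation (hecke_algebra n q v) d \<rho> \<and>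
     (\<forall>i\<in>{1..n}. diagonalizable (\<rho> (jucys_murphy n q v i))) \<and>
     (\<forall>i\<in>{1..<n}. completely_reducible d
        (\<rho> ` subalgebra_generated (hecke_algebra n q v)
              {jucys_murphy n q v i, jucys_murphy n q v (i + 1), hecke_sigma n q v i}))"

definition Spec :: "nat \<Rightarrow> 'k::field \<Rightarrow> ('m::{finite,linorder} \<Rightarrow> 'k) \<Rightarrow> (nat \<Rightarrow> 'k) set" where
  "Spec n q v = {a \<in> {1..n} \<rightarrow>\<^sub>E UNIV. \<exists>d \<rho>. C_representation n q v d \<rho> \<and>
     (\<exists>e\<in>carrier_vec d. e \<noteq> 0\<^sub>v d \<and>
        (\<forall>i\<in>{1..n}. \<rho> (jucys_murphy n q v i) *\<^sub>v e = a i \<cdot>\<^sub>v e))}"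

section \<open>Content strings\<close>

text \<open>
  In \<open>c2\<close> the entry \<open>a j\<close> is required to be of the form \<open>v\<^sub>k q\<^sup>2\<^sup>z\<close>, and the condition on
  earlier entries applies to such a presentation with \<open>z \<noteq> 0\<close>. Presentations need not be unique for
  special parameters (\<open>q\<close> a root of unity of large order, or \<open>v\<^sub>2 = v\<^sub>1 q\<^sup>2\<^sup>n\<close>): there the
  presentation is existentially quantified, since an entry equal to some \<open>v\<^sub>k\<close> must be allowed
  to start a new component even though it may also equal \<open>v\<^sub>l q\<^sup>2\<^sup>z\<close> with \<open>z \<noteq> 0\<close>.
  Lemma \<open>Cont_eq_of_unique_presentation\<close> below gives the form of \<open>c2\<close> for unique presentations.
\<close>

definition Cont :: "nat \<Rightarrow> 'k::field \<Rightarrow> ('m \<Rightarrow> 'k) \<Rightarrow> (nat \<Rightarrow> 'k) set" where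
  "Cont n q v = {a \<in> {1..n} \<rightarrow>\<^sub>E UNIV.
     \<comment> \<open>c1\<close> a 1 \<in> range v \<and>
     \<comment> \<open>c2\<close> (\<forall>j\<in>{1<..n}. \<exists>k (z::int). a j = v k * q powi (2 * z) \<and>
       (z \<noteq> 0 \<longrightarrow> {v k * q powi (2 * (z - 1)), v k * q powi (2 * (z + 1))} \<inter> a ` {1..<j} \<noteq> {})) \<and>
     \<comment> \<open>c3\<close> (\<forall>i\<in>{1..n}. \<forall>j\<in>{1..n}. \<forall>k (z::int).
       i < j \<and> a i = a j \<and> a j = v k * q powi (2 * z) \<longrightarrow>
       {v k * q powi (2 * (z - 1)), v k * q powi (2 * (z + 1))} \<subseteq> a ` {i<..<j})}"

lemma Cont_eq_of_unique_presentation: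
  fixes q :: "'k::field" and v :: "'m \<Rightarrow> 'k"
  assumes unique: "\<And>k l y z. v k * q powi (2 * y) = v l * q powi (2 * z) \<Longrightarrow> k = l \<and> y = z"
    and "1 \<le> n"
  shows "Cont n q v = {a \<in> {1..n} \<rightarrow>\<^sub>E {v k * q powi (2 * z) | k z. True}.
     a 1 \<in> range v \<and>
     (\<forall>j\<in>{1<..n}. \<forall>k (z::int). a j = v k * q powi (2 * z) \<and> z \<noteq> 0 \<longrightarrow>
       {v k * q powi (2 * (z - 1)), v k * q powi (2 * (z + 1))} \<inter> a ` {1..<j} \<noteq> {}) \<and>
     (\<forall>i\<in>{1..n}. \<forall>j\<in>{1..n}. \<forall>k (z::int).
       i < j \<and> a i = a j \<and> a j = v k * q powi (2 * z) \<longrightarrow>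
       {v k * q powi (2 * (z - 1)), v k * q powi (2 * (z + 1))} \<subseteq> a ` {i<..<j})}"
    (is "_ = {a \<in> _ \<rightarrow>\<^sub>E ?V. _ \<and> ?c2 a \<and> _}")
proof -
  have form: "a \<in> {1..n} \<rightarrow>\<^sub>E UNIV \<and> a 1 \<in> range v \<and>
      (\<forall>j\<in>{1<..n}. \<exists>k (z::int). a j = v k * q powi (2 * z) \<and>
       (z \<noteq> 0 \<longrightarrow> {v k * q powi (2 * (z - 1)), v k * q powi (2 * (z + 1))} \<inter> a ` {1..<j} \<noteq> {}))
    \<longleftrightarrow> a \<in> {1..n} \<rightarrow>\<^sub>E ?V \<and> a 1 \<in> range v \<and> ?c2 a" (is "?L \<longleftrightarrow> ?R") for a
  proof
    assume L: ?L
    have "a j \<in> ?V" if "j \<in> {1..n}" for j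
    proof (cases "j = 1")
      case True
      with L obtain k where "a j = v k * q powi (2 * 0)" by auto
      then show ?thesis by blast
    next
      case False
      with that have "j \<in> {1<..n}" by auto
      with L obtain k z where "a j = v k * q powi (2 * z)" by meson
      then show ?thesis by blast
    qed
    moreover have "?c2 a"
    proof (intro ballI allI impI)
      fix j k and z :: int
      assume j: "j \<in> {1<..n}" and az: "a j = v k * q powi (2 * z) \<and> z \<noteq> 0"
      from L j obtain l y where ly: "a j = v l * q powi (2 * y)"
        "y \<noteq> 0 \<longrightarrow> {v l * q powi (2 * (y - 1)), v l * q powi (2 * (y + 1))} \<inter> a ` {1..<j} \<noteq> {}"
        by meson
      have "v k * q powi (2 * z) = v l * q powi (2 * y)" using az ly(1) by metis
      then have "k = l \<and> z = y" by (rule unique)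
      with az ly(2)
      show "{v k * q powi (2 * (z - 1)), v k * q powi (2 * (z + 1))} \<inter> a ` {1..<j} \<noteq> {}" by blast
    qed
    moreover have "a \<in> extensional {1..n}"
      using L by (simp add: PiE_iff)
    ultimately show ?R using L by (simp only: PiE_iff) simp
  next
    assume R: ?R
    have "\<exists>k (z::int). a j = v k * q powi (2 * z) \<and>
       (z \<noteq> 0 \<longrightarrow> {v k * q powi (2 * (z - 1)), v k * q powi (2 * (z + 1))} \<inter> a ` {1..<j} \<noteq> {})"
      if j: "j \<in> {1<..n}" for j
    proof -
      from R have P: "a \<in> {1..n} \<rightarrow>\<^sub>E ?V" and c2: "?c2 a" by simp_all
      from j have "j \<in> {1..n}" by simp
      with P have "a j \<in> ?V" by (rule PiE_mem)
      then obtain k z where az: "a j = v k * q powi (2 * z)" by blast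
      with c2[rule_format, OF j, of k z] show ?thesis
        by (intro exI[of _ k] exI[of _ z]) simp
    qed
    moreover have "a \<in> {1..n} \<rightarrow>\<^sub>E UNIV"
      using R by (simp add: PiE_iff)
    ultimately show ?L using R by simp
  qed
  show ?thesis unfolding Cont_def
    by (simp only: conj_assoc[symmetric] form[unfolded conj_assoc[symmetric]])
qed

section \<open>Standard tableaux\<close>

definition is_partition :: "nat list \<Rightarrow> bool" where
  "is_partition p \<longleftrightarrow> sorted_wrt (\<ge>) p \<and> 0 \<notin> set p"

definition m_partitions :: "nat \<Rightarrow> ('m::finite \<Rightarrow> nat list) set" where
  "m_partitions n = {p. (\<forall>k. is_partition (p k)) \<and> (\<Sum>k\<in>UNIV. sum_list (p k)) = n}"

text \<open>A node \<open>(k, r, c)\<close> lies in row \<open>r\<close> and column \<open>c\<close> (counted from \<open>0\<close>) of the diagram \<open>p k\<close>.\<close>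

definition nodes :: "('m \<Rightarrow> nat list) \<Rightarrow> ('m \<times> nat \<times> nat) set" where
  "nodes p = {(k, r, c). r < length (p k) \<and> c < p k ! r}"

definition standard_tableaux :: "nat \<Rightarrow> (('m::finite \<Rightarrow> nat list) \<times> ('m \<times> nat \<times> nat \<Rightarrow> nat)) set" where
  "standard_tableaux n = {(p, T). p \<in> m_partitions n \<and>
     T \<in> nodes p \<rightarrow>\<^sub>E {1..n} \<and> bij_betw T (nodes p) {1..n} \<and>
     (\<forall>k r c c'. (k, r, c) \<in> nodes p \<and> (k, r, c') \<in> nodes p \<and> c < c' \<longrightarrow> T (k, r, c) < T (k, r, c')) \<and>
     (\<forall>k r r' c. (k, r, c) \<in> nodes p \<and> (k, r', c) \<in> nodes p \<and> r < r' \<longrightarrow> T (k, r, c) < T (k, r', c))}"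

section \<open>Parameters\<close>

text \<open>
  These conditions do not exclude \<open>q\<^sup>2 = 1\<close>. In that case the Jucys--Murphy elements only have the
  eigenvalues \<open>v\<^sub>k\<close>, so for \<open>n \<ge> 2\<close> they do not separate standard tableaux.
\<close>

definition admissible :: "nat \<Rightarrow> complex \<Rightarrow> ('m \<Rightarrow> complex) \<Rightarrow> bool" where
  "admissible n q v \<longleftrightarrow> q \<noteq> 0 \<and>
     (\<forall>N<n. (\<Sum>l\<le>N. q ^ (2 * l)) \<noteq> 0) \<and>
     (\<forall>i j k. j \<noteq> k \<and> - int n < i \<and> i < int n \<longrightarrow> q powi (2 * i) * v j - v k \<noteq> 0) \<and>
     (\<forall>j. v j \<noteq> 0)"

text \<open>
  The field of rational functions in \<open>q\<close> and \<open>v\<^sub>k\<close> (\<open>k :: 'm\<close>) over the complex numbers, as the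
  fraction field of the polynomial ring in the \<open>v\<^sub>k\<close> with coefficients in the
  univariate polynomial ring in \<open>q\<close>.
\<close>

type_synonym 'm generic_field = "(('m \<Rightarrow>\<^sub>0 nat) \<Rightarrow>\<^sub>0 complex poly) fract"

definition generic_q :: "'m::linorder generic_field" where
  "generic_q = Fract (Poly_Mapping.single 0 [:0, 1:]) 1"

definition generic_v :: "'m::linorder \<Rightarrow> 'm generic_field" where
  "generic_v k = Fract (Poly_Mapping.single (Poly_Mapping.single k 1) 1) 1"

end

theory Submission
  imports Defs "HOL-Combinatorics.Transposition"
begin

text \<open>
  The spectrum equals the set of content strings. Let \<open>e\<close> be a joint eigenvector with eigenvalues
  \<open>a\<^sub>1, \<dots>, a\<^sub>n\<close>. Diagonalizability of \<open>J\<^sub>i\<^sub>+\<^sub>1\<close> forces \<open>a\<^sub>i \<noteq> a\<^sub>i\<^sub>+\<^sub>1\<close>; if \<open>a\<^sub>i\<close> and \<open>a\<^sub>i\<^sub>+\<^sub>1\<close>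
  differ by a factor \<open>q\<^sup>2\<close> (are linked), complete reducibility makes \<open>e\<close> an eigenvector of \<open>\<sigma>\<^sub>i\<close>, and
  otherwise a combination of \<open>e\<close> and \<open>\<sigma>\<^sub>i e\<close> has the string with \<open>a\<^sub>i\<close> and \<open>a\<^sub>i\<^sub>+\<^sub>1\<close> exchanged. By the
  braid relation no string contains \<open>x, y, x\<close> with \<open>x, y\<close> linked, and the conditions defining
  content strings follow by moving entries. Conversely, Young's seminormal form defines a
  representation with a basis indexed by all content strings.

  A standard tableau is a growing sequence of diagrams, and it is mapped to the sequence of the
  contents of the added nodes. The assumptions on the parameters imply that the contents of the
  addable nodes of a diagram with less than \<open>n\<close> nodes are distinct, and the content string
  conditions say that each entry is the content of an addable node.
\<close>

section \<open>Content strings\<close>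

text \<open>A field element may have several presentations v_k q^(2z), so the content conditions are
  restated through the relation \<open>linked\<close> between field elements, which mentions neither
  k nor z. The spectrum depends on local conditions only: q^2 \<noteq> 1 makes q - 1/q nonzero, so
  that equal adjacent eigenvalues would produce a Jordan chain, and q^4 \<noteq> 1 lets the braid
  relation exclude x, y, x. The comparison with tableaux needs more, namely that nodes on different
  diagonals have different contents. A hook count bounds how far apart the diagonals of a diagram
  can be, and these bounds match the exponents separated by the parameters. A single representation
  on functions of all content strings realizes every string at once, so the first bijection is the
  identity.\<close>

definition linked :: "'k::field \<Rightarrow> 'k \<Rightarrow> 'k \<Rightarrow> bool" where
  "linked q x y \<longleftrightarrow> y = q\<^sup>2 * x \<or> x = q\<^sup>2 * y"

lemma linked_sym: "linked q x y \<longleftrightarrow> linked q y x"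
  by (auto simp: linked_def)

lemma powi_shift:
  fixes q :: "'k::field"
  assumes "q \<noteq> 0"
  shows "x * q powi (2 * (z + 1)) = q\<^sup>2 * (x * q powi (2 * z))"
    and "q\<^sup>2 * (x * q powi (2 * (z - 1))) = x * q powi (2 * z)"
proof -
  have "q powi (2 * (z + 1)) = q powi (2 * z) * q powi 2"
    using assms by (subst power_int_add[symmetric]) (auto simp: algebra_simps)
  then show "x * q powi (2 * (z + 1)) = q\<^sup>2 * (x * q powi (2 * z))"
    by (simp add: power_int_def algebra_simps)
  have "q powi (2 * z) = q powi (2 * (z - 1)) * q powi 2"
    using assms by (subst power_int_add[symmetric]) (auto simp: algebra_simps)
  then show "q\<^sup>2 * (x * q powi (2 * (z - 1))) = x * q powi (2 * z)"
    by (simp add: power_int_def algebra_simps)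
qed

lemma powi_pred_eq_iff:
  fixes q :: "'k::field"
  assumes "q \<noteq> 0"
  shows "y = x * q powi (2 * (z - 1)) \<longleftrightarrow> q\<^sup>2 * y = x * q powi (2 * z)"
  unfolding powi_shift(2)[OF assms, of x z, symmetric] using assms by simp

text \<open>Whatever presentation of a value x is chosen, its two neighbours are q^2 x and q^(-2) x.
  Hence k and z can be eliminated from the conditions, and the ambiguity of presentations becomes
  harmless.\<close>

lemma Cont_iff:
  fixes q :: "'k::field" and v :: "'m \<Rightarrow> 'k"
  assumes q: "q \<noteq> 0" and n: "1 \<le> n"
  shows "a \<in> Cont n q v \<longleftrightarrow> a \<in> {1..n} \<rightarrow>\<^sub>E UNIV
    \<and> (\<forall>j\<in>{1..n}. a j \<in> range v \<or> (\<exists>l\<in>{1..<j}. linked q (a l) (a j)))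
    \<and> (\<forall>i\<in>{1..n}. \<forall>j\<in>{1..n}. i < j \<longrightarrow> a i = a j \<longrightarrow>
        (\<exists>l\<in>{i<..<j}. a l = q\<^sup>2 * a j) \<and> (\<exists>l\<in>{i<..<j}. q\<^sup>2 * a l = a j))"
    (is "_ \<longleftrightarrow> ?P a \<and> ?c2 a \<and> ?c3 a")
proof
  assume "a \<in> Cont n q v"
  note C = this[unfolded Cont_def mem_Collect_eq]
  have P: "?P a" and c1: "a 1 \<in> range v" using C by blast+
  have c2: "\<And>j. j \<in> {1<..n} \<Longrightarrow> \<exists>k (z::int). a j = v k * q powi (2 * z) \<and>
       (z \<noteq> 0 \<longrightarrow> {v k * q powi (2 * (z - 1)), v k * q powi (2 * (z + 1))} \<inter> a ` {1..<j} \<noteq> {})"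
    using C by blast
  have c3: "\<And>i j k (z::int). i \<in> {1..n} \<Longrightarrow> j \<in> {1..n} \<Longrightarrow> i < j \<Longrightarrow> a i = a j \<Longrightarrow>
       a j = v k * q powi (2 * z) \<Longrightarrow>
       {v k * q powi (2 * (z - 1)), v k * q powi (2 * (z + 1))} \<subseteq> a ` {i<..<j}"
    using C by blast
  have "a j \<in> range v \<or> (\<exists>l\<in>{1..<j}. linked q (a l) (a j))" if "j \<in> {1..n}" for j
  proof (cases "j = 1")
    case False
    with that c2[of j] obtain k and z :: int where kz: "a j = v k * q powi (2 * z)"
      "z \<noteq> 0 \<longrightarrow> {v k * q powi (2 * (z - 1)), v k * q powi (2 * (z + 1))} \<inter> a ` {1..<j} \<noteq> {}"
      by auto
    show ?thesis
    proof (cases "z = 0")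
      case False
      with kz(2) obtain l where "l \<in> {1..<j}"
        "a l = v k * q powi (2 * (z - 1)) \<or> a l = v k * q powi (2 * (z + 1))" by auto
      then show ?thesis
        unfolding powi_pred_eq_iff[OF q] powi_shift(1)[OF q] kz(1)[symmetric] linked_def by metis
    qed (use kz in auto)
  qed (use c1 in auto)
  moreover have "(\<exists>l\<in>{i<..<j}. a l = q\<^sup>2 * a j) \<and> (\<exists>l\<in>{i<..<j}. q\<^sup>2 * a l = a j)"
    if ij: "i \<in> {1..n}" "j \<in> {1..n}" "i < j" "a i = a j" for i j
  proof -
    have "1 < j" using ij by auto
    with c2[of j] ij obtain k and z :: int where kz: "a j = v k * q powi (2 * z)" by auto
    from c3[OF ij kz] have "v k * q powi (2 * (z - 1)) \<in> a ` {i<..<j}"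
      "v k * q powi (2 * (z + 1)) \<in> a ` {i<..<j}" by auto
    then obtain l l' where "l \<in> {i<..<j}" "a l = v k * q powi (2 * (z - 1))"
      "l' \<in> {i<..<j}" "a l' = v k * q powi (2 * (z + 1))" by (auto simp: image_iff)
    then show ?thesis
      unfolding powi_pred_eq_iff[OF q] powi_shift(1)[OF q] kz[symmetric] by blast
  qed
  ultimately show "?P a \<and> ?c2 a \<and> ?c3 a" using P by blast
next
  assume asm: "?P a \<and> ?c2 a \<and> ?c3 a"
  then have c2: "\<And>j. j \<in> {1..n} \<Longrightarrow> a j \<in> range v \<or> (\<exists>l\<in>{1..<j}. linked q (a l) (a j))"
    and c3: "?c3 a" by blast+
  \<comment> \<open>The right-hand side names no exponents, so a presentation must be rebuilt: links
    lead back to an entry in the range of v, and each link changes the exponent by one.\<close>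
  have form: "\<exists>k (z::int). a j = v k * q powi (2 * z)" if "j \<in> {1..n}" for j
    using that
  proof (induction j rule: less_induct)
    case (less j)
    from c2[OF less.prems] show ?case
    proof
      assume "a j \<in> range v"
      then obtain k where "a j = v k * q powi (2 * 0)" by auto
      then show ?thesis by blast
    next
      assume "\<exists>l\<in>{1..<j}. linked q (a l) (a j)"
      then obtain l where l: "l \<in> {1..<j}" "linked q (a l) (a j)" by blast
      with less obtain k and z :: int where kz: "a l = v k * q powi (2 * z)" by fastforce
      from l(2) have "a j = v k * q powi (2 * (z + 1)) \<or> a j = v k * q powi (2 * (z - 1))"
        unfolding powi_pred_eq_iff[OF q] powi_shift(1)[OF q] kz[symmetric] linked_def by metis
      then show ?thesis by blast
    qed
  qed
  have "a 1 \<in> range v" using c2[of 1] n by auto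
  moreover have "\<exists>k (z::int). a j = v k * q powi (2 * z) \<and>
       (z \<noteq> 0 \<longrightarrow> {v k * q powi (2 * (z - 1)), v k * q powi (2 * (z + 1))} \<inter> a ` {1..<j} \<noteq> {})"
    if j: "j \<in> {1<..n}" for j
  proof -
    have j': "j \<in> {1..n}" using j by auto
    from c2[OF j'] show ?thesis
    proof
      assume "a j \<in> range v"
      then obtain k where "a j = v k * q powi (2 * 0)" by auto
      then show ?thesis by blast
    next
      assume "\<exists>l\<in>{1..<j}. linked q (a l) (a j)"
      then obtain l where l: "l \<in> {1..<j}" "linked q (a l) (a j)" by blast
      from form[OF j'] obtain k and z :: int where kz: "a j = v k * q powi (2 * z)" by blast
      from l(2) have "a l = v k * q powi (2 * (z + 1)) \<or> a l = v k * q powi (2 * (z - 1))"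
        unfolding powi_pred_eq_iff[OF q] powi_shift(1)[OF q] kz[symmetric] linked_def by metis
      then have "a l \<in> {v k * q powi (2 * (z - 1)), v k * q powi (2 * (z + 1))} \<inter> a ` {1..<j}"
        using l(1) by blast
      then show ?thesis using kz by blast
    qed
  qed
  moreover have "{v k * q powi (2 * (z - 1)), v k * q powi (2 * (z + 1))} \<subseteq> a ` {i<..<j}"
    if ij: "i \<in> {1..n}" "j \<in> {1..n}" "i < j" "a i = a j"
      and kz: "a j = v k * q powi (2 * z)" for i j k and z :: int
  proof -
    from c3 ij obtain l l' where "l \<in> {i<..<j}" "a l = q\<^sup>2 * a j" "l' \<in> {i<..<j}" "q\<^sup>2 * a l' = a j"
      by metis
    moreover from this have "a l = v k * q powi (2 * (z + 1))" "a l' = v k * q powi (2 * (z - 1))"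
      unfolding powi_pred_eq_iff[OF q] powi_shift(1)[OF q] kz[symmetric] by auto
    ultimately show ?thesis by (metis image_eqI insert_subset empty_subsetI)
  qed
  ultimately show "a \<in> Cont n q v" using asm unfolding Cont_def by blast
qed

section \<open>Exchange of adjacent entries\<close>

definition swap_at :: "nat \<Rightarrow> (nat \<Rightarrow> 'k) \<Rightarrow> nat \<Rightarrow> 'k" where
  "swap_at i a = a \<circ> transpose i (Suc i)"

lemma swap_at_apply:
  "swap_at i a j = (if j = i then a (Suc i) else if j = Suc i then a i else a j)"
  by (simp add: swap_at_def transpose_def)

lemma swap_at_swap_at [simp]: "swap_at i (swap_at i a) = a"
  by (rule ext) (simp add: swap_at_apply)

lemma swap_at_PiE:
  assumes "a \<in> {1..n} \<rightarrow>\<^sub>E UNIV" "1 \<le> i" "i < n"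
  shows "swap_at i a \<in> {1..n} \<rightarrow>\<^sub>E UNIV"
  using assms by (auto simp: PiE_iff extensional_def swap_at_apply)

lemma swap_at_commute:
  "Suc i < j \<Longrightarrow> swap_at i (swap_at j a) = swap_at j (swap_at i a)"
  by (rule ext) (simp add: swap_at_apply)

lemma swap_at_braid:
  "swap_at i (swap_at (Suc i) (swap_at i a)) = swap_at (Suc i) (swap_at i (swap_at (Suc i) a))"
  by (rule ext) (simp add: swap_at_apply)

text \<open>Condition \<open>c3\<close> is proved by induction on the distance of two equal entries: an end
  entry that is not linked to its inner neighbour can be moved inwards, and if both are linked,
  the two inner neighbours are either the two required entries or again equal.\<close>

lemma exchange_closed_subset_Cont:
  fixes q :: "'k::field" and v :: "'m \<Rightarrow> 'k"
  assumes q: "q \<noteq> 0" and n: "1 \<le> n" and PiE: "S \<subseteq> {1..n} \<rightarrow>\<^sub>E UNIV"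
    and first: "\<And>a. a \<in> S \<Longrightarrow> a 1 \<in> range v"
    and adjacent: "\<And>a i. a \<in> S \<Longrightarrow> 1 \<le> i \<Longrightarrow> i < n \<Longrightarrow> a i \<noteq> a (Suc i)"
    and exchange: "\<And>a i. a \<in> S \<Longrightarrow> 1 \<le> i \<Longrightarrow> i < n \<Longrightarrow> \<not> linked q (a i) (a (Suc i)) \<Longrightarrow>
      swap_at i a \<in> S"
    and triple: "\<And>a i. a \<in> S \<Longrightarrow> 1 \<le> i \<Longrightarrow> Suc i < n \<Longrightarrow> linked q (a i) (a (Suc i)) \<Longrightarrow>
      a i \<noteq> a (Suc (Suc i))"
  shows "S \<subseteq> Cont n q v"
proof
  fix a assume "a \<in> S"
  have c2: "a j \<in> range v \<or> (\<exists>l\<in>{1..<j}. linked q (a l) (a j))" if "1 \<le> j" "j \<le> n" "a \<in> S" for a j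
    using that
  proof (induction j arbitrary: a rule: nat_induct_at_least)
    case base
    then show ?case using first by simp
  next
    case (Suc j)
    show ?case
    proof (cases "linked q (a j) (a (Suc j))")
      case True
      then show ?thesis using Suc.hyps by force
    next
      \<comment> \<open>The entry is moved one place to the left. A linked entry found in front of
        it there has the same position in \<open>a\<close>.\<close>
      case False
      with Suc have "swap_at j a \<in> S" by (intro exchange) auto
      with Suc.IH[of "swap_at j a"] Suc.prems show ?thesis
        by (fastforce simp: swap_at_apply)
    qed
  qed
  have c3: "(\<exists>l\<in>{i<..<j}. a l = q\<^sup>2 * a j) \<and> (\<exists>l\<in>{i<..<j}. q\<^sup>2 * a l = a j)"
    if "1 \<le> i" "i < j" "j \<le> n" "a \<in> S" "a i = a j" for a i j
    using that
  proof (induction "j - i" arbitrary: a i j rule: less_induct)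
    case less
    note IH = less.hyps
    have "Suc i \<noteq> j" using adjacent[of a i] less.prems by auto
    with less.prems have ij: "Suc i < j" by simp
    define b where "b = swap_at i a"
    define c where "c = swap_at (j - 1) a"
    consider l where "i < l" "l < j" "a l = a i" | "\<not> linked q (a i) (a (Suc i))"
      | "\<not> linked q (a (j - 1)) (a j)"
      | "linked q (a i) (a (Suc i))" "linked q (a (j - 1)) (a j)" "\<forall>l\<in>{i<..<j}. a l \<noteq> a i"
      by (cases "\<exists>l\<in>{i<..<j}. a l = a i") auto
    then show ?case
    proof cases
      case 1
      with IH[of l i a] less.prems show ?thesis by fastforce
    next
      case 2
      then have "b \<in> S" using exchange[of a i] less.prems by (simp add: b_def)
      with IH[of j "Suc i" b] ij less.prems show ?thesis
        by (fastforce simp: b_def swap_at_apply)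
    next
      case 3
      then have "c \<in> S" using exchange[of a "j - 1"] less.prems ij by (simp add: c_def)
      have eqs: "c (j - 1) = a j" "c i = a i" "\<forall>l<j - 1. c l = a l"
        using ij by (auto simp: c_def swap_at_apply)
      show ?thesis
        using IH[of "j - 1" i c] \<open>c \<in> S\<close> ij less.prems eqs by fastforce
    next
      case 4
      have "Suc (Suc i) \<noteq> j" using triple[of a i] 4 less.prems by auto
      with ij have ij': "Suc i < j - 1" by simp
      have mem: "Suc i \<in> {i<..<j}" "j - 1 \<in> {i<..<j}" using ij by auto
      show ?thesis
      proof (cases "a (Suc i) = a (j - 1)")
        case True
        have "(\<exists>l\<in>{Suc i<..<j - 1}. a l = q\<^sup>2 * a (j - 1)) \<and> (\<exists>l\<in>{Suc i<..<j - 1}. q\<^sup>2 * a l = a (j - 1))"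
          by (rule IH) (use True ij' less.prems in auto)
        then obtain l l' where
          l: "l \<in> {Suc i<..<j - 1}" "a l = q\<^sup>2 * a (j - 1)"
          "l' \<in> {Suc i<..<j - 1}" "q\<^sup>2 * a l' = a (j - 1)" by blast
        \<comment> \<open>The common value x of the inner neighbours is linked to
          \<open>a i\<close>, so q^2 x or q^(-2) x equals \<open>a i\<close>. Both occur strictly
          inside, where no entry equals \<open>a i\<close>, which is a contradiction.\<close>
        then have "a l \<noteq> a i" "a l' \<noteq> a i" using 4(3) by auto
        then show ?thesis using 4(2) l q less.prems(5) by (auto simp: linked_def)
      next
        case False
        then show ?thesis using 4(1,2) mem less.prems(5) q unfolding linked_def by auto
      qed
    qed
  qed
  show "a \<in> Cont n q v"
    unfolding Cont_iff[OF q n] using c2 c3 PiE \<open>a \<in> S\<close> by auto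
qed

lemma
  fixes q :: "'k::field" and v :: "'m \<Rightarrow> 'k"
  assumes q: "q \<noteq> 0" and a: "a \<in> Cont n q v" and j: "j \<le> n"
  shows Cont_linked: "1 \<le> j \<Longrightarrow> a j \<in> range v \<or> (\<exists>l\<in>{1..<j}. linked q (a l) (a j))"
    and Cont_between: "1 \<le> i \<Longrightarrow> i < j \<Longrightarrow> a i = a j \<Longrightarrow> \<exists>l>i. l < j \<and> a l = q\<^sup>2 * a j"
      "1 \<le> i \<Longrightarrow> i < j \<Longrightarrow> a i = a j \<Longrightarrow> \<exists>l>i. l < j \<and> q\<^sup>2 * a l = a j"
proof -
  show "a j \<in> range v \<or> (\<exists>l\<in>{1..<j}. linked q (a l) (a j))" if "1 \<le> j"
  proof -
    have n: "1 \<le> n" and j': "j \<in> {1..n}" using that j by auto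
    show ?thesis
      using a[unfolded Cont_iff[OF q n], THEN conjunct2, THEN conjunct1, rule_format, OF j'] .
  qed
  have "(\<exists>l\<in>{i<..<j}. a l = q\<^sup>2 * a j) \<and> (\<exists>l\<in>{i<..<j}. q\<^sup>2 * a l = a j)"
    if "1 \<le> i" "i < j" "a i = a j"
  proof -
    have n: "1 \<le> n" and ij: "i \<in> {1..n}" "j \<in> {1..n}" using that j by auto
    show ?thesis
      using a[unfolded Cont_iff[OF q n], THEN conjunct2, THEN conjunct2, rule_format, OF ij that(2,3)] .
  qed
  then show "\<exists>l>i. l < j \<and> a l = q\<^sup>2 * a j" "\<exists>l>i. l < j \<and> q\<^sup>2 * a l = a j"
    if "1 \<le> i" "i < j" "a i = a j" using that unfolding Bex_def greaterThanLessThan_iff by blast+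
qed

lemma Cont_adjacent_neq:
  fixes q :: "'k::field"
  assumes "q \<noteq> 0" "a \<in> Cont n q v" "1 \<le> i" "i < n"
  shows "a i \<noteq> a (Suc i)"
proof
  assume "a i = a (Suc i)"
  from Cont_between(1)[OF assms(1,2) _ _ _ this] assms show False by auto
qed

text \<open>The exchange can only do harm if one of the two entries is the witness that the other
  one requires in c2 or c3. Such a witness is linked to the entry that requires it.\<close>

lemma Cont_swap_at:
  fixes q :: "'k::field"
  assumes q: "q \<noteq> 0" and a: "a \<in> Cont n q v" and i: "1 \<le> i" "i < n"
    and unl: "\<not> linked q (a i) (a (Suc i))"
  shows "swap_at i a \<in> Cont n q v"
proof -
  have n: "1 \<le> n" using i by simp
  define b where "b = swap_at i a"
  have b: "b j = (if j = i then a (Suc i) else if j = Suc i then a i else a j)" for j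
    by (simp add: b_def swap_at_apply)
  note c2 = Cont_linked[OF q a] and c3 = Cont_between[OF q a]
  have neq: "a i \<noteq> a (Suc i)" using Cont_adjacent_neq[OF q a i] .
  \<comment> \<open>An open interval that does not separate the positions i and Suc i keeps its set
    of values; a value at one of them moves to the other.\<close>
  have im: "\<exists>l'. r < l' \<and> l' < s \<and> b l' = a l"
    if "r < l" "l < s" "r \<noteq> i" "s \<noteq> Suc i" for l r s
  proof (cases "l = i \<or> l = Suc i")
    case True
    with that have "b (if l = i then Suc i else i) = a l" "r < i" "Suc i < s" by (auto simp: b)
    then show ?thesis by (intro exI[of _ "if l = i then Suc i else i"]) auto
  next
    case False
    then have "b l = a l" by (auto simp: b)
    then show ?thesis using that by blast
  qed
  have B2: "b j \<in> range v \<or> (\<exists>l\<in>{1..<j}. linked q (b l) (b j))" if j: "1 \<le> j" "j \<le> n" for j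
  proof -
    consider "j = i" | "j = Suc i" | "j \<noteq> i" "j \<noteq> Suc i" by blast
    then show ?thesis
    proof cases
      case 1
      have "a (Suc i) \<in> range v \<or> (\<exists>l\<in>{1..<Suc i}. linked q (a l) (a (Suc i)))"
        by (rule c2) (use i in auto)
      then show ?thesis
      proof (elim disjE bexE)
        fix l assume l: "l \<in> {1..<Suc i}" "linked q (a l) (a (Suc i))"
        with unl have "l \<noteq> i" by blast
        with l 1 have "l \<in> {1..<j}" "linked q (b l) (b j)" by (auto simp: b)
        then show ?thesis by blast
      qed (use 1 in \<open>auto simp: b\<close>)
    next
      case 2
      have "a i \<in> range v \<or> (\<exists>l\<in>{1..<i}. linked q (a l) (a i))"
        by (rule c2) (use i in auto)
      then show ?thesis
      proof (elim disjE bexE)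
        fix l assume l: "l \<in> {1..<i}" "linked q (a l) (a i)"
        with 2 have "l \<in> {1..<j}" "linked q (b l) (b j)" by (auto simp: b)
        then show ?thesis by blast
      qed (use 2 in \<open>auto simp: b\<close>)
    next
      case 3
      have "b j = a j" using 3 by (simp add: b)
      from c2[OF j(2,1)] show ?thesis
      proof
        assume "\<exists>l\<in>{1..<j}. linked q (a l) (a j)"
        then obtain l where "l \<in> {1..<j}" and linked: "linked q (a l) (a j)" by blast
        then have l: "0 < l" "l < j" by auto
        have "0 \<noteq> i" using i by simp
        from im[OF l(1,2) this 3(2)] obtain l' where "0 < l'" "l' < j" "b l' = a l" by blast
        then have "l' \<in> {1..<j}" "linked q (b l') (b j)" using linked \<open>b j = a j\<close> by auto
        then show ?thesis by blast
      qed (use \<open>b j = a j\<close> in auto)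
    qed
  qed
  \<comment> \<open>\<open>Q\<close> stands for being q^2 or q^(-2) times the repeated value, so
    both halves of c3 are treated together. An interval of \<open>b\<close> that ends at i or starts
    at Suc i comes from an interval of \<open>a\<close> that contains one exchanged entry more;
    \<open>NQ\<close> says that this entry is not the witness.\<close>
  have key: "\<exists>l. r < l \<and> l < s \<and> Q (b l)"
    if rs: "1 \<le> r" "r < s" "s \<le> n" "b r = b s"
      and Q: "\<And>i j. 1 \<le> i \<Longrightarrow> i < j \<Longrightarrow> j \<le> n \<Longrightarrow> a i = a j \<Longrightarrow> a j = b s \<Longrightarrow> \<exists>l. i < l \<and> l < j \<and> Q (a l)"
      and NQ: "b s = a i \<Longrightarrow> \<not> Q (a (Suc i))" "b s = a (Suc i) \<Longrightarrow> \<not> Q (a i)"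
    for r s Q
  proof -
    consider "r = i" "s = Suc i" | "s = i" | "r < i" "s = Suc i" | "r = i" "Suc i < s" | "r = Suc i"
      | "r \<noteq> i" "r \<noteq> Suc i" "s \<noteq> i" "s \<noteq> Suc i" using rs by linarith
    then show ?thesis
    proof cases
      case 1
      then show ?thesis using rs neq by (simp add: b)
    next
      case 2
      have e: "a r = a (Suc i)" "a (Suc i) = b s" using 2 rs by (auto simp: b)
      have "\<exists>l. r < l \<and> l < Suc i \<and> Q (a l)"
        by (rule Q[OF _ _ _ e]) (use 2 rs(1-3) i in auto)
      then obtain l where l: "r < l" "l < Suc i" "Q (a l)" by blast
      have "l \<noteq> i" using NQ(2) e(2) l(3) by auto
      have "b l = a l" "l < s" using l(1,2) 2 rs(1-3) \<open>l \<noteq> i\<close> by (simp_all add: b)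
      then show ?thesis using l by auto
    next
      case 3
      have e: "a r = a i" "a i = b s" using 3 rs by (auto simp: b)
      have "\<exists>l. r < l \<and> l < i \<and> Q (a l)"
        by (rule Q[OF _ _ _ e]) (use 3 rs(1-3) i in auto)
      then obtain l where l: "r < l" "l < i" "Q (a l)" by blast
      have "b l = a l" "l < s" using l(1,2) 3 rs(1-3) by (simp_all add: b)
      then show ?thesis using l by auto
    next
      case 4
      have e: "a (Suc i) = a s" "a s = b s" using 4 rs by (auto simp: b)
      have "\<exists>l. Suc i < l \<and> l < s \<and> Q (a l)"
        by (rule Q[OF _ _ _ e]) (use 4 rs(1-3) i in auto)
      then obtain l where l: "Suc i < l" "l < s" "Q (a l)" by blast
      have "b l = a l" "r < l" using l(1,2) 4 rs(1-3) by (simp_all add: b)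
      then show ?thesis using l by auto
    next
      case 5
      have e: "a i = a s" "a s = b s" using 5 rs by (auto simp: b)
      have "\<exists>l. i < l \<and> l < s \<and> Q (a l)"
        by (rule Q[OF _ _ _ e]) (use 5 rs(1-3) i in auto)
      then obtain l where l: "i < l" "l < s" "Q (a l)" by blast
      have "l \<noteq> Suc i" using NQ(1) e l(3) by auto
      have "b l = a l" "r < l" using l(1,2) 5 rs(1-3) \<open>l \<noteq> Suc i\<close> by (simp_all add: b)
      then show ?thesis using l by auto
    next
      case 6
      have e: "a r = a s" "a s = b s" using 6 rs by (auto simp: b)
      have "\<exists>l. r < l \<and> l < s \<and> Q (a l)"
        by (rule Q[OF _ _ _ e]) (use rs(1-3) in auto)
      then obtain l where l: "r < l" "l < s" "Q (a l)" by blast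
      from im[OF l(1,2)] 6 obtain l' where "r < l'" "l' < s" "b l' = a l" by blast
      then show ?thesis using l(3) by auto
    qed
  qed
  have B3: "\<exists>l. r < l \<and> l < s \<and> b l = q\<^sup>2 * b s" "\<exists>l. r < l \<and> l < s \<and> q\<^sup>2 * b l = b s"
    if "1 \<le> r" "r < s" "s \<le> n" "b r = b s" for r s
  proof -
    show "\<exists>l. r < l \<and> l < s \<and> b l = q\<^sup>2 * b s"
    proof (rule key[OF that, where Q = "\<lambda>x. x = q\<^sup>2 * b s"])
      show "\<exists>l. i < l \<and> l < j \<and> a l = q\<^sup>2 * b s"
        if "1 \<le> i" "i < j" "j \<le> n" "a i = a j" "a j = b s" for i j
        using c3(1)[OF that(3,1,2,4)] that(5) by simp
    qed (use unl in \<open>auto simp: linked_def\<close>)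
    show "\<exists>l. r < l \<and> l < s \<and> q\<^sup>2 * b l = b s"
    proof (rule key[OF that, where Q = "\<lambda>x. q\<^sup>2 * x = b s"])
      show "\<exists>l. i < l \<and> l < j \<and> q\<^sup>2 * a l = b s"
        if "1 \<le> i" "i < j" "j \<le> n" "a i = a j" "a j = b s" for i j
        using c3(2)[OF that(3,1,2,4)] that(5) by simp
    qed (use unl in \<open>auto simp: linked_def\<close>)
  qed
  have "b \<in> Cont n q v"
    unfolding Cont_iff[OF q n]
  proof (intro conjI ballI impI)
    show "b \<in> {1..n} \<rightarrow>\<^sub>E UNIV"
      using swap_at_PiE[OF _ i] a unfolding b_def Cont_def by blast
    fix r s assume "r \<in> {1..n}" "s \<in> {1..n}" "r < s" "b r = b s"
    then show "\<exists>l\<in>{r<..<s}. b l = q\<^sup>2 * b s" "\<exists>l\<in>{r<..<s}. q\<^sup>2 * b l = b s"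
      using B3[of r s] by (simp_all add: Bex_def)
  qed (use B2 in simp)
  then show ?thesis by (simp add: b_def)
qed

text \<open>This makes the seminormal representation finite-dimensional. Following links backwards,
  entry j is at most j factors q^2 or q^(-2) away from the range of v, hence lies in the finite set
  \<open>F j\<close>.\<close>

lemma finite_Cont:
  fixes q :: "'k::field" and v :: "'m::finite \<Rightarrow> 'k"
  assumes q: "q \<noteq> 0" and n: "1 \<le> n"
  shows "finite (Cont n q v)"
proof -
  define F where "F j = ((\<lambda>X. X \<union> (\<lambda>x. q\<^sup>2 * x) ` X \<union> (\<lambda>x. x / q\<^sup>2) ` X) ^^ j) (range v)" for j
  have F0: "F 0 = range v"
    and FS: "F (Suc j) = F j \<union> (\<lambda>x. q\<^sup>2 * x) ` F j \<union> (\<lambda>x. x / q\<^sup>2) ` F j" for j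
    by (simp_all add: F_def)
  have fin: "finite (F j)" for j by (induction j) (simp_all add: F0 FS)
  have mono: "mono F" by (rule mono_iff_le_Suc[THEN iffD2]) (auto simp: FS)
  have "a j \<in> F j" if "a \<in> Cont n q v" "j \<in> {1..n}" for a j
    using that(2)
  proof (induction j rule: less_induct)
    case (less j)
    have "a j \<in> range v \<or> (\<exists>l\<in>{1..<j}. linked q (a l) (a j))"
      by (rule Cont_linked[OF q that(1)]) (use less.prems in auto)
    then show ?case
    proof
      assume "a j \<in> range v"
      then show ?thesis using monoD[OF mono, of 0 j] by (auto simp: F0)
    next
      assume "\<exists>l\<in>{1..<j}. linked q (a l) (a j)"
      then obtain l where l: "l \<in> {1..<j}" "linked q (a l) (a j)" by blast
      with less have "a l \<in> F l" by auto
      moreover have "a j = q\<^sup>2 * a l \<or> a j = a l / q\<^sup>2" using l(2) q by (auto simp: linked_def)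
      ultimately have "a j \<in> F (Suc l)" by (auto simp: FS)
      then show ?thesis using monoD[OF mono, of "Suc l" j] l(1) by auto
    qed
  qed
  then have "a j \<in> F n" if "a \<in> Cont n q v" "j \<in> {1..n}" for a j
    using that monoD[OF mono, of j n] by (meson atLeastAtMost_iff subsetD)
  moreover have "a \<in> {1..n} \<rightarrow>\<^sub>E UNIV" if "a \<in> Cont n q v" for a
    using that unfolding Cont_def by blast
  ultimately have "Cont n q v \<subseteq> {1..n} \<rightarrow>\<^sub>E F n"
    by (simp add: PiE_iff subset_iff)
  then show ?thesis using fin by (meson finite_PiE finite_atLeastAtMost finite_subset)
qed

section \<open>Sequences of diagrams and standard tableaux\<close>

text \<open>Finite order ideals are tuples of Young diagrams, all components at once. In this
  encoding adding a node is \<open>insert\<close>; row lengths are recovered by \<open>rows\<close>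
  only when tableaux are built.\<close>

definition order_ideal :: "('m \<times> nat \<times> nat) set \<Rightarrow> bool" where
  "order_ideal D \<longleftrightarrow> (\<forall>k r c. (k, Suc r, c) \<in> D \<longrightarrow> (k, r, c) \<in> D) \<and>
     (\<forall>k r c. (k, r, Suc c) \<in> D \<longrightarrow> (k, r, c) \<in> D)"

lemma order_ideal_mem:
  assumes D: "order_ideal D" and x: "(k, r, c) \<in> D" and le: "r' \<le> r" "c' \<le> c"
  shows "(k, r', c') \<in> D"
proof -
  have step: "(k, Suc r, c) \<in> D \<Longrightarrow> (k, r, c) \<in> D" "(k, r, Suc c) \<in> D \<Longrightarrow> (k, r, c) \<in> D" for r c
    using D unfolding order_ideal_def by blast+
  have row: "(k, r', c) \<in> D"
    using le(1) by (induction r' rule: inc_induct) (use x step(1) in blast)+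
  show ?thesis
    using le(2) by (induction c' rule: inc_induct) (use row step(2) in blast)+
qed

lemma order_ideal_insert:
  assumes "order_ideal D" "\<And>r'. r = Suc r' \<Longrightarrow> (k, r', c) \<in> D"
    "\<And>c'. c = Suc c' \<Longrightarrow> (k, r, c') \<in> D"
  shows "order_ideal (insert (k, r, c) D)"
  using assms unfolding order_ideal_def by blast

lemma order_ideal_Un: "order_ideal D \<Longrightarrow> order_ideal E \<Longrightarrow> order_ideal (D \<union> E)"
  unfolding order_ideal_def by blast

text \<open>The first row up to column c together with the first column down to row r. It is forced
  into an ideal by any node in row r and any node in column c, so its r + c + 1 nodes bound r + c by
  the size of the ideal.\<close>

definition hook :: "'m \<Rightarrow> nat \<Rightarrow> nat \<Rightarrow> ('m \<times> nat \<times> nat) set" where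
  "hook k r c = (\<lambda>j. (k, 0, j)) ` {..c} \<union> (\<lambda>i. (k, i, 0)) ` {1..r}"

lemma finite_hook: "finite (hook k r c)" by (simp add: hook_def)

lemma card_hook: "card (hook k r c) = Suc (r + c)"
proof -
  have "card (hook k r c) = card ((\<lambda>j. (k, 0::nat, j)) ` {..c}) + card ((\<lambda>i. (k, i, 0::nat)) ` {1..r})"
    unfolding hook_def by (rule card_Un_disjoint) auto
  then show ?thesis by (simp add: card_image inj_on_def)
qed

lemma hook_subset:
  assumes "order_ideal D" "(k, r, c') \<in> D" "(k, r', c) \<in> D"
  shows "hook k r c \<subseteq> D"
  using order_ideal_mem[OF assms(1,2)] order_ideal_mem[OF assms(1,3)] by (auto simp: hook_def)

text \<open>The difference of the diagonals is (c + r') - (c' + r). Both sums are smaller than the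
  size of \<open>D\<close>, by the hooks with the row of one node and the column of the
  other.\<close>

lemma diagonal_bound_same:
  assumes "order_ideal D" "finite D" "(k, r, c) \<in> D" "(k, r', c') \<in> D"
  shows "\<bar>(int c - int r) - (int c' - int r')\<bar> < int (card D)"
proof -
  have "hook k r' c \<subseteq> D" "hook k r c' \<subseteq> D" using hook_subset assms by metis+
  then have "Suc (r' + c) \<le> card D" "Suc (r + c') \<le> card D"
    using card_mono[OF assms(2)] by (metis card_hook)+
  then show ?thesis by linarith
qed

text \<open>The hooks of the two nodes lie in different components and are disjoint, so their sizes
  add up; this gains one more unit than a single component does.\<close>

lemma diagonal_bound_distinct:
  assumes "order_ideal D" "finite D" "(k, r, c) \<in> D" "(l, r', c') \<in> D" "k \<noteq> l"
  shows "\<bar>(int c - int r) - (int c' - int r')\<bar> + 2 \<le> int (card D)"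
proof -
  have "hook k r c \<union> hook l r' c' \<subseteq> D" using hook_subset assms by (metis Un_least)
  moreover have "card (hook k r c \<union> hook l r' c') = card (hook k r c) + card (hook l r' c')"
    by (rule card_Un_disjoint) (use \<open>k \<noteq> l\<close> in \<open>auto simp: finite_hook hook_def\<close>)
  ultimately have "Suc (r + c) + Suc (r' + c') \<le> card D"
    using card_mono[OF assms(2)] by (metis card_hook)
  then show ?thesis by linarith
qed

text \<open>The inverse of a standard filling: \<open>s j\<close> is the node that carries j. Values
  outside {1..n} are left free, so sequences are only compared on this range.\<close>

definition std_seq :: "nat \<Rightarrow> (nat \<Rightarrow> 'm \<times> nat \<times> nat) \<Rightarrow> bool" where
  "std_seq n s \<longleftrightarrow> inj_on s {1..n} \<and> (\<forall>j\<le>n. order_ideal (s ` {1..j}))"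

lemma std_seq_mem:
  assumes "std_seq n s" "1 \<le> j" "j \<le> n" "s j = (k, r, c)" "r' \<le> r" "c' \<le> c"
  obtains l where "1 \<le> l" "l \<le> j" "s l = (k, r', c')"
proof -
  have "order_ideal (s ` {1..j})" using assms by (simp add: std_seq_def)
  moreover have "(k, r, c) \<in> s ` {1..j}" using assms(2,4) by (metis atLeastAtMost_iff imageI order_refl)
  ultimately have "(k, r', c') \<in> s ` {1..j}" using assms(5,6) by (rule order_ideal_mem)
  then show ?thesis using that by auto
qed

lemma std_seq_le:
  assumes s: "std_seq n s" and i: "1 \<le> i" "i \<le> n" and j: "1 \<le> j" "j \<le> n"
    and eq: "s i = (k, r', c')" "s j = (k, r, c)" "r' \<le> r" "c' \<le> c"
  shows "i \<le> j"
proof -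
  obtain l where l: "1 \<le> l" "l \<le> j" "s l = (k, r', c')"
    using std_seq_mem[OF s j eq(2-4)] .
  have "inj_on s {1..n}" using s by (simp add: std_seq_def)
  then have "i = l" by (rule inj_onD) (use i j l eq(1) in auto)
  then show ?thesis using l by simp
qed

lemma std_seq_notin:
  assumes s: "std_seq n s" and i: "1 \<le> i" "i \<le> n"
  shows "s i \<notin> s ` {1..i - 1}"
proof
  assume "s i \<in> s ` {1..i - 1}"
  then obtain l where l: "l \<in> {1..i - 1}" "s i = s l" by blast
  have "inj_on s {1..n}" using s by (simp add: std_seq_def)
  then have "i = l" by (rule inj_onD) (use i l in auto)
  then show False using l(1) i by auto
qed

lemma std_seq_snoc:
  assumes s: "std_seq j s" and x: "x \<notin> s ` {1..j}" "order_ideal (insert x (s ` {1..j}))"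
  shows "std_seq (Suc j) (s(Suc j := x))"
proof -
  have im: "(s(Suc j := x)) ` {1..i} = s ` {1..i}" if "i \<le> j" for i
    using that by (intro image_cong) auto
  have split: "{1..Suc j} = insert (Suc j) {1..j}" by auto
  have "(s(Suc j := x)) ` {1..Suc j} = insert x (s ` {1..j})"
    unfolding split image_insert im[OF order_refl] by simp
  then have "order_ideal ((s(Suc j := x)) ` {1..i})" if "i \<le> Suc j" for i
    using that x(2) s im by (metis le_Suc_eq std_seq_def)
  moreover have "inj_on (s(Suc j := x)) {1..Suc j}"
    unfolding split inj_on_insert
  proof
    have "inj_on s {1..j}" using s by (simp add: std_seq_def)
    then show "inj_on (s(Suc j := x)) {1..j}" by (rule inj_on_cong[THEN iffD1, rotated]) auto
    have "{1..j} - {Suc j} = {1..j}" by auto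
    then show "(s(Suc j := x)) (Suc j) \<notin> (s(Suc j := x)) ` ({1..j} - {Suc j})"
      using im[of j] x(1) by (metis fun_upd_same order_refl)
  qed
  ultimately show ?thesis by (simp add: std_seq_def)
qed

section \<open>Contents of nodes under separated parameters\<close>

locale separated_parameters =
  fixes n :: nat and q :: "'k::field" and v :: "'m \<Rightarrow> 'k"
  assumes n: "1 \<le> n" and q: "q \<noteq> 0" and v: "v k \<noteq> 0"
    and q_power: "1 \<le> i \<Longrightarrow> i \<le> n \<Longrightarrow> q ^ (2 * i) \<noteq> 1"
    and v_separated: "j \<noteq> k \<Longrightarrow> - int n < z \<Longrightarrow> z < int n \<Longrightarrow> q powi (2 * z) * v j \<noteq> v k"
begin

lemma presentation_unique:
  assumes eq: "v k * q powi (2 * z) = v l * q powi (2 * y)"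
    and bound: "k = l \<Longrightarrow> \<bar>z - y\<bar> \<le> int n" "k \<noteq> l \<Longrightarrow> \<bar>z - y\<bar> < int n"
  shows "k = l \<and> z = y"
proof -
  have "q powi (2 * z) = q powi (2 * (z - y)) * q powi (2 * y)"
    using q by (subst power_int_add[symmetric]) (auto simp: algebra_simps)
  with eq q have eq': "q powi (2 * (z - y)) * v k = v l" by (simp add: mult.commute)
  have kl: "k = l"
  proof (rule ccontr)
    assume "k \<noteq> l"
    with bound(2) v_separated[of k l "z - y"] eq' show False by auto
  qed
  with eq' v have one: "q powi (2 * (z - y)) = 1" by (metis mult_cancel_right1)
  have "z = y"
  proof (rule ccontr)
    assume "z \<noteq> y"
    define i where "i = nat \<bar>z - y\<bar>"
    have i: "1 \<le> i" "i \<le> n" using \<open>z \<noteq> y\<close> bound(1) kl by (auto simp: i_def)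
    have "q powi int (2 * i) = 1"
    proof (cases "z > y")
      case True
      then have "int (2 * i) = 2 * (z - y)" by (simp add: i_def)
      then show ?thesis using one by simp
    next
      case False
      then have "int (2 * i) = - (2 * (z - y))" by (simp add: i_def)
      then show ?thesis using one by (simp only: power_int_minus) simp
    qed
    then have "q ^ (2 * i) = 1" by (simp only: power_int_of_nat)
    with q_power[OF i] show False by blast
  qed
  with kl show ?thesis by blast
qed

definition content :: "'m \<times> nat \<times> nat \<Rightarrow> 'k" where
  "content = (\<lambda>(k, r, c). v k * q powi (2 * (int c - int r)))"

lemma content_diagonal: "int c - int r = int c' - int r' \<Longrightarrow> content (k, r, c) = content (k, r', c')"
  by (simp only: content_def prod.case)

lemma content_Suc_col: "content (k, r, Suc c) = q\<^sup>2 * content (k, r, c)"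
  using powi_shift(1)[OF q, of "v k" "int c - int r"]
  by (simp add: content_def algebra_simps)

lemma content_Suc_row: "q\<^sup>2 * content (k, Suc r, c) = content (k, r, c)"
  using powi_shift(2)[OF q, of "v k" "int c - int r"]
  by (simp add: content_def algebra_simps)

text \<open>With at most n + 1 nodes the hook bounds keep the exponents at most n apart in one
  component and at most n - 1 apart in two, the ranges that the parameters separate. The bound
  \<open>Suc n\<close> lets \<open>addable_unique\<close> compare two nodes added to one
  diagram.\<close>

lemma content_eqD:
  assumes E: "order_ideal E" "finite E" "card E \<le> Suc n"
    and xy: "(k, r, c) \<in> E" "(l, r', c') \<in> E" "content (k, r, c) = content (l, r', c')"
  shows "k = l \<and> int c - int r = int c' - int r'"
proof (rule presentation_unique)
  show "v k * q powi (2 * (int c - int r)) = v l * q powi (2 * (int c' - int r'))"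
    using xy(3) by (simp add: content_def)
  show "\<bar>int c - int r - (int c' - int r')\<bar> \<le> int n" if "k = l"
    using diagonal_bound_same[OF E(1,2), of k r c r' c'] xy E(3) that by simp
  show "\<bar>int c - int r - (int c' - int r')\<bar> < int n" if "k \<noteq> l"
    using diagonal_bound_distinct[OF E(1,2) xy(1,2) that] E(3) by linarith
qed

text \<open>The factor q^2 shifts one exponent by one; the smaller bound on the size of
  \<open>E\<close> absorbs this shift.\<close>

lemma content_shift_eqD:
  assumes E: "order_ideal E" "finite E" "card E < n"
    and xy: "(k, r, c) \<in> E" "(l, r', c') \<in> E" "content (k, r, c) = q\<^sup>2 * content (l, r', c')"
  shows "k = l \<and> int c - int r = int c' - int r' + 1"
proof (rule presentation_unique)
  show "v k * q powi (2 * (int c - int r)) = v l * q powi (2 * (int c' - int r' + 1))"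
    using xy(3) unfolding powi_shift(1)[OF q] by (simp add: content_def)
  show "\<bar>int c - int r - (int c' - int r' + 1)\<bar> \<le> int n" if "k = l"
    using diagonal_bound_same[OF E(1,2), of k r c r' c'] xy E(3) that by simp
  show "\<bar>int c - int r - (int c' - int r' + 1)\<bar> < int n" if "k \<noteq> l"
    using diagonal_bound_distinct[OF E(1,2) xy(1,2) that] E(3) by linarith
qed

text \<open>Equal contents put both nodes on one diagonal of one component. If they differ, one lies
  up and to the left of the other, so it belongs to the ideal with the other node added, and
  therefore already to \<open>D\<close>.\<close>

lemma addable_unique:
  assumes D: "order_ideal D" "finite D" "card D < n"
    and x: "x \<notin> D" "order_ideal (insert x D)" and y: "y \<notin> D" "order_ideal (insert y D)"
    and eq: "content x = content y"
  shows "x = y"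
proof (rule ccontr)
  assume "x \<noteq> y"
  obtain k r c where x': "x = (k, r, c)" by (cases x)
  obtain l r' c' where y': "y = (l, r', c')" by (cases y)
  let ?E = "insert x D \<union> insert y D"
  have "k = l \<and> int c - int r = int c' - int r'"
  proof (rule content_eqD)
    show "order_ideal ?E" using x(2) y(2) by (rule order_ideal_Un)
    show "card ?E \<le> Suc n" using D(2,3) x(1) y(1) by (simp add: card_insert_if)
  qed (use D x' y' eq in auto)
  then have kl: "k = l" and diag: "int c - int r = int c' - int r'" by simp_all
  consider "r < r'" | "r' < r" | "r = r'" by linarith
  then show False
  proof cases
    case 1
    then have "x \<in> insert y D" using order_ideal_mem[OF y(2), of l r' c' r c] kl diag x' y' by simp
    then show ?thesis using x \<open>x \<noteq> y\<close> by simp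
  next
    case 2
    then have "y \<in> insert x D" using order_ideal_mem[OF x(2), of k r c r' c'] kl diag x' y' by simp
    then show ?thesis using y \<open>x \<noteq> y\<close> by simp
  next
    case 3
    then show ?thesis using \<open>x \<noteq> y\<close> kl diag x' y' by simp
  qed
qed

lemma std_seq_eqI:
  assumes s: "std_seq n s" and t: "std_seq n t"
    and eq: "\<And>i. 1 \<le> i \<Longrightarrow> i \<le> n \<Longrightarrow> content (s i) = content (t i)"
    and i: "1 \<le> i" "i \<le> n"
  shows "s i = t i"
  using i
proof (induction i rule: less_induct)
  case (less i)
  define D where "D = s ` {1..i - 1}"
  have D': "D = t ` {1..i - 1}"
    unfolding D_def using less by (intro image_cong) auto
  have split: "{1..i} = insert i {1..i - 1}" using less.prems by auto
  have ins: "insert (s i) D = s ` {1..i}" "insert (t i) D = t ` {1..i}"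
    unfolding split image_insert by (simp_all only: D_def[symmetric] D'[symmetric])
  have notin: "s i \<notin> D" "t i \<notin> D"
    using std_seq_notin[OF s less.prems] std_seq_notin[OF t less.prems] D_def D' by simp_all
  have fin: "finite D" unfolding D_def by simp
  have "card D < n"
    using card_image_le[of "{1..i - 1}" s] less.prems unfolding D_def by simp
  moreover have "order_ideal D"
    using s less.prems unfolding std_seq_def D_def by auto
  moreover have "order_ideal (s ` {1..i})" "order_ideal (t ` {1..i})"
    using s t less.prems unfolding std_seq_def by auto
  then have "order_ideal (insert (s i) D)" "order_ideal (insert (t i) D)"
    by (simp_all only: ins)
  ultimately show ?case
    using addable_unique[of D "s i" "t i"] notin fin eq less.prems by blast
qed

text \<open>Off the main diagonal, the left or upper neighbour of a node was added earlier and is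
  linked to it. For c3, equal contents mean the same diagonal; the nodes left of and above the later
  node lie in the rectangle spanned by the two nodes, hence are added between them.\<close>

lemma std_seq_Cont:
  assumes s: "std_seq n s"
  shows "restrict (\<lambda>i. content (s i)) {1..n} \<in> Cont n q v"
  unfolding Cont_iff[OF q n]
proof (intro conjI ballI impI)
  fix j assume "j \<in> {1..n}"
  then have j: "1 \<le> j" "j \<le> n" by auto
  obtain k r c where sj: "s j = (k, r, c)" by (cases "s j")
  have lt: "l < j" if "1 \<le> l" "l \<le> j" "s l \<noteq> s j" for l
    using that by (metis le_neq_implies_less)
  consider "r = c" | c' where "c = Suc c'" | r' where "r = Suc r'"
    by (metis not0_implies_Suc)
  then show "restrict (\<lambda>i. content (s i)) {1..n} j \<in> range v \<or>
      (\<exists>l\<in>{1..<j}. linked q (restrict (\<lambda>i. content (s i)) {1..n} l) (restrict (\<lambda>i. content (s i)) {1..n} j))"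
  proof cases
    case 1
    then show ?thesis using j sj by (simp add: content_def)
  next
    case 2
    obtain l where l: "1 \<le> l" "l \<le> j" "s l = (k, r, c')"
      using std_seq_mem[OF s j sj, of r c'] 2 by auto
    then have "l < j" using lt sj 2 by simp
    then have "linked q (content (s l)) (content (s j))"
      using l sj 2 by (simp add: linked_def content_Suc_col)
    then show ?thesis using l \<open>l < j\<close> j by force
  next
    case 3
    obtain l where l: "1 \<le> l" "l \<le> j" "s l = (k, r', c)"
      using std_seq_mem[OF s j sj, of r' c] 3 by auto
    then have "l < j" using lt sj 3 by simp
    then have "linked q (content (s l)) (content (s j))"
      using l sj 3 by (simp add: linked_def content_Suc_row)
    then show ?thesis using l \<open>l < j\<close> j by force
  qed
next
  have fin: "finite (s ` {1..n})" by simp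
  have card: "card (s ` {1..n}) \<le> Suc n" using card_image_le[of "{1..n}" s] by simp
  have ideal: "order_ideal (s ` {1..n})" using s by (simp add: std_seq_def)
  fix i j assume "i \<in> {1..n}" "j \<in> {1..n}" and lt: "i < j"
    and e: "restrict (\<lambda>i. content (s i)) {1..n} i = restrict (\<lambda>i. content (s i)) {1..n} j"
  then have i: "1 \<le> i" "i \<le> n" and j: "1 \<le> j" "j \<le> n" and eq: "content (s i) = content (s j)"
    by auto
  obtain k r c where si: "s i = (k, r, c)" by (cases "s i")
  obtain k' r' c' where sj: "s j = (k', r', c')" by (cases "s j")
  have "k = k' \<and> int c - int r = int c' - int r'"
  proof (rule content_eqD[OF ideal fin card])
    show "(k, r, c) \<in> s ` {1..n}" using i unfolding si[symmetric] by simp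
    show "(k', r', c') \<in> s ` {1..n}" using j unfolding sj[symmetric] by simp
  qed (use eq si sj in simp)
  then have k: "k' = k" and diag: "int c - int r = int c' - int r'" by auto
  have "r < r'"
  proof (rule ccontr)
    assume "\<not> r < r'"
    then have "j \<le> i" using std_seq_le[OF s j i _ si, of r' c'] sj k diag by simp
    with lt show False by simp
  qed
  with diag have "c < c'" by simp
  from \<open>r < r'\<close> obtain r'' where r'': "r' = Suc r''" "r \<le> r''" by (cases r') auto
  from \<open>c < c'\<close> obtain c'' where c'': "c' = Suc c''" "c \<le> c''" by (cases c') auto
  have between: "\<exists>l\<in>{i<..<j}. s l = (k, r1, c1)"
    if bounds: "r \<le> r1" "c \<le> c1" "r1 \<le> r'" "c1 \<le> c'" "(r1, c1) \<noteq> (r, c)" "(r1, c1) \<noteq> (r', c')" for r1 c1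
  proof -
    obtain l where l: "1 \<le> l" "l \<le> j" "s l = (k, r1, c1)"
      using std_seq_mem[OF s j sj[unfolded k] bounds(3,4)] .
    have "l \<noteq> j" "l \<noteq> i" using l si sj that by auto
    moreover have "i \<le> l" using std_seq_le[OF s i _ _ si l(3)] l j that by simp
    ultimately show ?thesis using l by auto
  qed
  have eqj: "content (s j) = content (k, Suc r'', Suc c'')" using sj k r'' c'' by simp
  obtain l1 where l1: "l1 \<in> {i<..<j}" "s l1 = (k, r'', Suc c'')"
    using between[of r'' "Suc c''"] r'' c'' by auto
  then have "content (s l1) = q\<^sup>2 * content (s j)"
    using eqj by (simp add: content_Suc_row)
  then show "\<exists>l\<in>{i<..<j}. restrict (\<lambda>i. content (s i)) {1..n} l = q\<^sup>2 * restrict (\<lambda>i. content (s i)) {1..n} j"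
    using l1(1) i j by (intro bexI[of _ l1]) auto
  obtain l2 where l2: "l2 \<in> {i<..<j}" "s l2 = (k, Suc r'', c'')"
    using between[of "Suc r''" c''] r'' c'' by auto
  then have "q\<^sup>2 * content (s l2) = content (s j)"
    using eqj by (simp add: content_Suc_col)
  then show "\<exists>l\<in>{i<..<j}. q\<^sup>2 * restrict (\<lambda>i. content (s i)) {1..n} l = restrict (\<lambda>i. content (s i)) {1..n} j"
    using l2(1) i j by (intro bexI[of _ l2]) auto
qed auto

text \<open>A new value is placed at a corner (k, 0, 0) or next to a node with linked content, in
  the first row or column. A repeated value is placed at the diagonal successor of its last
  occurrence, where c3 provides the two neighbours that must be present.\<close>

lemma addable_exists:
  assumes a: "a \<in> Cont n q v" and j: "Suc j \<le> n" and s: "std_seq j s"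
    and eq: "\<And>i. 1 \<le> i \<Longrightarrow> i \<le> j \<Longrightarrow> content (s i) = a i"
  obtains x where "x \<notin> s ` {1..j}" "order_ideal (insert x (s ` {1..j}))" "content x = a (Suc j)"
proof -
  let ?D = "s ` {1..j}"
  have D: "order_ideal ?D" and fin: "finite ?D" using s by (auto simp: std_seq_def)
  have card: "card ?D < n" using card_image_le[of "{1..j}" s] j by simp
  have contents: "content x \<in> a ` {1..j}" if "x \<in> ?D" for x using that eq by auto
  show ?thesis
  proof (cases "a (Suc j) \<in> a ` {1..j}")
    case False
    then have new: "x \<notin> ?D" if "content x = a (Suc j)" for x using that contents by metis
    have "a (Suc j) \<in> range v \<or> (\<exists>l\<in>{1..<Suc j}. linked q (a l) (a (Suc j)))"
      by (rule Cont_linked[OF q a j]) simp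
    then show ?thesis
    proof (elim disjE bexE)
      assume "a (Suc j) \<in> range v"
      then obtain k where k: "a (Suc j) = v k" by auto
      then have c: "content (k, 0, 0) = a (Suc j)" by (simp add: content_def)
      show ?thesis
        by (rule that[OF new[OF c] order_ideal_insert[OF D] c]) auto
    next
      fix l assume l: "l \<in> {1..<Suc j}" "linked q (a l) (a (Suc j))"
      obtain k r c where sl: "s l = (k, r, c)" by (cases "s l")
      have mem: "(k, r, c) \<in> ?D" using l(1) unfolding sl[symmetric] by auto
      have al: "content (k, r, c) = a l" using eq[of l] l(1) sl by auto
      from l(2) consider "a (Suc j) = q\<^sup>2 * a l" | "a l = q\<^sup>2 * a (Suc j)"
        by (auto simp: linked_def)
      then show ?thesis
      proof cases
        case 1
        then have c: "content (k, r, Suc c) = a (Suc j)" using al by (simp add: content_Suc_col)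
        \<comment> \<open>Otherwise the node above the new one lies in row \<open>r'\<close>: its
          left neighbour \<open>(k, r', c)\<close> is on the diagonal of the new node and already
          carries the value.\<close>
        have "r = 0"
        proof (cases r)
          case (Suc r')
          have "content (k, r', c) = content (k, r, Suc c)"
            by (rule content_diagonal) (simp add: Suc)
          then have "content (k, r', c) = a (Suc j)" using c by simp
          moreover have "(k, r', c) \<in> ?D" using order_ideal_mem[OF D mem] Suc by simp
          ultimately show ?thesis using new by blast
        qed simp
        then show ?thesis
          by (intro that[OF new[OF c] order_ideal_insert[OF D] c]) (use mem in auto)
      next
        case 2
        have "q\<^sup>2 * content (k, Suc r, c) = q\<^sup>2 * a (Suc j)"
          using al 2 by (simp add: content_Suc_row)
        then have c: "content (k, Suc r, c) = a (Suc j)" using q by simp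
        have "c = 0"
        proof (cases c)
          case (Suc c')
          have "content (k, r, c') = content (k, Suc r, c)"
            by (rule content_diagonal) (simp add: Suc)
          then have "content (k, r, c') = a (Suc j)" using \<open>content (k, Suc r, c) = a (Suc j)\<close> by simp
          moreover have "(k, r, c') \<in> ?D" using order_ideal_mem[OF D mem] Suc by simp
          ultimately show ?thesis using new by blast
        qed simp
        then show ?thesis
          by (intro that[OF new[OF c] order_ideal_insert[OF D] c]) (use mem in auto)
      qed
    qed
  next
    case True
    define I where "I = {i \<in> {1..j}. a i = a (Suc j)}"
    have I: "finite I" "I \<noteq> {}" using True by (auto simp: I_def)
    \<comment> \<open>With the last occurrence, the diagonal successor of \<open>s i\<close> is
      still missing: it would have been added after i and would carry the same value.\<close>
    define i where "i = Max I"
    have "i \<in> I" using Max_in[OF I] by (simp add: i_def)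
    then have i: "1 \<le> i" "i \<le> j" "a i = a (Suc j)" by (auto simp: I_def)
    have last: "p \<le> i" if "1 \<le> p" "p \<le> j" "a p = a (Suc j)" for p
      using that I by (auto simp: i_def I_def)
    obtain k r c where si: "s i = (k, r, c)" by (cases "s i")
    have mem: "(k, r, c) \<in> ?D" using i unfolding si[symmetric] by auto
    have ci: "content (k, r, c) = a (Suc j)" using eq[of i] i si by simp
    have "i < Suc j" using i by simp
    obtain l1 where l1: "i < l1" "l1 \<le> j" "a l1 = q\<^sup>2 * a (Suc j)"
      using Cont_between(1)[OF q a j i(1) \<open>i < Suc j\<close> i(3)] by auto
    obtain l2 where l2: "i < l2" "l2 \<le> j" "q\<^sup>2 * a l2 = a (Suc j)"
      using Cont_between(2)[OF q a j i(1) \<open>i < Suc j\<close> i(3)] by auto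
    obtain k1 r1 c1 where s1: "s l1 = (k1, r1, c1)" by (cases "s l1")
    obtain k2 r2 c2 where s2: "s l2 = (k2, r2, c2)" by (cases "s l2")
    have m1: "(k1, r1, c1) \<in> ?D" and m2: "(k2, r2, c2) \<in> ?D"
      using l1 l2 i unfolding s1[symmetric] s2[symmetric] by auto
    have "content (k1, r1, c1) = q\<^sup>2 * content (k, r, c)"
      using eq[of l1] l1 i s1 ci by simp
    from content_shift_eqD[OF D fin card m1 mem this]
    have k1: "k1 = k" and d1: "int c1 - int r1 = int c - int r + 1" by auto
    have "content (k, r, c) = q\<^sup>2 * content (k2, r2, c2)"
      using eq[of l2] l2 i s2 ci by simp
    from content_shift_eqD[OF D fin card mem m2 this]
    have k2: "k2 = k" and d2: "int c - int r = int c2 - int r2 + 1" by auto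
    \<comment> \<open>\<open>s l1\<close> lies on the next diagonal and was added after
      \<open>s i\<close>, so it is not up and to the left of \<open>s i\<close>. It therefore lies
      weakly below row r, which forces the right neighbour of \<open>s i\<close> into the ideal. The
      entry l2 gives the lower neighbour in the same way.\<close>
    have "r \<le> r1"
    proof (rule ccontr)
      assume "\<not> r \<le> r1"
      then have "l1 \<le> i" using std_seq_le[OF s _ _ _ _ _ si, of l1 r1 c1] l1 i s1 k1 d1 by simp
      with l1 show False by simp
    qed
    then have right: "(k, r, Suc c) \<in> ?D"
      using order_ideal_mem[OF D m1] k1 d1 by simp
    have "c \<le> c2"
    proof (rule ccontr)
      assume "\<not> c \<le> c2"
      then have "l2 \<le> i" using std_seq_le[OF s _ _ _ _ _ si, of l2 r2 c2] l2 i s2 k2 d2 by simp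
      with l2 show False by simp
    qed
    then have below: "(k, Suc r, c) \<in> ?D"
      using order_ideal_mem[OF D m2] k2 d2 by simp
    have cx: "content (k, Suc r, Suc c) = a (Suc j)"
      using ci content_diagonal[of "Suc c" "Suc r" c r k] by simp
    have "(k, Suc r, Suc c) \<notin> ?D"
    proof
      assume "(k, Suc r, Suc c) \<in> ?D"
      then obtain p where p: "1 \<le> p" "p \<le> j" "s p = (k, Suc r, Suc c)" by auto
      then have "a p = a (Suc j)" using eq[of p] cx by simp
      then have "p \<le> i" using last p by blast
      moreover have "i \<le> p" using std_seq_le[OF s _ _ _ _ si p(3)] i p by simp
      ultimately show False using p(3) si by simp
    qed
    then show ?thesis
      by (rule that[OF _ order_ideal_insert[OF D] cx]) (use right below in auto)
  qed
qed

lemma Cont_std_seq: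
  assumes a: "a \<in> Cont n q v"
  obtains s where "std_seq n s" "\<And>i. 1 \<le> i \<Longrightarrow> i \<le> n \<Longrightarrow> content (s i) = a i"
proof -
  have "\<exists>s. std_seq j s \<and> (\<forall>i\<in>{1..j}. content (s i) = a i)" if "j \<le> n" for j
    using that
  proof (induction j)
    case 0
    then show ?case by (simp add: std_seq_def order_ideal_def)
  next
    case (Suc j)
    then obtain s where s: "std_seq j s" "\<And>i. 1 \<le> i \<Longrightarrow> i \<le> j \<Longrightarrow> content (s i) = a i" by auto
    obtain x where x: "x \<notin> s ` {1..j}" "order_ideal (insert x (s ` {1..j}))" "content x = a (Suc j)"
      using addable_exists[OF a Suc.prems s] .
    have "content ((s(Suc j := x)) i) = a i" if "i \<in> {1..Suc j}" for i
      using that s(2) x(3) by (cases "i = Suc j") auto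
    with std_seq_snoc[OF s(1) x(1,2)] show ?case by blast
  qed
  then show ?thesis using that by (metis atLeastAtMost_iff order_refl)
qed

end

section \<open>Order ideals as partitions, growing sequences as fillings\<close>

lemma down_closed_eq_lessThan:
  fixes N :: "nat set"
  assumes "finite N" and down: "\<And>x. Suc x \<in> N \<Longrightarrow> x \<in> N"
  shows "N = {..<card N}"
proof (cases "N = {}")
  case False
  have "x \<in> N" if "x \<le> Max N" for x
    using that by (induction rule: inc_induct) (use Max_in[OF assms(1) False] down in blast)+
  then have "N = {..Max N}" using assms(1) by (auto intro: Max_ge)
  then show ?thesis by (metis card_atMost lessThan_Suc_atMost)
qed simp

lemma order_ideal_nodes:
  assumes "\<And>k. is_partition (p k)"
  shows "order_ideal (nodes p)"
proof -
  have "p k ! Suc r \<le> p k ! r" if "Suc r < length (p k)" for k r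
    using sorted_wrt_nth_less[of "(\<ge>)" "p k" r "Suc r"] assms[of k] that by (auto simp: is_partition_def)
  then show ?thesis unfolding order_ideal_def nodes_def by fastforce
qed

lemma card_nodes:
  fixes p :: "'m::finite \<Rightarrow> nat list"
  shows "card (nodes p) = (\<Sum>k\<in>UNIV. sum_list (p k))"
proof -
  have eq: "nodes p = (SIGMA k:UNIV. SIGMA r:{..<length (p k)}. {..<p k ! r})"
    by (auto simp: nodes_def)
  show "card (nodes p) = (\<Sum>k\<in>UNIV. sum_list (p k))"
    unfolding eq by (simp add: sum_list_sum_nth lessThan_atLeast0)
qed

text \<open>The inverse of \<open>nodes\<close> on order ideals. Counting the rows by column 0 keeps
  empty rows out, as \<open>is_partition\<close> demands.\<close>

definition rows :: "('m \<times> nat \<times> nat) set \<Rightarrow> 'm \<Rightarrow> nat list" where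
  "rows D k = map (\<lambda>r. card {c. (k, r, c) \<in> D}) [0..<card {r. (k, r, 0) \<in> D}]"

lemma rows_nodes:
  assumes "\<And>k. is_partition (p k)"
  shows "rows (nodes p) = p"
proof
  fix k
  have "0 < p k ! r" if "r < length (p k)" for r
    using assms[of k] nth_mem[OF that] by (auto simp: is_partition_def intro: gr0I)
  then have "{r. (k, r, 0) \<in> nodes p} = {..<length (p k)}" by (auto simp: nodes_def)
  moreover have "{c. (k, r, c) \<in> nodes p} = {..<p k ! r}" if "r < length (p k)" for r
    using that by (auto simp: nodes_def)
  ultimately show "rows (nodes p) k = p k"
    by (intro nth_equalityI) (simp_all add: rows_def)
qed

lemma
  fixes D :: "('m \<times> nat \<times> nat) set"
  assumes D: "order_ideal D" "finite D"
  shows nodes_rows: "nodes (rows D) = D" and is_partition_rows: "is_partition (rows D k)"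
proof -
  have fin: "finite {r. (k, r, 0) \<in> D}" "finite {c. (k, r, c) \<in> D}" for k r
    using finite_vimageI[OF D(2), of "\<lambda>r. (k, r, 0)"] finite_vimageI[OF D(2), of "\<lambda>c. (k, r, c)"]
    by (auto simp: inj_on_def vimage_def)
  have step: "(k, Suc r, c) \<in> D \<Longrightarrow> (k, r, c) \<in> D" "(k, r, Suc c) \<in> D \<Longrightarrow> (k, r, c) \<in> D" for k r c
    using D unfolding order_ideal_def by blast+
  have col: "{r. (k, r, 0) \<in> D} = {..<card {r. (k, r, 0) \<in> D}}" for k
    by (rule down_closed_eq_lessThan[OF fin(1)]) (use step in blast)
  have row: "{c. (k, r, c) \<in> D} = {..<card {c. (k, r, c) \<in> D}}" for k r
    by (rule down_closed_eq_lessThan[OF fin(2)]) (use step in blast)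
  have col_iff: "r < card {r. (k, r, 0) \<in> D} \<longleftrightarrow> (k, r, 0) \<in> D" for k r
    using col[of k] by (metis lessThan_iff mem_Collect_eq)
  have row_iff: "c < card {c. (k, r, c) \<in> D} \<longleftrightarrow> (k, r, c) \<in> D" for k r c
    using row[of k r] by (metis lessThan_iff mem_Collect_eq)
  show "nodes (rows D) = D"
  proof (rule Set.set_eqI)
    fix x :: "'m \<times> nat \<times> nat"
    obtain k r c where x: "x = (k, r, c)" by (cases x)
    have "x \<in> nodes (rows D) \<longleftrightarrow> (k, r, 0) \<in> D \<and> (k, r, c) \<in> D"
      by (auto simp: x nodes_def rows_def col_iff row_iff)
    then show "x \<in> nodes (rows D) \<longleftrightarrow> x \<in> D"
      using order_ideal_mem[OF D(1), of k r c r 0] x by auto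
  qed
  have mono: "card {c. (k, j, c) \<in> D} \<le> card {c. (k, i, c) \<in> D}" if "i < j" for i j
    by (rule card_mono[OF fin(2)]) (use order_ideal_mem[OF D(1)] that in auto)
  show "is_partition (rows D k)"
    unfolding is_partition_def sorted_wrt_iff_nth_less
  proof (intro conjI allI impI)
    fix i j assume "i < j" "j < length (rows D k)"
    then show "rows D k ! j \<le> rows D k ! i" using mono[of i j] by (simp add: rows_def)
  next
    show "0 \<notin> set (rows D k)"
    proof
      assume "0 \<in> set (rows D k)"
      then obtain r where r: "r < card {r. (k, r, 0) \<in> D}" "card {c. (k, r, c) \<in> D} = 0"
        by (auto simp: rows_def)
      then show False using col_iff[of r k] row_iff[of 0 k r] by simp
    qed
  qed
qed

lemma standard_tableau_std_seq:
  fixes p :: "'m::finite \<Rightarrow> nat list"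
  assumes "(p, T) \<in> standard_tableaux n"
  defines "s \<equiv> inv_into (nodes p) T"
  shows "std_seq n s" and "s ` {1..n} = nodes p" and "\<And>i. 1 \<le> i \<Longrightarrow> i \<le> n \<Longrightarrow> T (s i) = i"
proof -
  have part: "is_partition (p k)" for k
    using assms(1) by (auto simp: standard_tableaux_def m_partitions_def)
  have bij: "bij_betw T (nodes p) {1..n}"
    and cols: "\<And>k r c c'. (k, r, c) \<in> nodes p \<Longrightarrow> (k, r, c') \<in> nodes p \<Longrightarrow> c < c' \<Longrightarrow> T (k, r, c) < T (k, r, c')"
    and rows: "\<And>k r r' c. (k, r, c) \<in> nodes p \<Longrightarrow> (k, r', c) \<in> nodes p \<Longrightarrow> r < r' \<Longrightarrow> T (k, r, c) < T (k, r', c)"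
    using assms(1) unfolding standard_tableaux_def by blast+
  show Ts: "T (s i) = i" if "1 \<le> i" "i \<le> n" for i
    using that bij_betw_inv_into_right[OF bij] by (simp add: s_def)
  have inv: "bij_betw s {1..n} (nodes p)" unfolding s_def by (rule bij_betw_inv_into[OF bij])
  then show im: "s ` {1..n} = nodes p" by (simp add: bij_betw_def)
  have ideal: "order_ideal (nodes p)" using order_ideal_nodes[of p] part by blast
  \<comment> \<open>Prefixes of the sequence are sublevel sets of \<open>T\<close>, so that they are
    ideals because \<open>T\<close> increases along rows and columns.\<close>
  have pre: "s ` {1..j} = {x \<in> nodes p. T x \<le> j}" if "j \<le> n" for j
  proof
    show "s ` {1..j} \<subseteq> {x \<in> nodes p. T x \<le> j}"
      using that Ts im by fastforce
    show "{x \<in> nodes p. T x \<le> j} \<subseteq> s ` {1..j}"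
    proof
      fix x assume x: "x \<in> {x \<in> nodes p. T x \<le> j}"
      then obtain i where i: "i \<in> {1..n}" "x = s i" using im by blast
      then have "i \<le> j" using Ts[of i] x by simp
      then show "x \<in> s ` {1..j}" using i by auto
    qed
  qed
  have "order_ideal (s ` {1..j})" if "j \<le> n" for j
    unfolding pre[OF that] order_ideal_def
  proof (intro conjI allI impI)
    fix k r c
    assume "(k, Suc r, c) \<in> {x \<in> nodes p. T x \<le> j}"
    then have "(k, r, c) \<in> nodes p" "(k, Suc r, c) \<in> nodes p" "T (k, Suc r, c) \<le> j"
      using order_ideal_mem[OF ideal, of k "Suc r" c r c] by auto
    with rows[of k r c "Suc r"] show "(k, r, c) \<in> {x \<in> nodes p. T x \<le> j}" by simp
  next
    fix k r c
    assume "(k, r, Suc c) \<in> {x \<in> nodes p. T x \<le> j}"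
    then have "(k, r, c) \<in> nodes p" "(k, r, Suc c) \<in> nodes p" "T (k, r, Suc c) \<le> j"
      using order_ideal_mem[OF ideal, of k r "Suc c" r c] by auto
    with cols[of k r c "Suc c"] show "(k, r, c) \<in> {x \<in> nodes p. T x \<le> j}" by simp
  qed
  then show "std_seq n s" using inv by (simp add: std_seq_def bij_betw_def)
qed

lemma std_seq_standard_tableau:
  fixes s :: "nat \<Rightarrow> 'm::finite \<times> nat \<times> nat"
  assumes s: "std_seq n s"
  obtains p T where "(p, T) \<in> standard_tableaux n" "\<And>i. 1 \<le> i \<Longrightarrow> i \<le> n \<Longrightarrow> inv_into (nodes p) T i = s i"
proof -
  define D where "D = s ` {1..n}"
  have D: "order_ideal D" "finite D" using s by (auto simp: std_seq_def D_def)
  have inj: "inj_on s {1..n}" using s by (simp add: std_seq_def)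
  define p where "p = rows D"
  have nodes: "nodes p = D" using nodes_rows[OF D] by (simp add: p_def)
  define T where "T = restrict (inv_into {1..n} s) D"
  have Ts: "T (s i) = i" if "1 \<le> i" "i \<le> n" for i
    using that inj by (simp add: T_def D_def)
  have bij: "bij_betw T (nodes p) {1..n}"
    unfolding nodes
  proof (rule bij_betw_byWitness[where f' = s])
    show "\<forall>x\<in>D. s (T x) = x" "T ` D \<subseteq> {1..n}" using Ts by (auto simp: D_def)
  qed (use Ts in \<open>auto simp: D_def\<close>)
  have less: "T x < T y"
    if "x \<in> D" "y \<in> D" "x = (k, r, c)" "y = (k, r', c')" "r \<le> r'" "c \<le> c'" "x \<noteq> y" for x y k r c r' c'
  proof -
    from that obtain i j where ij: "i \<in> {1..n}" "j \<in> {1..n}" "x = s i" "y = s j" unfolding D_def by blast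
    then have "i \<le> j" using std_seq_le[OF s, of i j k r c r' c'] that by auto
    moreover have "i \<noteq> j" using that(7) ij by auto
    ultimately show ?thesis using Ts[of i] Ts[of j] ij by simp
  qed
  have "card (nodes p) = n" unfolding nodes D_def using card_image[OF inj] by simp
  then have "p \<in> m_partitions n"
    using is_partition_rows[OF D] card_nodes[of p] by (simp add: m_partitions_def p_def)
  moreover have "T \<in> nodes p \<rightarrow>\<^sub>E {1..n}"
    unfolding nodes using bij_betw_imp_surj_on[OF bij, unfolded nodes] by (auto simp: T_def)
  ultimately have tab: "(p, T) \<in> standard_tableaux n"
    using bij unfolding standard_tableaux_def
  proof (intro CollectI case_prodI conjI allI impI)
    show "T (k, r, c) < T (k, r, c')" if "(k, r, c) \<in> nodes p \<and> (k, r, c') \<in> nodes p \<and> c < c'" for k r c c'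
      by (rule less[of _ _ k r c r c']) (use that nodes in auto)
    show "T (k, r, c) < T (k, r', c)" if "(k, r, c) \<in> nodes p \<and> (k, r', c) \<in> nodes p \<and> r < r'" for k r r' c
      by (rule less[of _ _ k r c r' c]) (use that nodes in auto)
  qed
  have "inv_into (nodes p) T i = s i" if i: "1 \<le> i" "i \<le> n" for i
    by (rule inv_into_f_eq) (use bij nodes i Ts in \<open>auto simp: bij_betw_def D_def\<close>)
  with tab show ?thesis by (rule that)
qed

lemma bij_betw_Cont_standard_tableaux:
  fixes v :: "'m::finite \<Rightarrow> 'k::field"
  assumes "separated_parameters n q v"
  shows "\<exists>g. bij_betw g (Cont n q v)
    (standard_tableaux n :: (('m \<Rightarrow> nat list) \<times> ('m \<times> nat \<times> nat \<Rightarrow> nat)) set)"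
proof -
  interpret separated_parameters n q v by fact
  define F :: "(('m \<Rightarrow> nat list) \<times> ('m \<times> nat \<times> nat \<Rightarrow> nat)) \<Rightarrow> nat \<Rightarrow> 'k"
    where "F = (\<lambda>(p, T). restrict (\<lambda>i. content (inv_into (nodes p) T i)) {1..n})"
  have "inj_on F (standard_tableaux n)"
  proof (rule inj_onI, clarify)
    fix p T p' T'
    assume P: "(p, T) \<in> standard_tableaux n" and P': "(p', T') \<in> standard_tableaux n"
      and eq: "F (p, T) = F (p', T')"
    let ?s = "inv_into (nodes p) T" and ?t = "inv_into (nodes p') T'"
    note s = standard_tableau_std_seq[OF P] and t = standard_tableau_std_seq[OF P']
    have c: "content (?s i) = content (?t i)" if "1 \<le> i" "i \<le> n" for i
      using fun_cong[OF eq, of i] that by (simp add: F_def)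
    have st: "?s i = ?t i" if "1 \<le> i" "i \<le> n" for i
      using std_seq_eqI[OF s(1) t(1) c that] .
    have "nodes p = ?s ` {1..n}" by (rule s(2)[symmetric])
    also have "\<dots> = ?t ` {1..n}" by (rule image_cong) (use st in auto)
    also have "\<dots> = nodes p'" by (rule t(2))
    finally have nodes: "nodes p = nodes p'" .
    have part: "is_partition (p k)" "is_partition (p' k)" for k
      using P P' by (auto simp: standard_tableaux_def m_partitions_def)
    have "rows (nodes p) = p" by (rule rows_nodes) (rule part)
    moreover have "rows (nodes p') = p'" by (rule rows_nodes) (rule part)
    ultimately have "p = p'" using nodes by metis
    moreover have "T = T'"
    proof (rule extensionalityI)
      show "T \<in> extensional (nodes p)" "T' \<in> extensional (nodes p)"
        using P P' \<open>p = p'\<close> by (auto simp: standard_tableaux_def PiE_iff)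
      fix x assume "x \<in> nodes p"
      then obtain i where i: "i \<in> {1..n}" "x = ?s i" using s(2) by blast
      then show "T x = T' x" using s(3)[of i] t(3)[of i] st[of i] by simp
    qed
    ultimately show "p = p' \<and> T = T'" by blast
  qed
  moreover have "F ` standard_tableaux n = Cont n q v"
  proof
    show "F ` standard_tableaux n \<subseteq> Cont n q v"
    proof (clarify)
      fix p :: "'m \<Rightarrow> nat list" and T
      assume "(p, T) \<in> standard_tableaux n"
      from std_seq_Cont[OF standard_tableau_std_seq(1)[OF this]]
      show "F (p, T) \<in> Cont n q v" by (simp add: F_def)
    qed
    show "Cont n q v \<subseteq> F ` standard_tableaux n"
    proof
      fix a assume a: "a \<in> Cont n q v"
      then obtain s where s: "std_seq n s" "\<And>i. 1 \<le> i \<Longrightarrow> i \<le> n \<Longrightarrow> content (s i) = a i"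
        by (rule Cont_std_seq) blast
      obtain p T where P: "(p, T) \<in> standard_tableaux n"
        and inv: "\<And>i. 1 \<le> i \<Longrightarrow> i \<le> n \<Longrightarrow> inv_into (nodes p) T i = s i"
        using std_seq_standard_tableau[OF s(1)] by blast
      have "F (p, T) = a"
      proof (rule extensionalityI)
        show "a \<in> extensional {1..n}" using a by (simp add: Cont_def PiE_iff)
      qed (use s inv in \<open>auto simp: F_def\<close>)
      then show "a \<in> F ` standard_tableaux n" using P by blast
    qed
  qed
  ultimately have "bij_betw F (standard_tableaux n) (Cont n q v)" by (simp add: bij_betw_def)
  then show ?thesis using bij_betw_inv_into by blast
qed

section \<open>Matrix representations of presented algebras\<close>

lemma invariant_subspace_iff:
  "invariant_subspace d \<A> W \<longleftrightarrow> W \<subseteq> carrier_vec d \<and> 0\<^sub>v d \<in> W \<and> (\<forall>u\<in>W. \<forall>w\<in>W. u + w \<in> W) \<and>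
     (\<forall>c. \<forall>w\<in>W. c \<cdot>\<^sub>v w \<in> W) \<and> (\<forall>X\<in>\<A>. \<forall>w\<in>W. X *\<^sub>v w \<in> W)"
proof -
  have "VectorSpace.subspace class_ring W (module_vec TYPE('a) d) \<longleftrightarrow>
    W \<subseteq> carrier_vec d \<and> 0\<^sub>v d \<in> W \<and> (\<forall>u\<in>W. \<forall>w\<in>W. u + w \<in> W) \<and> (\<forall>c. \<forall>w\<in>W. c \<cdot>\<^sub>v w \<in> W)"
    unfolding VectorSpace.subspace_def submodule_def
    using vec_vs vec_module by (auto simp: module_vec_simps)
  then show ?thesis by (auto simp: invariant_subspace_def)
qed

primrec mat_eval :: "nat \<Rightarrow> ('g \<Rightarrow> 'k::field mat) \<Rightarrow> ('k, 'g) aterm \<Rightarrow> 'k mat" where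
  "mat_eval d M (Scalar c) = c \<cdot>\<^sub>m 1\<^sub>m d"
| "mat_eval d M (Gen g) = M g"
| "mat_eval d M (x \<^bold>+ y) = mat_eval d M x + mat_eval d M y"
| "mat_eval d M (x \<^bold>* y) = mat_eval d M x * mat_eval d M y"

lemma mat_eval_carrier:
  assumes "\<And>g. g \<in> G \<Longrightarrow> M g \<in> carrier_mat d d"
  shows "t \<in> aterms G \<Longrightarrow> mat_eval d M t \<in> carrier_mat d d"
  by (induction t) (use assms in auto)

text \<open>The universal property of the presented algebra: matrices satisfy all identities of
  unital algebras, so only the relations \<open>R\<close> need to be checked.\<close>

lemma alg_cong_mat_eval:
  assumes M: "\<And>g. g \<in> G \<Longrightarrow> M g \<in> carrier_mat d d"
    and R: "\<And>x y. (x, y) \<in> R \<Longrightarrow> x \<in> aterms G \<Longrightarrow> y \<in> aterms G \<Longrightarrow> mat_eval d M x = mat_eval d M y"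
    and xy: "(x, y) \<in> alg_cong G R"
  shows "mat_eval d M x = mat_eval d M y"
proof -
  have carr: "mat_eval d M t \<in> carrier_mat d d" if "t \<in> aterms G" for t
    using mat_eval_carrier[of G M d t] M that by blast
  show ?thesis
    using xy
  proof induction
    case (relation x y)
    then show ?case by (rule R)
  next
    case (plus_assoc x y z)
    then show ?case using carr by (simp add: assoc_add_mat[of _ d d])
  next
    case (plus_comm x y)
    then show ?case using carr by (simp add: comm_add_mat[of _ d d])
  next
    case (plus_zero x)
    have "(0 :: 'b) \<cdot>\<^sub>m 1\<^sub>m d = 0\<^sub>m d d" by (rule eq_matI) auto
    then show ?case using carr[OF plus_zero] by simp
  next
    case (plus_inverse x)
    have "(0 :: 'b) \<cdot>\<^sub>m 1\<^sub>m d = 0\<^sub>m d d" by (rule eq_matI) auto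
    moreover have "((- 1) \<cdot>\<^sub>m 1\<^sub>m d) * mat_eval d M x = - mat_eval d M x"
      using carr[OF plus_inverse] by (subst mult_smult_assoc_mat[of _ d d _ d]) auto
    ultimately show ?case using carr[OF plus_inverse] by simp
  next
    case (times_assoc x y z)
    then show ?case using carr by (simp add: assoc_mult_mat[of _ d d _ d _ d])
  next
    case (times_one x)
    have "(1 :: 'b) \<cdot>\<^sub>m 1\<^sub>m d = 1\<^sub>m d" by (rule eq_matI) auto
    then show ?case using carr[OF times_one] by simp
  next
    case (distrib_right x y z)
    then show ?case using carr by (simp add: add_mult_distrib_mat[of _ d d _ _ d])
  next
    case (distrib_left x y z)
    then show ?case using carr by (simp add: mult_add_distrib_mat[of _ d d _ d])
  next
    case (scalar_plus a b)
    show ?case by (simp, rule eq_matI) (auto simp: algebra_simps)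
  next
    case (scalar_times a b)
    show ?case
      by (simp add: mult_smult_assoc_mat[of _ d d _ d] mult_smult_distrib[of _ d d _ d], rule eq_matI) auto
  next
    case (scalar_central x a)
    have "(a \<cdot>\<^sub>m 1\<^sub>m d) * mat_eval d M x = a \<cdot>\<^sub>m mat_eval d M x"
      using carr[OF scalar_central] by (subst mult_smult_assoc_mat[of _ d d _ d]) auto
    moreover have "mat_eval d M x * (a \<cdot>\<^sub>m 1\<^sub>m d) = a \<cdot>\<^sub>m mat_eval d M x"
      using carr[OF scalar_central] by (subst mult_smult_distrib[of _ d d _ d]) auto
    ultimately show ?case by simp
  qed simp_all
qed

text \<open>A representation is determined by the images of the generators. Every identity in it can
  thus be derived by evaluating terms.\<close>

lemma representation_mat_eval:
  assumes "representation (presented_algebra G R) d \<rho>" and t: "t \<in> aterms G"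
  shows "\<rho> (alg_cong G R `` {t}) = mat_eval d (\<lambda>g. \<rho> (alg_cong G R `` {Gen g})) t"
proof -
  let ?A = "presented_algebra G R"
  have hom: "\<rho> \<in> Ring.ring_hom ?A (ring_mat TYPE('a) d ())"
    and smult: "\<And>c x. x \<in> carrier ?A \<Longrightarrow> \<rho> (c \<odot>\<^bsub>?A\<^esub> x) = c \<cdot>\<^sub>m \<rho> x"
    using assms(1) by (auto simp: representation_def)
  have cl: "alg_cong G R `` {x} \<in> carrier ?A" if "x \<in> aterms G" for x
    using that by (auto simp: presented_algebra_carrier intro: quotientI)
  show ?thesis
    using t
  proof (induction t)
    case (Scalar c)
    have "(Scalar c \<^bold>* Scalar 1, Scalar (c * 1)) \<in> alg_cong G R" by (rule alg_cong.scalar_times)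
    then have "alg_cong G R `` {Scalar c} = alg_cong G R `` {Scalar c \<^bold>* Scalar 1}"
      by (simp add: alg_class_eq_iff alg_cong.sym)
    also have "\<dots> = c \<odot>\<^bsub>?A\<^esub> \<one>\<^bsub>?A\<^esub>"
      by (simp add: presented_algebra_one presented_algebra_smult)
    finally show ?case
      using smult[of "\<one>\<^bsub>?A\<^esub>" c] ring_hom_one[OF hom] cl[of "Scalar 1"]
      by (simp add: presented_algebra_one ring_mat_simps)
  next
    case (Plus x y)
    then show ?case
      using ring_hom_add[OF hom cl[of x] cl[of y]] by (simp add: presented_algebra_add ring_mat_simps)
  next
    case (Times x y)
    then show ?case
      using ring_hom_mult[OF hom cl[of x] cl[of y]] by (simp add: presented_algebra_mult ring_mat_simps)
  qed simp
qed

text \<open>Evaluation at an arbitrary representative of the class; the choice is immaterial once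
  the matrices satisfy the relations.\<close>

definition rep_of :: "nat \<Rightarrow> ('g \<Rightarrow> 'k::field mat) \<Rightarrow> ('k, 'g) aterm set \<Rightarrow> 'k mat" where
  "rep_of d M X = mat_eval d M (SOME t. t \<in> X)"

lemma
  assumes M: "\<And>g. g \<in> G \<Longrightarrow> M g \<in> carrier_mat d d"
    and R: "\<And>x y. (x, y) \<in> R \<Longrightarrow> x \<in> aterms G \<Longrightarrow> y \<in> aterms G \<Longrightarrow> mat_eval d M x = mat_eval d M y"
  shows rep_of_class: "t \<in> aterms G \<Longrightarrow> rep_of d M (alg_cong G R `` {t}) = mat_eval d M t"
    and representation_rep_of: "representation (presented_algebra G R) d (rep_of d M)"
proof -
  show cls: "rep_of d M (alg_cong G R `` {t}) = mat_eval d M t" if "t \<in> aterms G" for t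
  proof -
    have "t \<in> alg_cong G R `` {t}" using that by (auto intro: alg_cong.refl)
    then have "(SOME s. s \<in> alg_cong G R `` {t}) \<in> alg_cong G R `` {t}" by (rule someI)
    then have "(t, SOME s. s \<in> alg_cong G R `` {t}) \<in> alg_cong G R" by simp
    from alg_cong_mat_eval[of G M d R, OF M R this] show ?thesis by (simp add: rep_of_def)
  qed
  let ?A = "presented_algebra G R"
  have rep: "\<exists>x\<in>aterms G. X = alg_cong G R `` {x}" if "X \<in> carrier ?A" for X
    using that by (auto simp: presented_algebra_carrier elim: quotientE)
  have carr: "mat_eval d M t \<in> carrier_mat d d" if "t \<in> aterms G" for t
    using mat_eval_carrier[of G M d t] M that by blast
  have "rep_of d M \<in> Ring.ring_hom ?A (ring_mat TYPE('b) d ())"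
  proof (rule ring_hom_memI)
    fix X assume "X \<in> carrier ?A"
    then show "rep_of d M X \<in> carrier (ring_mat TYPE('b) d ())"
      using rep[of X] carr by (auto simp: cls ring_mat_simps)
  next
    fix X Y assume "X \<in> carrier ?A" "Y \<in> carrier ?A"
    then obtain x y where xy: "x \<in> aterms G" "X = alg_cong G R `` {x}" "y \<in> aterms G" "Y = alg_cong G R `` {y}"
      using rep by meson
    then show "rep_of d M (X \<otimes>\<^bsub>?A\<^esub> Y) = rep_of d M X \<otimes>\<^bsub>ring_mat TYPE('b) d ()\<^esub> rep_of d M Y"
      "rep_of d M (X \<oplus>\<^bsub>?A\<^esub> Y) = rep_of d M X \<oplus>\<^bsub>ring_mat TYPE('b) d ()\<^esub> rep_of d M Y"
      by (simp_all add: cls presented_algebra_mult presented_algebra_add ring_mat_simps)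
  next
    show "rep_of d M \<one>\<^bsub>?A\<^esub> = \<one>\<^bsub>ring_mat TYPE('b) d ()\<^esub>"
      by (simp add: presented_algebra_one cls ring_mat_simps) (rule eq_matI, auto)
  qed
  moreover have "rep_of d M (c \<odot>\<^bsub>?A\<^esub> X) = c \<cdot>\<^sub>m rep_of d M X" if X: "X \<in> carrier ?A" for c X
  proof -
    obtain x where x: "x \<in> aterms G" "X = alg_cong G R `` {x}" using rep[OF X] by blast
    then show ?thesis
      using carr[OF x(1)] by (simp add: presented_algebra_smult cls mult_smult_assoc_mat[of _ d d _ d])
  qed
  ultimately show "representation ?A d (rep_of d M)" by (simp add: representation_def)
qed

text \<open>Representatives of the Jucys-Murphy classes, so that their images can be computed with
  \<open>mat_eval\<close>, both in a given representation and in the seminormal one.\<close>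

fun jucys_murphy_term :: "nat \<Rightarrow> ('k::field, hecke_gen) aterm" where
  "jucys_murphy_term 0 = Scalar 1"
| "jucys_murphy_term (Suc 0) = \<tau>\<^sub>t"
| "jucys_murphy_term (Suc (Suc i)) = \<sigma>\<^sub>t (Suc i) \<^bold>* jucys_murphy_term (Suc i) \<^bold>* \<sigma>\<^sub>t (Suc i)"

lemma sigma_closed: "i \<in> {1..<n} \<Longrightarrow> Sigma i \<in> hecke_gens n"
  by (simp add: hecke_gens_def)

lemma jucys_murphy_term_closed: "i \<le> n \<Longrightarrow> jucys_murphy_term i \<in> aterms (hecke_gens n)"
  by (induction i rule: jucys_murphy_term.induct) (auto simp: hecke_gens_def)

lemma jucys_murphy_class:
  "i \<le> n \<Longrightarrow> jucys_murphy n q v i = alg_cong (hecke_gens n) (hecke_rels n q v) `` {jucys_murphy_term i}"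
proof (induction i rule: jucys_murphy_term.induct)
  case (3 i)
  then show ?case
    using sigma_closed[of "Suc i" n]
    by (simp add: jucys_murphy_term_closed hecke_algebra_def hecke_sigma_def presented_algebra_mult)
qed (simp_all add: hecke_algebra_def hecke_tau_def presented_algebra_one)

lemma cyclotomic_term_closed: "cyclotomic_term v \<in> aterms (hecke_gens n)"
proof -
  have "foldr (\<lambda>k t. (\<tau>\<^sub>t \<^bold>+ Scalar (- v k)) \<^bold>* t) ks (Scalar 1) \<in> aterms (hecke_gens n)" for ks
    by (induction ks) (auto simp: hecke_gens_def)
  then show ?thesis by (simp add: cyclotomic_term_def)
qed

text \<open>This serves twice: it confines the eigenvalues of the first Jucys-Murphy element to the
  range of v, and it verifies the cyclotomic relation on the seminormal basis.\<close>

lemma mat_eval_cyclotomic_term: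
  fixes v :: "'m::{finite,linorder} \<Rightarrow> 'k::field"
  assumes T: "M Tau \<in> carrier_mat d d" and w: "w \<in> carrier_vec d" and eig: "M Tau *\<^sub>v w = c \<cdot>\<^sub>v w"
  shows "mat_eval d M (cyclotomic_term v) *\<^sub>v w = (\<Prod>k\<in>UNIV. c - v k) \<cdot>\<^sub>v w"
proof -
  let ?f = "\<lambda>ks. foldr (\<lambda>k t. (\<tau>\<^sub>t \<^bold>+ Scalar (- v k)) \<^bold>* t) ks (Scalar 1)"
  have "mat_eval d M (?f ks) \<in> carrier_mat d d \<and>
      mat_eval d M (?f ks) *\<^sub>v w = (\<Prod>k\<leftarrow>ks. c - v k) \<cdot>\<^sub>v w" for ks
  proof (induction ks)
    case Nil
    have "(1 :: 'k) \<cdot>\<^sub>m 1\<^sub>m d = 1\<^sub>m d" by (rule eq_matI) auto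
    then show ?case using w by simp
  next
    case (Cons k ks)
    let ?L = "M Tau + - v k \<cdot>\<^sub>m 1\<^sub>m d" and ?r = "\<Prod>k\<leftarrow>ks. c - v k"
    have L: "?L \<in> carrier_mat d d" using T by simp
    have smult: "(- v k \<cdot>\<^sub>m 1\<^sub>m d) *\<^sub>v w = - v k \<cdot>\<^sub>v w"
      using w by (intro eq_vecI) auto
    have "?L *\<^sub>v w = (c - v k) \<cdot>\<^sub>v w"
      using w T by (simp add: add_mult_distrib_mat_vec[of _ d d] eig smult)
        (rule eq_vecI, auto simp: algebra_simps)
    then have "?L *\<^sub>v (?r \<cdot>\<^sub>v w) = (?r * (c - v k)) \<cdot>\<^sub>v w"
      using L w by (simp add: mult_mat_vec[of _ d d] smult_smult_assoc)
    moreover have fk: "mat_eval d M (?f (k # ks)) = ?L * mat_eval d M (?f ks)" by simp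
    ultimately have "mat_eval d M (?f (k # ks)) *\<^sub>v w = (\<Prod>k\<leftarrow>k # ks. c - v k) \<cdot>\<^sub>v w"
      using L Cons w by (simp only: fk assoc_mult_mat_vec[of _ d d _ d]) (simp add: mult.commute)
    moreover have "mat_eval d M (?f (k # ks)) \<in> carrier_mat d d"
      unfolding fk using L Cons by (intro mult_carrier_mat[of _ d d]) auto
    ultimately show ?case by blast
  qed
  then have "mat_eval d M (cyclotomic_term v) *\<^sub>v w = (\<Prod>k\<leftarrow>sorted_list_of_set UNIV. c - v k) \<cdot>\<^sub>v w"
    by (simp add: cyclotomic_term_def)
  also have "(\<Prod>k\<leftarrow>sorted_list_of_set UNIV. c - v k) = (\<Prod>k\<in>UNIV. c - v k)"
    by (subst prod.distinct_set_conv_list[symmetric]) auto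
  finally show ?thesis .
qed

section \<open>Spectra consist of content strings\<close>

text \<open>A diagonalizable matrix has no Jordan chain of length two. In diagonal coordinates (D_ii
  - a) x_i = y_i and (D_ii - a) y_i = 0, where x and y are the coordinates of w and u; this forces
  y_i = 0.\<close>

lemma diagonalizable_generalized_eigenvector:
  fixes A :: "'k::field mat"
  assumes "diagonalizable A" and A: "A \<in> carrier_mat d d"
    and w: "w \<in> carrier_vec d" and u: "u \<in> carrier_vec d"
    and eqs: "A *\<^sub>v w = a \<cdot>\<^sub>v w + u" "A *\<^sub>v u = a \<cdot>\<^sub>v u"
  shows "u = 0\<^sub>v d"
proof -
  obtain D P Q where diag: "diagonal_mat D" and sim: "similar_mat_wit A D P Q"
    using assms(1) unfolding diagonalizable_def similar_mat_def by blast
  note PQ = similar_mat_witD2[OF A sim]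
  note [simp] = PQ(5-7) carrier_matD[OF PQ(5)] carrier_matD[OF PQ(6)] carrier_matD[OF PQ(7)]
  have QA: "Q *\<^sub>v (A *\<^sub>v y) = D *\<^sub>v (Q *\<^sub>v y)" if y: "y \<in> carrier_vec d" for y
  proof -
    have "A *\<^sub>v y = P *\<^sub>v (D *\<^sub>v (Q *\<^sub>v y))"
      unfolding PQ(3) using y
      by (simp add: assoc_mult_mat_vec[of _ d d _ d] mult_carrier_mat[of _ d d _ d] mult_mat_vec_carrier[of _ d d])
    then have "Q *\<^sub>v (A *\<^sub>v y) = (Q * P) *\<^sub>v (D *\<^sub>v (Q *\<^sub>v y))"
      using y by (simp add: assoc_mult_mat_vec[of _ d d _ d] mult_mat_vec_carrier[of _ d d])
    then show ?thesis using y PQ(2) by (simp add: mult_mat_vec_carrier[of _ d d])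
  qed
  have D_index: "(D *\<^sub>v y) $ i = D $$ (i, i) * y $ i" if "i < d" "y \<in> carrier_vec d" for i y
  proof -
    have "(D *\<^sub>v y) $ i = (\<Sum>j\<in>{0..<d}. D $$ (i, j) * y $ j)"
      using that carrier_vecD[OF that(2)] by (simp add: scalar_prod_def)
    also have "\<dots> = (\<Sum>j\<in>{0..<d}. if j = i then D $$ (i, i) * y $ i else 0)"
      using diag that PQ(5) by (intro sum.cong) (auto simp: diagonal_mat_def)
    finally show ?thesis using that by simp
  qed
  have "(Q *\<^sub>v u) $ i = 0" if i: "i < d" for i
  proof -
    have "D *\<^sub>v (Q *\<^sub>v w) = a \<cdot>\<^sub>v (Q *\<^sub>v w) + Q *\<^sub>v u" "D *\<^sub>v (Q *\<^sub>v u) = a \<cdot>\<^sub>v (Q *\<^sub>v u)"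
      using QA[OF w] QA[OF u] w u eqs
      by (simp_all add: mult_add_distrib_mat_vec[of _ d d] mult_mat_vec[of _ d d])
    then have "D $$ (i, i) * (Q *\<^sub>v w) $ i = a * (Q *\<^sub>v w) $ i + (Q *\<^sub>v u) $ i"
      "D $$ (i, i) * (Q *\<^sub>v u) $ i = a * (Q *\<^sub>v u) $ i"
      using D_index[OF i, of "Q *\<^sub>v w"] D_index[OF i, of "Q *\<^sub>v u"] w u i PQ(7)
      by (auto simp del: index_mult_mat_vec)
    then show ?thesis by (cases "(Q *\<^sub>v u) $ i = 0") auto
  qed
  then have "Q *\<^sub>v u = 0\<^sub>v d" by (intro eq_vecI) (simp_all del: index_mult_mat_vec)
  moreover have "P *\<^sub>v 0\<^sub>v d = 0\<^sub>v d" by (intro eq_vecI) (simp_all add: scalar_prod_def)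
  ultimately have "P *\<^sub>v (Q *\<^sub>v u) = 0\<^sub>v d" by simp
  moreover have "P *\<^sub>v (Q *\<^sub>v u) = (P * Q) *\<^sub>v u" using u by (simp add: assoc_mult_mat_vec[of _ d d _ d])
  ultimately show ?thesis using u PQ(1) by simp
qed

section \<open>The relations of a given representation as identities on vectors\<close>

locale hecke_representation =
  fixes n :: nat and q :: "'k::field" and v :: "'m::{finite,linorder} \<Rightarrow> 'k"
    and d :: nat and \<rho> :: "'k hecke_elem \<Rightarrow> 'k mat"
  assumes rep: "representation (hecke_algebra n q v) d \<rho>"
begin

definition gen_mat :: "hecke_gen \<Rightarrow> 'k mat" where
  "gen_mat g = \<rho> (alg_cong (hecke_gens n) (hecke_rels n q v) `` {Gen g})"

definition S :: "nat \<Rightarrow> 'k vec \<Rightarrow> 'k vec" where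
  "S i w = \<rho> (hecke_sigma n q v i) *\<^sub>v w"

definition J :: "nat \<Rightarrow> 'k vec \<Rightarrow> 'k vec" where
  "J i w = \<rho> (jucys_murphy n q v i) *\<^sub>v w"

definition h :: 'k where "h = q - inverse q"

lemma rho_class:
  "t \<in> aterms (hecke_gens n) \<Longrightarrow>
    \<rho> (alg_cong (hecke_gens n) (hecke_rels n q v) `` {t}) = mat_eval d gen_mat t"
  using representation_mat_eval[OF rep[unfolded hecke_algebra_def]]
  unfolding gen_mat_def by blast

lemma rho_carrier:
  assumes "t \<in> aterms (hecke_gens n)"
  shows "\<rho> (alg_cong (hecke_gens n) (hecke_rels n q v) `` {t}) \<in> carrier_mat d d"
proof -
  have "\<rho> \<in> Ring.ring_hom (presented_algebra (hecke_gens n) (hecke_rels n q v)) (ring_mat TYPE('k) d ())"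
    using rep by (simp add: representation_def hecke_algebra_def)
  from ring_hom_closed[OF this] show ?thesis
    using assms by (simp add: presented_algebra_carrier ring_mat_simps quotientI)
qed

lemma gen_mat_carrier: "g \<in> hecke_gens n \<Longrightarrow> gen_mat g \<in> carrier_mat d d"
  using rho_carrier[of "Gen g"] by (simp add: gen_mat_def)

lemma gen_mat_Sigma: "gen_mat (Sigma i) = \<rho> (hecke_sigma n q v i)"
  by (simp add: gen_mat_def hecke_sigma_def)

lemma sigma_carrier: "i \<in> {1..<n} \<Longrightarrow> \<rho> (hecke_sigma n q v i) \<in> carrier_mat d d"
  using gen_mat_carrier[of "Sigma i"] by (simp add: gen_mat_Sigma sigma_closed)

lemma rho_jucys_murphy: "i \<le> n \<Longrightarrow> \<rho> (jucys_murphy n q v i) = mat_eval d gen_mat (jucys_murphy_term i)"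
  by (simp add: jucys_murphy_class rho_class jucys_murphy_term_closed)

lemma jucys_murphy_carrier: "i \<le> n \<Longrightarrow> \<rho> (jucys_murphy n q v i) \<in> carrier_mat d d"
  by (simp add: jucys_murphy_class rho_carrier jucys_murphy_term_closed)

lemma relation:
  assumes "(t, u) \<in> hecke_rels n q v" "t \<in> aterms (hecke_gens n)" "u \<in> aterms (hecke_gens n)"
  shows "mat_eval d gen_mat t = mat_eval d gen_mat u"
proof -
  have "alg_cong (hecke_gens n) (hecke_rels n q v) `` {t} = alg_cong (hecke_gens n) (hecke_rels n q v) `` {u}"
    using assms by (simp add: alg_class_eq_iff alg_cong.relation)
  then show ?thesis using assms rho_class by metis
qed

lemma S_closed [simp]: "i \<in> {1..<n} \<Longrightarrow> w \<in> carrier_vec d \<Longrightarrow> S i w \<in> carrier_vec d"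
  using sigma_carrier unfolding S_def by (rule mult_mat_vec_carrier)

lemma J_closed [simp]: "i \<le> n \<Longrightarrow> w \<in> carrier_vec d \<Longrightarrow> J i w \<in> carrier_vec d"
  using jucys_murphy_carrier unfolding J_def by (rule mult_mat_vec_carrier)

lemma
  assumes "i \<in> {1..<n}" "w \<in> carrier_vec d"
  shows S_add: "u \<in> carrier_vec d \<Longrightarrow> S i (w + u) = S i w + S i u"
    and S_smult: "S i (c \<cdot>\<^sub>v w) = c \<cdot>\<^sub>v S i w"
  using sigma_carrier[OF assms(1)] assms(2)
  by (auto simp: S_def mult_add_distrib_mat_vec[of _ d d] mult_mat_vec[of _ d d])

lemma
  assumes "i \<le> n" "w \<in> carrier_vec d"
  shows J_add: "u \<in> carrier_vec d \<Longrightarrow> J i (w + u) = J i w + J i u"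
    and J_smult: "J i (c \<cdot>\<^sub>v w) = c \<cdot>\<^sub>v J i w"
  using jucys_murphy_carrier[OF assms(1)] assms(2)
  by (auto simp: J_def mult_add_distrib_mat_vec[of _ d d] mult_mat_vec[of _ d d])

lemma S_quadratic:
  assumes i: "i \<in> {1..<n}" and w: "w \<in> carrier_vec d"
  shows "S i (S i w) = h \<cdot>\<^sub>v S i w + w"
proof -
  let ?M = "gen_mat (Sigma i)"
  have M: "?M \<in> carrier_mat d d" using gen_mat_carrier sigma_closed[OF i] .
  have "(\<sigma>\<^sub>t i \<^bold>* \<sigma>\<^sub>t i, Scalar (q - inverse q) \<^bold>* \<sigma>\<^sub>t i \<^bold>+ Scalar 1) \<in> hecke_rels n q v"
    using i by (auto simp: hecke_rels_def)
  from relation[OF this] have "?M * ?M = (h \<cdot>\<^sub>m 1\<^sub>m d) * ?M + 1 \<cdot>\<^sub>m 1\<^sub>m d"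
    using sigma_closed[OF i] by (simp add: h_def)
  then have "(?M * ?M) *\<^sub>v w = ((h \<cdot>\<^sub>m 1\<^sub>m d) * ?M + 1 \<cdot>\<^sub>m 1\<^sub>m d) *\<^sub>v w" by simp
  moreover have "(c \<cdot>\<^sub>m 1\<^sub>m d) *\<^sub>v y = c \<cdot>\<^sub>v y" if "y \<in> carrier_vec d" for c and y :: "'k vec"
    using that by (intro eq_vecI) auto
  moreover have "(h \<cdot>\<^sub>m 1\<^sub>m d) * ?M \<in> carrier_mat d d"
    using M by (intro mult_carrier_mat[of _ d d]) auto
  ultimately show ?thesis
    using M w by (simp add: S_def gen_mat_Sigma[symmetric] assoc_mult_mat_vec[of _ d d _ d]
        add_mult_distrib_mat_vec[of _ d d])
qed

lemma S_braid:
  assumes i: "1 \<le> i" "i + 1 < n" and w: "w \<in> carrier_vec d"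
  shows "S i (S (Suc i) (S i w)) = S (Suc i) (S i (S (Suc i) w))"
proof -
  have i': "i \<in> {1..<n}" "Suc i \<in> {1..<n}" using i by auto
  note M = gen_mat_carrier[OF sigma_closed[OF i'(1)]] gen_mat_carrier[OF sigma_closed[OF i'(2)]]
  have "(\<sigma>\<^sub>t i \<^bold>* \<sigma>\<^sub>t (i + 1) \<^bold>* \<sigma>\<^sub>t i, \<sigma>\<^sub>t (i + 1) \<^bold>* \<sigma>\<^sub>t i \<^bold>* \<sigma>\<^sub>t (i + 1)) \<in> hecke_rels n q v"
    using i unfolding hecke_rels_def by blast
  from relation[OF this] sigma_closed[OF i'(1)] sigma_closed[OF i'(2)]
  have "(gen_mat (Sigma i) * gen_mat (Sigma (Suc i)) * gen_mat (Sigma i)) *\<^sub>v w =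
    (gen_mat (Sigma (Suc i)) * gen_mat (Sigma i) * gen_mat (Sigma (Suc i))) *\<^sub>v w" by simp
  then show ?thesis
    using M w by (simp add: S_def gen_mat_Sigma[symmetric] assoc_mult_mat_vec[of _ d d _ d])
qed

lemma S_commute:
  assumes i: "i \<in> {1..<n}" "j \<in> {1..<n}" "\<bar>int i - int j\<bar> > 1" and w: "w \<in> carrier_vec d"
  shows "S i (S j w) = S j (S i w)"
proof -
  note M = gen_mat_carrier[OF sigma_closed[OF i(1)]] gen_mat_carrier[OF sigma_closed[OF i(2)]]
  have "(\<sigma>\<^sub>t i \<^bold>* \<sigma>\<^sub>t j, \<sigma>\<^sub>t j \<^bold>* \<sigma>\<^sub>t i) \<in> hecke_rels n q v"
    using i unfolding hecke_rels_def by blast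
  from relation[OF this] sigma_closed[OF i(1)] sigma_closed[OF i(2)]
  have "(gen_mat (Sigma i) * gen_mat (Sigma j)) *\<^sub>v w = (gen_mat (Sigma j) * gen_mat (Sigma i)) *\<^sub>v w"
    by simp
  then show ?thesis
    using M w by (simp add: S_def gen_mat_Sigma[symmetric] assoc_mult_mat_vec[of _ d d _ d])
qed

lemma rho_J1: "\<rho> (jucys_murphy n q v (Suc 0)) = gen_mat Tau"
  by (simp add: gen_mat_def hecke_tau_def)

lemma J1_S_commute:
  assumes i: "1 < i" "i < n" and w: "w \<in> carrier_vec d"
  shows "J (Suc 0) (S i w) = S i (J (Suc 0) w)"
proof -
  have i': "i \<in> {1..<n}" and T: "Tau \<in> hecke_gens n" using i by (auto simp: hecke_gens_def)
  note M = gen_mat_carrier[OF T] gen_mat_carrier[OF sigma_closed[OF i']]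
  have "(\<tau>\<^sub>t \<^bold>* \<sigma>\<^sub>t i, \<sigma>\<^sub>t i \<^bold>* \<tau>\<^sub>t) \<in> hecke_rels n q v"
    using i unfolding hecke_rels_def by blast
  from relation[OF this] T sigma_closed[OF i']
  have "(gen_mat Tau * gen_mat (Sigma i)) *\<^sub>v w = (gen_mat (Sigma i) * gen_mat Tau) *\<^sub>v w"
    by simp
  then show ?thesis
    using M w by (simp add: S_def J_def rho_J1 gen_mat_Sigma[symmetric] assoc_mult_mat_vec[of _ d d _ d]
        del: jucys_murphy.simps)
qed

lemma J_Suc:
  assumes i: "1 \<le> i" "i < n" and w: "w \<in> carrier_vec d"
  shows "J (Suc i) w = S i (J i (S i w))"
proof -
  have i': "i \<in> {1..<n}" using i by simp
  obtain i0 where i0: "i = Suc i0" using i(1) by (cases i) auto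
  have "\<rho> (jucys_murphy n q v (Suc i)) = \<rho> (hecke_sigma n q v i) * \<rho> (jucys_murphy n q v i) * \<rho> (hecke_sigma n q v i)"
    using i i0 by (simp only: rho_jucys_murphy Suc_leI less_imp_le) (simp add: gen_mat_Sigma)
  then show ?thesis
    using sigma_carrier[OF i'] jucys_murphy_carrier[of i] i w
    by (simp add: J_def S_def assoc_mult_mat_vec[of _ d d _ d] del: jucys_murphy.simps)
qed

lemma J_S_commute_below:
  assumes "1 \<le> l" "l < i" "i < n" "w \<in> carrier_vec d"
  shows "J l (S i w) = S i (J l w)"
  using assms
proof (induction l arbitrary: w rule: nat_induct_at_least)
  case base
  then show ?case using J1_S_commute[of i w] by simp
next
  case (Suc l)
  then have l: "l \<in> {1..<n}" "i \<in> {1..<n}" "l \<le> n" "\<bar>int l - int i\<bar> > 1" by auto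
  have "J (Suc l) (S i w) = S l (J l (S l (S i w)))" using J_Suc l Suc.prems by simp
  also have "\<dots> = S l (J l (S i (S l w)))" using S_commute[of l i w] l Suc.prems by simp
  also have "\<dots> = S l (S i (J l (S l w)))" using Suc.IH[of "S l w"] l Suc.prems by simp
  also have "\<dots> = S i (S l (J l (S l w)))" using S_commute[of l i] l Suc.prems by simp
  also have "\<dots> = S i (J (Suc l) w)" using J_Suc l Suc.prems by simp
  finally show ?case .
qed

text \<open>The induction step only uses that \<open>S l\<close> and \<open>S i\<close> commute. For
  l = i + 2 the operator J is S_{i+1} S_i J_i S_i S_{i+1}; a braid move turns S_i into S_{i+1},
  which passes J_i, and a second braid move turns it back.\<close>

lemma J_S_commute_above:
  assumes "Suc (Suc i) \<le> l" "1 \<le> i" "l \<le> n" "w \<in> carrier_vec d"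
  shows "J l (S i w) = S i (J l w)"
  using assms
proof (induction l arbitrary: w rule: nat_induct_at_least)
  case base
  let ?j = "Suc i"
  have i: "i \<in> {1..<n}" "?j \<in> {1..<n}" "i \<le> n" "1 \<le> i" "i + 1 < n" "i < n" "?j < n" "1 \<le> ?j"
    using base by auto
  note w = base.prems(3)
  have "J (Suc ?j) (S i w) = S ?j (S i (J i (S i (S ?j (S i w)))))"
    using J_Suc[of ?j] J_Suc[of i] i w by simp
  also have "\<dots> = S ?j (S i (J i (S ?j (S i (S ?j w)))))"
    using S_braid[of i w] i w by simp
  also have "\<dots> = S ?j (S i (S ?j (J i (S i (S ?j w)))))"
    using J_S_commute_below[of i ?j "S i (S ?j w)"] i w by simp
  also have "\<dots> = S i (S ?j (S i (J i (S i (S ?j w)))))"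
    using S_braid[of i "J i (S i (S ?j w))"] i w by simp
  also have "\<dots> = S i (J (Suc ?j) w)"
    using J_Suc[of ?j] J_Suc[of i] i w by simp
  finally show ?case .
next
  case (Suc l)
  then have l: "l \<in> {1..<n}" "i \<in> {1..<n}" "l \<le> n" "\<bar>int l - int i\<bar> > 1" by auto
  have "J (Suc l) (S i w) = S l (J l (S l (S i w)))" using J_Suc l Suc.prems by simp
  also have "\<dots> = S l (J l (S i (S l w)))" using S_commute[of l i w] l Suc.prems by simp
  also have "\<dots> = S l (S i (J l (S l w)))" using Suc.IH[of "S l w"] l Suc.prems by simp
  also have "\<dots> = S i (S l (J l (S l w)))" using S_commute[of l i] l Suc.prems by simp
  also have "\<dots> = S i (J (Suc l) w)" using J_Suc l Suc.prems by simp
  finally show ?case .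
qed

lemma J_S_commute:
  assumes "1 \<le> l" "l \<le> n" "i \<in> {1..<n}" "l \<noteq> i" "l \<noteq> Suc i" "w \<in> carrier_vec d"
  shows "J l (S i w) = S i (J l w)"
  using J_S_commute_below[of l i w] J_S_commute_above[of i l w] assms by fastforce

lemma J1_eigenvector:
  assumes n: "1 \<le> n" and w: "w \<in> carrier_vec d" and eig: "J 1 w = c \<cdot>\<^sub>v w"
  shows "(\<Prod>k\<in>UNIV. c - v k) \<cdot>\<^sub>v w = 0\<^sub>v d"
proof -
  have T: "gen_mat Tau \<in> carrier_mat d d" by (rule gen_mat_carrier) (simp add: hecke_gens_def)
  have "(cyclotomic_term v, Scalar 0) \<in> hecke_rels n q v" by (simp add: hecke_rels_def)
  from relation[OF this cyclotomic_term_closed] have "mat_eval d gen_mat (cyclotomic_term v) = 0 \<cdot>\<^sub>m 1\<^sub>m d"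
    by simp
  moreover have "mat_eval d gen_mat (cyclotomic_term v) *\<^sub>v w = (\<Prod>k\<in>UNIV. c - v k) \<cdot>\<^sub>v w"
    by (rule mat_eval_cyclotomic_term[of gen_mat d w c v, OF T w])
      (use eig in \<open>simp add: J_def rho_J1 del: jucys_murphy.simps\<close>)
  moreover have "(0 \<cdot>\<^sub>m 1\<^sub>m d) *\<^sub>v w = 0\<^sub>v d" using w by (intro eq_vecI) auto
  ultimately show ?thesis by simp
qed

lemma smult_vec_eq_0D:
  "c \<cdot>\<^sub>v w = 0\<^sub>v d \<Longrightarrow> (c :: 'k) \<noteq> 0 \<Longrightarrow> w \<in> carrier_vec d \<Longrightarrow> w = 0\<^sub>v d"
proof (rule eq_vecI)
  fix i assume "c \<cdot>\<^sub>v w = 0\<^sub>v d" "c \<noteq> 0" "w \<in> carrier_vec d" "i < dim_vec (0\<^sub>v d :: 'k vec)"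
  then have "(c \<cdot>\<^sub>v w) $ i = (0\<^sub>v d :: 'k vec) $ i" "i < dim_vec w" "i < d" by simp_all
  then show "w $ i = 0\<^sub>v d $ i" using \<open>c \<noteq> 0\<close> by simp
qed auto

lemma J1_eigenvalue:
  assumes n: "1 \<le> n" and w: "w \<in> carrier_vec d" "w \<noteq> 0\<^sub>v d" and eig: "J 1 w = c \<cdot>\<^sub>v w"
  shows "c \<in> range v"
proof (rule ccontr)
  assume "c \<notin> range v"
  then have "(\<Prod>k\<in>UNIV. c - v k) \<noteq> 0" by auto
  with J1_eigenvector[OF n w(1) eig] w show False using smult_vec_eq_0D by blast
qed

lemma S_inj:
  assumes i: "i \<in> {1..<n}" and w: "w \<in> carrier_vec d" "S i w = 0\<^sub>v d"
  shows "w = 0\<^sub>v d"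
proof -
  have "S i (0 \<cdot>\<^sub>v w) = 0 \<cdot>\<^sub>v S i w" using S_smult[OF i w(1)] .
  moreover have "0 \<cdot>\<^sub>v w = 0\<^sub>v d" using w by (intro eq_vecI) auto
  ultimately have "S i (0\<^sub>v d) = 0\<^sub>v d" using w by auto
  then have "0\<^sub>v d = h \<cdot>\<^sub>v 0\<^sub>v d + w" using S_quadratic[OF i w(1)] w by simp
  also have "\<dots> = w" using w(1) by (intro eq_vecI) auto
  finally show ?thesis by simp
qed

text \<open>Needed to know that the eigenvalues are nonzero. The first element has only the nonzero
  eigenvalues v_k, and the others arise from it by multiplication with the injective operators
  S.\<close>

lemma J_inj:
  assumes v: "\<And>k. v k \<noteq> 0"
  shows "1 \<le> i \<Longrightarrow> i \<le> n \<Longrightarrow> w \<in> carrier_vec d \<Longrightarrow> J i w = 0\<^sub>v d \<Longrightarrow> w = 0\<^sub>v d"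
proof (induction i arbitrary: w rule: nat_induct_at_least)
  case base
  have "J 1 w = 0 \<cdot>\<^sub>v w" using base by (intro eq_vecI) auto
  moreover have "0 \<notin> range v" using v by (metis imageE)
  ultimately show ?case using J1_eigenvalue[of w 0] base by auto
next
  case (Suc i)
  then have i: "i \<in> {1..<n}" by auto
  have "S i (J i (S i w)) = 0\<^sub>v d" using J_Suc[of i w] Suc.prems Suc.hyps by simp
  then have "J i (S i w) = 0\<^sub>v d" using S_inj[OF i, of "J i (S i w)"] i Suc.prems by simp
  then have "S i w = 0\<^sub>v d" using Suc.IH[of "S i w"] i Suc.prems by simp
  then show ?case using S_inj[OF i] Suc.prems by simp
qed

text \<open>By the quadratic relation S - h is inverse to S. Hence J_i S = (S - h) J_{i+1} and
  J_{i+1} S = S J_i (h S + 1), and both can be evaluated at e because S J_i S e = b e.\<close>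

lemma intertwine:
  assumes i: "i \<in> {1..<n}" and e: "e \<in> carrier_vec d"
    and Ji: "J i e = a \<cdot>\<^sub>v e" and Jj: "J (Suc i) e = b \<cdot>\<^sub>v e"
  shows "J i (S i e) = b \<cdot>\<^sub>v S i e + (- (h * b)) \<cdot>\<^sub>v e"
    and "J (Suc i) (S i e) = a \<cdot>\<^sub>v S i e + (h * b) \<cdot>\<^sub>v e"
proof -
  have i': "i \<le> n" "1 \<le> i" "i < n" using i by auto
  have b: "S i (J i (S i e)) = b \<cdot>\<^sub>v e" using J_Suc[of i e] i' e Jj by simp
  have "S i (S i (J i (S i e))) = h \<cdot>\<^sub>v S i (J i (S i e)) + J i (S i e)"
    using S_quadratic[OF i, of "J i (S i e)"] i i' e by simp
  then have eq: "b \<cdot>\<^sub>v S i e = h \<cdot>\<^sub>v (b \<cdot>\<^sub>v e) + J i (S i e)"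
    unfolding b using S_smult[OF i e] by simp
  show "J i (S i e) = b \<cdot>\<^sub>v S i e + (- (h * b)) \<cdot>\<^sub>v e"
    unfolding eq using i i' e by (intro eq_vecI) (auto simp: carrier_vecD[OF J_closed[of i "S i e"]])
  have "J (Suc i) (S i e) = S i (J i (h \<cdot>\<^sub>v S i e + e))"
    using J_Suc[of i "S i e"] S_quadratic[OF i e] i i' e by simp
  also have "J i (h \<cdot>\<^sub>v S i e + e) = h \<cdot>\<^sub>v J i (S i e) + a \<cdot>\<^sub>v e"
    using J_add[of i "h \<cdot>\<^sub>v S i e" e] J_smult[of i "S i e" h] i i' e Ji by simp
  also have "S i \<dots> = h \<cdot>\<^sub>v (b \<cdot>\<^sub>v e) + a \<cdot>\<^sub>v S i e"
    using S_add[OF i, of "h \<cdot>\<^sub>v J i (S i e)" "a \<cdot>\<^sub>v e"] S_smult[OF i] i i' e b by simp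
  also have "\<dots> = a \<cdot>\<^sub>v S i e + (h * b) \<cdot>\<^sub>v e"
    using i e by (intro eq_vecI) (auto simp: carrier_vecD[OF S_closed[of i e]])
  finally show "J (Suc i) (S i e) = a \<cdot>\<^sub>v S i e + (h * b) \<cdot>\<^sub>v e" .
qed

text \<open>It reduces the subspaces in the definition of complete reducibility to those invariant
  under the three generators, in both directions of the comparison with content strings.\<close>

lemma subalgebra_invariant:
  assumes X: "X \<subseteq> carrier (hecke_algebra n q v)" and W: "invariant_subspace d (\<rho> ` X) W"
  shows "invariant_subspace d (\<rho> ` subalgebra_generated (hecke_algebra n q v) X) W"
proof -
  let ?H = "hecke_algebra n q v"
  interpret H: ring ?H unfolding hecke_algebra_def by (rule presented_algebra_ring)
  have hom: "\<rho> \<in> Ring.ring_hom ?H (ring_mat TYPE('k) d ())"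
    and rho_smult: "\<And>c y. y \<in> carrier ?H \<Longrightarrow> \<rho> (c \<odot>\<^bsub>?H\<^esub> y) = c \<cdot>\<^sub>m \<rho> y"
    using rep by (auto simp: representation_def)
  have carr: "\<rho> y \<in> carrier_mat d d" if "y \<in> carrier ?H" for y
    using ring_hom_closed[OF hom that] by (simp add: ring_mat_simps)
  note W' = W[unfolded invariant_subspace_iff]
  have WV: "w \<in> carrier_vec d" if "w \<in> W" for w using W' that by blast
  have "x \<in> carrier ?H \<and> (\<forall>w\<in>W. \<rho> x *\<^sub>v w \<in> W)" if "x \<in> subalgebra_generated ?H X" for x
    using that
  proof induction
    case one
    have "\<rho> \<one>\<^bsub>?H\<^esub> *\<^sub>v w = w" if "w \<in> W" for w
      using ring_hom_one[OF hom] WV[OF that] by (simp add: ring_mat_simps)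
    then show ?case by simp
  next
    case (incl x)
    then show ?case using X W' by blast
  next
    case (add x y)
    then have "\<rho> (x \<oplus>\<^bsub>?H\<^esub> y) *\<^sub>v w = \<rho> x *\<^sub>v w + \<rho> y *\<^sub>v w" if "w \<in> W" for w
      using ring_hom_add[OF hom, of x y] carr WV[OF that]
      by (simp add: ring_mat_simps add_mult_distrib_mat_vec[of _ d d])
    moreover have "u + w \<in> W" if "u \<in> W" "w \<in> W" for u w using W' that by blast
    ultimately show ?case using add by simp
  next
    case (mult x y)
    then have "\<rho> (x \<otimes>\<^bsub>?H\<^esub> y) *\<^sub>v w = \<rho> x *\<^sub>v (\<rho> y *\<^sub>v w)" if "w \<in> W" for w
      using ring_hom_mult[OF hom, of x y] carr WV[OF that]
      by (simp add: ring_mat_simps assoc_mult_mat_vec[of _ d d _ d])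
    then show ?case using mult by simp
  next
    case (smult x c)
    have "\<rho> (c \<odot>\<^bsub>?H\<^esub> x) *\<^sub>v w = c \<cdot>\<^sub>v (\<rho> x *\<^sub>v w)" if "w \<in> W" for w
      using rho_smult[of x c] smult carr[of x] WV[OF that]
      by (intro eq_vecI) (auto simp: carrier_matD)
    moreover have "t \<cdot>\<^sub>v w \<in> W" if "w \<in> W" for t w using W' that by blast
    moreover obtain t where "t \<in> aterms (hecke_gens n)" "x = alg_cong (hecke_gens n) (hecke_rels n q v) `` {t}"
      using smult by (auto simp: hecke_algebra_def presented_algebra_carrier elim: quotientE)
    then have "c \<odot>\<^bsub>?H\<^esub> x \<in> carrier ?H"
      by (simp add: hecke_algebra_def presented_algebra_smult presented_algebra_carrier quotientI)
    ultimately show ?case using smult by simp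
  qed
  then show ?thesis using W' unfolding invariant_subspace_iff by blast
qed

lemma local_generators_closed:
  assumes i: "i \<in> {1..<n}"
  shows "{jucys_murphy n q v i, jucys_murphy n q v (Suc i), hecke_sigma n q v i}
    \<subseteq> carrier (hecke_algebra n q v)"
proof -
  have "jucys_murphy n q v l \<in> carrier (hecke_algebra n q v)" if "l \<le> n" for l
    using that by (simp add: jucys_murphy_class hecke_algebra_def presented_algebra_carrier quotientI
        jucys_murphy_term_closed)
  moreover have "hecke_sigma n q v i \<in> carrier (hecke_algebra n q v)"
    using sigma_closed[OF i]
    by (simp add: hecke_sigma_def hecke_algebra_def presented_algebra_carrier quotientI)
  ultimately show ?thesis using i by simp
qed

text \<open>The equation for c is the condition that the multiples of e in \<open>intertwine\<close>
  cancel. It is kept free of division so that the linked case can use it with c = q or c =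
  -1/q.\<close>

lemma exchange_vector:
  assumes i: "i \<in> {1..<n}" and e: "e \<in> carrier_vec d"
    and Ji: "J i e = a \<cdot>\<^sub>v e" and Jj: "J (Suc i) e = b \<cdot>\<^sub>v e"
    and c: "c * (b - a) = h * b"
  defines "f \<equiv> S i e + (- c) \<cdot>\<^sub>v e"
  shows "J i f = b \<cdot>\<^sub>v f" and "J (Suc i) f = a \<cdot>\<^sub>v f"
proof -
  have i': "i \<le> n" "Suc i \<le> n" using i by auto
  have Se: "S i e \<in> carrier_vec d" using i e by simp
  note dims [simp] = carrier_vecD[OF Se] carrier_vecD[OF e]
  show "J i f = b \<cdot>\<^sub>v f"
  proof -
    have "J i f = (b \<cdot>\<^sub>v S i e + (- (h * b)) \<cdot>\<^sub>v e) + (- c) \<cdot>\<^sub>v (a \<cdot>\<^sub>v e)"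
      using J_add[OF i'(1) Se, of "(- c) \<cdot>\<^sub>v e"] J_smult[OF i'(1) e] intertwine(1)[OF i e Ji Jj] e Ji
      by (simp add: f_def)
    also have "\<dots> = b \<cdot>\<^sub>v f"
      using Se e unfolding f_def c[symmetric] by (intro eq_vecI) (auto simp: algebra_simps)
    finally show ?thesis .
  qed
  show "J (Suc i) f = a \<cdot>\<^sub>v f"
  proof -
    have "J (Suc i) f = (a \<cdot>\<^sub>v S i e + (h * b) \<cdot>\<^sub>v e) + (- c) \<cdot>\<^sub>v (b \<cdot>\<^sub>v e)"
      using J_add[OF i'(2) Se, of "(- c) \<cdot>\<^sub>v e"] J_smult[OF i'(2) e] intertwine(2)[OF i e Ji Jj] e Jj
      by (simp add: f_def)
    also have "\<dots> = a \<cdot>\<^sub>v f"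
      using Se e unfolding f_def c[symmetric] by (intro eq_vecI) (auto simp: algebra_simps)
    finally show ?thesis .
  qed
qed

text \<open>Here \<open>S i e - c e\<close> spans an invariant line. An invariant complement of it contains \<open>e\<close>,
  because \<open>e\<close> and \<open>S i e - c e\<close> are eigenvectors of \<open>J i\<close> for different eigenvalues, and then
  also \<open>S i e - c e\<close>, which therefore vanishes.\<close>

lemma S_eigenvector:
  assumes i: "i \<in> {1..<n}" and e: "e \<in> carrier_vec d"
    and Ji: "J i e = a \<cdot>\<^sub>v e" and Jj: "J (Suc i) e = b \<cdot>\<^sub>v e" and ab: "a \<noteq> b"
    and c: "c * (b - a) = h * b" "c * c = h * c + 1"
    and cr: "completely_reducible d (\<rho> ` subalgebra_generated (hecke_algebra n q v)
        {jucys_murphy n q v i, jucys_murphy n q v (Suc i), hecke_sigma n q v i})"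
  shows "S i e = c \<cdot>\<^sub>v e"
proof -
  let ?X = "{jucys_murphy n q v i, jucys_murphy n q v (Suc i), hecke_sigma n q v i}"
  let ?A = "\<rho> ` subalgebra_generated (hecke_algebra n q v) ?X"
  have i': "i \<le> n" "Suc i \<le> n" using i by auto
  have Se: "S i e \<in> carrier_vec d" using i e by simp
  note dims [simp] = carrier_vecD[OF Se] carrier_vecD[OF e]
  define f where "f = S i e + (- c) \<cdot>\<^sub>v e"
  have f: "f \<in> carrier_vec d" using Se e by (simp add: f_def)
  note Jif = exchange_vector(1)[OF i e Ji Jj c(1), folded f_def]
    and Jjf = exchange_vector(2)[OF i e Ji Jj c(1), folded f_def]
  \<comment> \<open>The roots of x^2 = h x + 1 are c and h - c, so S - c maps into the eigenspace of
    h - c.\<close>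
  have Sf: "S i f = (h - c) \<cdot>\<^sub>v f"
  proof -
    have "S i f = (h \<cdot>\<^sub>v S i e + e) + (- c) \<cdot>\<^sub>v S i e"
      using S_add[OF i Se, of "(- c) \<cdot>\<^sub>v e"] S_smult[OF i e] S_quadratic[OF i e] e
      by (simp add: f_def)
    also have "\<dots> = (h - c) \<cdot>\<^sub>v f"
    proof (rule eq_vecI)
      fix j assume "j < dim_vec ((h - c) \<cdot>\<^sub>v f)"
      then have j: "j < d" using f by simp
      have "e $ j = (c * c - h * c) * e $ j" using c(2) by simp
      then show "(h \<cdot>\<^sub>v S i e + e + - c \<cdot>\<^sub>v S i e) $ j = ((h - c) \<cdot>\<^sub>v f) $ j"
        using j unfolding f_def by (simp add: algebra_simps)
    qed (use f e in simp)
    finally show ?thesis .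
  qed
  define W where "W = {t \<cdot>\<^sub>v f | t. True}"
  have "invariant_subspace d (\<rho> ` ?X) W"
    unfolding invariant_subspace_iff
  proof (intro conjI ballI allI)
    show "W \<subseteq> carrier_vec d" using f by (auto simp: W_def)
    have "0\<^sub>v d = 0 \<cdot>\<^sub>v f" using f by (intro eq_vecI) auto
    then show "0\<^sub>v d \<in> W" unfolding W_def by blast
    show "u + w \<in> W" if uw: "u \<in> W" "w \<in> W" for u w
    proof -
      obtain s t where "u = s \<cdot>\<^sub>v f" "w = t \<cdot>\<^sub>v f" using uw unfolding W_def by blast
      then have "u + w = (s + t) \<cdot>\<^sub>v f" by (simp add: add_smult_distrib_vec)
      then show ?thesis unfolding W_def by blast
    qed
    show "c \<cdot>\<^sub>v w \<in> W" if "w \<in> W" for c w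
      using that unfolding W_def by (auto simp: smult_smult_assoc)
    show "Y *\<^sub>v w \<in> W" if Y: "Y \<in> \<rho> ` ?X" and w: "w \<in> W" for Y w
    proof -
      obtain s where s: "w = s \<cdot>\<^sub>v f" using w unfolding W_def by blast
      from Y consider "Y = \<rho> (jucys_murphy n q v i)" | "Y = \<rho> (jucys_murphy n q v (Suc i))"
        | "Y = \<rho> (hecke_sigma n q v i)" by blast
      then have "\<exists>t. Y *\<^sub>v w = s \<cdot>\<^sub>v (t \<cdot>\<^sub>v f)"
      proof cases
        case 1
        then have "Y *\<^sub>v w = J i (s \<cdot>\<^sub>v f)" by (simp add: J_def s)
        then show ?thesis using J_smult[OF i'(1) f, of s] Jif by auto
      next
        case 2
        then have "Y *\<^sub>v w = J (Suc i) (s \<cdot>\<^sub>v f)" by (simp add: J_def s)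
        then show ?thesis using J_smult[OF i'(2) f, of s] Jjf by auto
      next
        case 3
        then have "Y *\<^sub>v w = S i (s \<cdot>\<^sub>v f)" by (simp add: S_def s)
        then show ?thesis using S_smult[OF i f, of s] Sf by auto
      qed
      then show ?thesis unfolding W_def by (auto simp: smult_smult_assoc)
    qed
  qed
  then have W: "invariant_subspace d ?A W"
    by (rule subalgebra_invariant[OF local_generators_closed[OF i]])
  obtain W' where W': "invariant_subspace d ?A W'" "W \<inter> W' = {0\<^sub>v d}"
    "{w + w' | w w'. w \<in> W \<and> w' \<in> W'} = carrier_vec d"
    using cr[unfolded completely_reducible_def, rule_format, OF W] by blast
  note W'_closed = W'(1)[unfolded invariant_subspace_iff]
  have inv: "J i w \<in> W'" "S i w \<in> W'" if "w \<in> W'" for w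
  proof -
    have "\<rho> (jucys_murphy n q v i) \<in> ?A" "\<rho> (hecke_sigma n q v i) \<in> ?A"
      by (auto intro: subalgebra_generated.incl)
    then show "J i w \<in> W'" "S i w \<in> W'" using W'_closed that unfolding J_def S_def by blast+
  qed
  have add: "u + w \<in> W'" if "u \<in> W'" "w \<in> W'" for u w using W'_closed that by blast
  have smult: "t \<cdot>\<^sub>v w \<in> W'" if "w \<in> W'" for t w using W'_closed that by blast
  have "e \<in> {w + w' | w w'. w \<in> W \<and> w' \<in> W'}" unfolding W'(3) by (rule e)
  then obtain t w' where w': "e = t \<cdot>\<^sub>v f + w'" "w' \<in> W'" unfolding W_def by blast
  have w'c: "w' \<in> carrier_vec d" using w'(2) W'_closed by blast
  have "J i e = t \<cdot>\<^sub>v (b \<cdot>\<^sub>v f) + J i w'"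
    using J_add[OF i'(1), of "t \<cdot>\<^sub>v f" w'] J_smult[OF i'(1) f] f w'c Jif by (simp add: w'(1))
  then have "a \<cdot>\<^sub>v e = t \<cdot>\<^sub>v (b \<cdot>\<^sub>v f) + J i w'" using Ji by simp
  moreover have Jw': "J i w' \<in> carrier_vec d" using i' w'c by simp
  \<comment> \<open>In e = t f + w' the operator J_i - b kills f and multiplies e by a - b, so e is
    a multiple of (J_i - b) w', which lies in the complement.\<close>
  ultimately have "inverse (a - b) \<cdot>\<^sub>v (J i w' + (- b) \<cdot>\<^sub>v w') = e"
  proof (intro eq_vecI)
    fix j assume j: "j < dim_vec e"
    assume eq: "a \<cdot>\<^sub>v e = t \<cdot>\<^sub>v (b \<cdot>\<^sub>v f) + J i w'"
    have jd: "j < d" "j < dim_vec f" "j < dim_vec w'" "j < dim_vec (J i w')"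
      using j f w'c Jw' by auto
    have "(a \<cdot>\<^sub>v e) $ j = (t \<cdot>\<^sub>v (b \<cdot>\<^sub>v f) + J i w') $ j" using eq by simp
    then have 1: "a * e $ j = t * b * f $ j + J i w' $ j" using j jd by simp
    have "e $ j = (t \<cdot>\<^sub>v f + w') $ j" using w'(1) by simp
    then have 2: "e $ j = t * f $ j + w' $ j" using jd by simp
    have "(a - b) * e $ j = J i w' $ j - b * w' $ j"
      using 1 2 by (simp add: algebra_simps)
    then have "inverse (a - b) * (J i w' $ j - b * w' $ j) = e $ j"
      using ab by (simp add: field_simps)
    then show "(inverse (a - b) \<cdot>\<^sub>v (J i w' + (- b) \<cdot>\<^sub>v w')) $ j = e $ j"
      using jd by simp
  qed (use e w'c in simp)
  moreover have "inverse (a - b) \<cdot>\<^sub>v (J i w' + (- b) \<cdot>\<^sub>v w') \<in> W'"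
    using add smult inv w'(2) by blast
  ultimately have "e \<in> W'" by simp
  then have "f \<in> W'" unfolding f_def by (intro add smult inv)
  moreover have "f \<in> W" unfolding W_def using f by (auto intro!: exI[of _ 1])
  ultimately have f0: "f = 0\<^sub>v d" using W'(2) by blast
  show ?thesis
  proof (rule eq_vecI)
    fix j assume "j < dim_vec (c \<cdot>\<^sub>v e)"
    then have "j < d" by simp
    moreover have "f $ j = 0\<^sub>v d $ j" using f0 by simp
    ultimately show "S i e $ j = (c \<cdot>\<^sub>v e) $ j" by (simp add: f_def)
  qed simp
qed

end

section \<open>Adjacent eigenvalues of a joint eigenvector\<close>

context hecke_representation
begin

lemma h_neq_0:
  assumes "q \<noteq> 0" "q\<^sup>2 \<noteq> 1"
  shows "h \<noteq> 0"
  using assms by (auto simp: h_def field_simps power2_eq_square)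

text \<open>For a = b the vectors \<open>S i e\<close> and h a e form a Jordan chain of
  \<open>J (Suc i)\<close>, so h a e = 0. Here h \<noteq> 0 since q^2 \<noteq> 1, and a \<noteq> 0
  by injectivity of \<open>J i\<close>.\<close>

lemma adjacent_eigenvalues_neq:
  assumes i: "i \<in> {1..<n}" and e: "e \<in> carrier_vec d" "e \<noteq> 0\<^sub>v d"
    and Ji: "J i e = a \<cdot>\<^sub>v e" and Jj: "J (Suc i) e = b \<cdot>\<^sub>v e"
    and diag: "diagonalizable (\<rho> (jucys_murphy n q v (Suc i)))"
    and q: "q \<noteq> 0" "q\<^sup>2 \<noteq> 1" and v: "\<And>k. v k \<noteq> 0"
  shows "a \<noteq> b"
proof
  assume "a = b"
  have i': "1 \<le> i" "Suc i \<le> n" "i \<le> n" using i by auto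
  have "a \<noteq> 0"
  proof
    assume "a = 0"
    then have "J i e = 0\<^sub>v d" unfolding Ji using e(1) by (intro eq_vecI) auto
    then show False using J_inj[OF v i'(1,3) e(1)] e(2) by blast
  qed
  have Se: "S i e \<in> carrier_vec d" using i e by simp
  have "(h * a) \<cdot>\<^sub>v e = 0\<^sub>v d"
  proof (rule diagonalizable_generalized_eigenvector[OF diag jucys_murphy_carrier[OF i'(2)] Se])
    show "\<rho> (jucys_murphy n q v (Suc i)) *\<^sub>v S i e = a \<cdot>\<^sub>v S i e + (h * a) \<cdot>\<^sub>v e"
      using intertwine(2)[OF i e(1) Ji Jj] \<open>a = b\<close> by (simp add: J_def)
    show "\<rho> (jucys_murphy n q v (Suc i)) *\<^sub>v ((h * a) \<cdot>\<^sub>v e) = a \<cdot>\<^sub>v ((h * a) \<cdot>\<^sub>v e)"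
      using J_smult[OF i'(2) e(1), of "h * a"] Jj \<open>a = b\<close> by (simp add: J_def smult_smult_assoc mult.commute)
  qed (use e in simp)
  then have "e = 0\<^sub>v d"
    using smult_vec_eq_0D e(1) h_neq_0[OF q] \<open>a \<noteq> 0\<close> by simp
  with e(2) show False ..
qed

text \<open>For linked values the constant h b / (b - a) of the exchange vector is q or -1/q. These
  are the roots of x^2 = h x + 1, as \<open>S_eigenvector\<close> requires.\<close>

lemma linked_S:
  assumes i: "i \<in> {1..<n}" and e: "e \<in> carrier_vec d"
    and Ji: "J i e = a \<cdot>\<^sub>v e" and Jj: "J (Suc i) e = b \<cdot>\<^sub>v e" and ab: "a \<noteq> b"
    and q: "q \<noteq> 0"
    and cr: "completely_reducible d (\<rho> ` subalgebra_generated (hecke_algebra n q v)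
        {jucys_murphy n q v i, jucys_murphy n q v (Suc i), hecke_sigma n q v i})"
  shows "b = q\<^sup>2 * a \<Longrightarrow> S i e = q \<cdot>\<^sub>v e" and "a = q\<^sup>2 * b \<Longrightarrow> S i e = (- inverse q) \<cdot>\<^sub>v e"
proof -
  show "S i e = q \<cdot>\<^sub>v e" if "b = q\<^sup>2 * a"
  proof (rule S_eigenvector[OF i e Ji Jj ab _ _ cr])
    show "q * (b - a) = h * b" "q * q = h * q + 1"
      using q that by (simp_all add: h_def field_simps power2_eq_square)
  qed
  show "S i e = (- inverse q) \<cdot>\<^sub>v e" if "a = q\<^sup>2 * b"
  proof (rule S_eigenvector[OF i e Ji Jj ab _ _ cr])
    show "- inverse q * (b - a) = h * b" "- inverse q * - inverse q = h * - inverse q + 1"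
      using q that by (simp_all add: h_def field_simps power2_eq_square)
  qed
qed

text \<open>Only f \<noteq> 0 depends on the values being unlinked. If f vanished, e would be an
  eigenvector of \<open>S i\<close>, its eigenvalue h b / (b - a) would be q or -1/q, and each of
  these makes a and b linked.\<close>

lemma unlinked_exchange_vector:
  assumes i: "i \<in> {1..<n}" and e: "e \<in> carrier_vec d" "e \<noteq> 0\<^sub>v d"
    and Ji: "J i e = a \<cdot>\<^sub>v e" and Jj: "J (Suc i) e = b \<cdot>\<^sub>v e" and ab: "a \<noteq> b"
    and q: "q \<noteq> 0" and unl: "\<not> linked q a b"
  defines "f \<equiv> S i e + (- (h * b / (b - a))) \<cdot>\<^sub>v e"
  shows "f \<in> carrier_vec d" "f \<noteq> 0\<^sub>v d" "J i f = b \<cdot>\<^sub>v f" "J (Suc i) f = a \<cdot>\<^sub>v f"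
    "\<And>l x. 1 \<le> l \<Longrightarrow> l \<le> n \<Longrightarrow> l \<noteq> i \<Longrightarrow> l \<noteq> Suc i \<Longrightarrow> J l e = x \<cdot>\<^sub>v e \<Longrightarrow> J l f = x \<cdot>\<^sub>v f"
proof -
  let ?c = "h * b / (b - a)"
  have Se: "S i e \<in> carrier_vec d" using i e by simp
  note [simp] = carrier_vecD[OF Se] carrier_vecD[OF e(1)]
  show f: "f \<in> carrier_vec d" using Se e by (simp add: f_def)
  have c: "?c * (b - a) = h * b" using ab by simp
  show "J i f = b \<cdot>\<^sub>v f" "J (Suc i) f = a \<cdot>\<^sub>v f"
    using exchange_vector[OF i e(1) Ji Jj c] by (simp_all add: f_def)
  show "J l f = x \<cdot>\<^sub>v f"
    if l: "1 \<le> l" "l \<le> n" "l \<noteq> i" "l \<noteq> Suc i" "J l e = x \<cdot>\<^sub>v e" for l x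
  proof -
    have "J l f = x \<cdot>\<^sub>v S i e + (- ?c) \<cdot>\<^sub>v (x \<cdot>\<^sub>v e)"
      using J_add[OF l(2) Se, of "(- ?c) \<cdot>\<^sub>v e"] J_smult[OF l(2) e(1)] e(1) l
        J_S_commute[OF l(1,2) i l(3,4) e(1)] S_smult[OF i e(1)]
      by (simp add: f_def)
    also have "\<dots> = x \<cdot>\<^sub>v f" unfolding f_def by (intro eq_vecI) (auto simp: algebra_simps)
    finally show ?thesis .
  qed
  show "f \<noteq> 0\<^sub>v d"
  proof
    assume f0: "f = 0\<^sub>v d"
    have Sc: "S i e = ?c \<cdot>\<^sub>v e"
    proof (rule eq_vecI)
      fix j assume "j < dim_vec (?c \<cdot>\<^sub>v e)"
      then have "j < d" by simp
      moreover have "f $ j = 0\<^sub>v d $ j" using f0 by simp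
      ultimately show "S i e $ j = (?c \<cdot>\<^sub>v e) $ j" by (simp add: f_def)
    qed simp
    obtain j where j: "j < d" "e $ j \<noteq> 0"
      using e by (metis carrier_vecD eq_vecI index_zero_vec)
    have "(?c \<cdot>\<^sub>v (?c \<cdot>\<^sub>v e)) $ j = (h \<cdot>\<^sub>v (?c \<cdot>\<^sub>v e) + e) $ j"
      using S_quadratic[OF i e(1)] S_smult[OF i e(1)] Sc by simp
    then have "(?c * ?c - h * ?c - 1) * e $ j = 0" using j by (simp add: algebra_simps)
    then have "?c * ?c - h * ?c - 1 = 0" using j by simp
    moreover have "x = q \<or> x = - inverse q" if "x * x - h * x - 1 = 0" for x
    proof -
      have "x * x - h * x - 1 = (x - q) * (x + inverse q)"
        using q by (simp add: h_def algebra_simps)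
      with that show ?thesis by (auto simp: eq_neg_iff_add_eq_0)
    qed
    ultimately have cq: "?c = q \<or> ?c = - inverse q" by blast
    have "?c = q \<Longrightarrow> b = q\<^sup>2 * a"
    proof -
      assume "?c = q"
      then have "q * (b - a) = (q - inverse q) * b" using c by (simp add: h_def)
      then have "q * (q * (b - a)) = q * ((q - inverse q) * b)" by simp
      then show "b = q\<^sup>2 * a" using q by (simp add: algebra_simps power2_eq_square)
    qed
    moreover have "?c = - inverse q \<Longrightarrow> a = q\<^sup>2 * b"
    proof -
      assume "?c = - inverse q"
      then have "- inverse q * (b - a) = (q - inverse q) * b" using c by (simp add: h_def)
      then have "q * (- inverse q * (b - a)) = q * ((q - inverse q) * b)" by simp
      then show "a = q\<^sup>2 * b" using q by (simp add: algebra_simps power2_eq_square)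
    qed
    ultimately show False using cq unl by (auto simp: linked_def)
  qed
qed

end

lemma Spec_subset_Cont:
  fixes q :: "'k::field" and v :: "'m::{finite,linorder} \<Rightarrow> 'k"
  assumes n: "1 \<le> n" and q: "q \<noteq> 0" and v: "\<And>k. v k \<noteq> 0"
    and q2: "2 \<le> n \<Longrightarrow> q\<^sup>2 \<noteq> 1" and q4: "2 \<le> n \<Longrightarrow> q ^ 4 \<noteq> 1"
  shows "Spec n q v \<subseteq> Cont n q v"
proof (rule exchange_closed_subset_Cont[OF q n])
  show "Spec n q v \<subseteq> {1..n} \<rightarrow>\<^sub>E UNIV" by (auto simp: Spec_def)
  have *: "\<exists>d \<rho> e. C_representation n q v d \<rho> \<and> hecke_representation n q v d \<rho> \<and>
      e \<in> carrier_vec d \<and> e \<noteq> 0\<^sub>v d \<and> (\<forall>i\<in>{1..n}. hecke_representation.J n q v \<rho> i e = a i \<cdot>\<^sub>v e)"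
    if "a \<in> Spec n q v" for a
  proof -
    from that obtain d \<rho> e where C: "C_representation n q v d \<rho>" and e: "e \<in> carrier_vec d" "e \<noteq> 0\<^sub>v d"
      "\<forall>i\<in>{1..n}. \<rho> (jucys_murphy n q v i) *\<^sub>v e = a i \<cdot>\<^sub>v e" unfolding Spec_def by blast
    have R: "hecke_representation n q v d \<rho>"
      using C by (simp add: C_representation_def hecke_representation_def)
    show ?thesis
      using C R e by (intro exI[of _ d] exI[of _ \<rho>] exI[of _ e]) (simp add: hecke_representation.J_def)
  qed
  fix a assume a: "a \<in> Spec n q v"
  obtain d \<rho> e where C: "C_representation n q v d \<rho>" and R: "hecke_representation n q v d \<rho>"
    and e: "e \<in> carrier_vec d" "e \<noteq> 0\<^sub>v d"
    and J: "\<And>i. i \<in> {1..n} \<Longrightarrow> hecke_representation.J n q v \<rho> i e = a i \<cdot>\<^sub>v e"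
    using *[OF a] by blast
  interpret hecke_representation n q v d \<rho> by (rule R)
  have diag: "diagonalizable (\<rho> (jucys_murphy n q v i))" if "i \<in> {1..n}" for i
    using C that by (simp add: C_representation_def)
  have cr: "completely_reducible d (\<rho> ` subalgebra_generated (hecke_algebra n q v)
      {jucys_murphy n q v i, jucys_murphy n q v (Suc i), hecke_sigma n q v i})" if "i \<in> {1..<n}" for i
    using C that by (simp add: C_representation_def del: jucys_murphy.simps)
  show "a 1 \<in> range v" using J1_eigenvalue[OF n e] J[of 1] n by simp
  have adjacent: "a i \<noteq> a (Suc i)" if i: "1 \<le> i" "i < n" for i
    by (rule adjacent_eigenvalues_neq[of i e]) (use i e J diag q q2 v in auto)
  show "a i \<noteq> a (Suc i)" if "1 \<le> i" "i < n" for i using adjacent that .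
  show "swap_at i a \<in> Spec n q v" if i: "1 \<le> i" "i < n" and unl: "\<not> linked q (a i) (a (Suc i))" for i
  proof -
    have i': "i \<in> {1..<n}" "i \<in> {1..n}" "Suc i \<in> {1..n}" using i by auto
    note f = unlinked_exchange_vector[OF i'(1) e J[OF i'(2)] J[OF i'(3)] adjacent[OF i] q unl]
    let ?f = "S i e + (- (h * a (Suc i) / (a (Suc i) - a i))) \<cdot>\<^sub>v e"
    have "J l ?f = swap_at i a l \<cdot>\<^sub>v ?f" if "l \<in> {1..n}" for l
      using f(3,4) f(5)[of l "a l"] J[OF that] that by (auto simp: swap_at_apply)
    moreover have "swap_at i a \<in> {1..n} \<rightarrow>\<^sub>E UNIV"
      by (rule swap_at_PiE[OF _ i]) (use a in \<open>simp add: Spec_def\<close>)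
    ultimately show ?thesis
      unfolding Spec_def using C f(1,2) unfolding J_def by blast
  qed
  show "a i \<noteq> a (Suc (Suc i))" if i: "1 \<le> i" "Suc i < n" and link: "linked q (a i) (a (Suc i))" for i
  proof
    assume eq: "a i = a (Suc (Suc i))"
    have i': "i \<in> {1..<n}" "Suc i \<in> {1..<n}" "i \<in> {1..n}" "Suc i \<in> {1..n}" "Suc (Suc i) \<in> {1..n}"
      using i by auto
    have J': "J (Suc (Suc i)) e = a i \<cdot>\<^sub>v e" using J[OF i'(5)] eq by simp
    have ne: "a i \<noteq> a (Suc i)" using adjacent[of i] i by simp
    note Si = linked_S[OF i'(1) e(1) J[OF i'(3)] J[OF i'(4)] ne q cr[OF i'(1)]]
      and Sj = linked_S[OF i'(2) e(1) J[OF i'(4)] J' ne[symmetric] q cr[OF i'(2)]]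
    obtain j where j: "j < d" "e $ j \<noteq> 0"
      using e by (metis carrier_vecD eq_vecI index_zero_vec)
    \<comment> \<open>In a pattern x, y, x of eigenvalues the two links point in opposite
      directions, so \<open>S i\<close> and \<open>S (Suc i)\<close> act on e by q and -1/q in some
      order. The braid relation makes these two scalars equal; as their product is -1, their square
      is -1, against q^4 \<noteq> 1.\<close>
    have contra: False if c: "S i e = x \<cdot>\<^sub>v e" "S (Suc i) e = y \<cdot>\<^sub>v e" "x * y = -1" "x + inverse x \<noteq> 0" "x \<noteq> 0" for x y
    proof -
      have "S i (S (Suc i) (S i e)) = S (Suc i) (S i (S (Suc i) e))"
        using S_braid[of i e] i e(1) by simp
      then have "(x * (y * x)) \<cdot>\<^sub>v e = (y * (x * y)) \<cdot>\<^sub>v e"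
        using c(1,2) S_smult[OF i'(1)] S_smult[OF i'(2)] e(1) by (simp add: smult_smult_assoc mult_ac)
      then have "((x * (y * x)) \<cdot>\<^sub>v e) $ j = ((y * (x * y)) \<cdot>\<^sub>v e) $ j" by simp
      then have "x * (y * x) = y * (x * y)" using j carrier_vecD[OF e(1)] by simp
      then have "(x * y) * x = (x * y) * y" by (simp add: mult_ac)
      then have "x = y" using c(3) by simp
      have "x * (x + inverse x) = x * x + x * inverse x" by (rule semiring_class.distrib_left)
      also have "\<dots> = x * y + 1" using \<open>x = y\<close> c(5) by simp
      finally have "x * (x + inverse x) = 0" using c(3) by simp
      then show False using c(3-5) by simp
    qed
    have "q + inverse q \<noteq> 0"
    proof
      assume "q + inverse q = 0"
      then have "q * q = -1" using q by (simp add: eq_neg_iff_add_eq_0 field_simps)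
      then have "q ^ 4 = 1" by (simp add: power4_eq_xxxx)
      then show False using q4 i by simp
    qed
    moreover have "- inverse q + inverse (- inverse q) = - (q + inverse q)" by simp
    ultimately have sum: "q + inverse q \<noteq> 0" "- inverse q + inverse (- inverse q) \<noteq> 0"
      by (simp_all only: neg_equal_0_iff_equal not_False_eq_True)
    from link consider "a (Suc i) = q\<^sup>2 * a i" | "a i = q\<^sup>2 * a (Suc i)" by (auto simp: linked_def)
    then show False
    proof cases
      case 1
      show ?thesis by (rule contra[OF Si(1)[OF 1] Sj(2)[OF 1]]) (use sum q in auto)
    next
      case 2
      show ?thesis by (rule contra[OF Si(2)[OF 2] Sj(1)[OF 2]]) (use sum q in auto)
    qed
  qed
qed

section \<open>The seminormal representation\<close>

text \<open>The conditions on q^2 and q^4 concern adjacent entries and triples of entries, so they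
  are imposed for n \<ge> 2 only: q^2 \<noteq> 1 keeps equal neighbours out of the spectrum, q^4
  \<noteq> 1 excludes the pattern x, y, x.\<close>

locale seminormal =
  fixes n :: nat and q :: "'k::field" and v :: "'m::{finite,linorder} \<Rightarrow> 'k"
  assumes n: "1 \<le> n" and q: "q \<noteq> 0" and v: "v k \<noteq> 0"
    and q2: "2 \<le> n \<Longrightarrow> q\<^sup>2 \<noteq> 1" and q4: "2 \<le> n \<Longrightarrow> q ^ 4 \<noteq> 1"
begin

text \<open>The coefficients of the seminormal form: \<open>\<sigma>\<^sub>i\<close> acts on functions of content strings by
  \<open>\<alpha> (a i) (a (i + 1))\<close> times the function plus \<open>\<beta> (a i) (a (i + 1))\<close> times the function composed
  with the exchange of the entries \<open>i\<close> and \<open>i + 1\<close>. The formula for \<open>\<beta>\<close> is replaced by \<open>0\<close> on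
  linked pairs, where the exchanged string need not be a content string; the product
  \<open>\<beta> x y * \<beta> y x\<close> vanishes there anyway, so all identities keep their generic form.\<close>

definition \<alpha> :: "'k \<Rightarrow> 'k \<Rightarrow> 'k" where
  "\<alpha> x y = (q - inverse q) * y / (y - x)"

definition \<beta> :: "'k \<Rightarrow> 'k \<Rightarrow> 'k" where
  "\<beta> x y = (if linked q x y then 0 else (inverse q * y - q * x) / (y - x))"

lemma \<alpha>_sum: "x \<noteq> y \<Longrightarrow> \<alpha> x y + \<alpha> y x = q - inverse q"
proof -
  assume "x \<noteq> y"
  then have "y / (y - x) + x / (x - y) = 1"
    by (simp add: divide_simps) (simp add: algebra_simps)
  then have "(q - inverse q) * (y / (y - x) + x / (x - y)) = q - inverse q" by simp
  then show ?thesis unfolding \<alpha>_def semiring_class.distrib_left by simp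
qed

lemma \<alpha>_weighted: "x \<noteq> y \<Longrightarrow> x * \<alpha> x y + y * \<alpha> y x = 0"
  unfolding \<alpha>_def by (simp add: divide_simps) (simp add: algebra_simps)

lemma \<alpha>_quadratic: "x \<noteq> y \<Longrightarrow> 1 + \<alpha> x y * \<alpha> y x = (inverse q * y - q * x) * (inverse q * x - q * y) / ((y - x) * (x - y))"
  unfolding \<alpha>_def using q by (simp add: divide_simps) (simp add: algebra_simps power2_eq_square)

lemma \<beta>_product:
  assumes "x \<noteq> y"
  shows "\<beta> x y * \<beta> y x = 1 + \<alpha> x y * \<alpha> y x"
proof (cases "linked q x y")
  case True
  then have "inverse q * y - q * x = 0 \<or> inverse q * x - q * y = 0"
    using q by (auto simp: linked_def field_simps power2_eq_square)
  then show ?thesis using True \<alpha>_quadratic[OF assms] by (auto simp: \<beta>_def)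
next
  case False
  then have "\<not> linked q y x" using linked_sym by metis
  with False show ?thesis using \<alpha>_quadratic[OF assms] by (simp add: \<beta>_def)
qed

lemma \<beta>_neq_0: "\<not> linked q x y \<Longrightarrow> x \<noteq> y \<Longrightarrow> \<beta> x y \<noteq> 0"
  using q by (auto simp: \<beta>_def linked_def field_simps power2_eq_square)

text \<open>These are the coefficients of single exchanges in the braid relation. After removal of
  the common factor (q - 1/q)^2 they are identities of rational functions in x, y, z.\<close>

lemma
  assumes "x \<noteq> y" "y \<noteq> z" "x \<noteq> z"
  shows \<alpha>_triple1: "\<alpha> x y * \<alpha> y z + \<alpha> y x * \<alpha> x z = \<alpha> y z * \<alpha> x z"
    and \<alpha>_triple2: "\<alpha> x y * \<alpha> x z = \<alpha> y z * \<alpha> x y + \<alpha> z y * \<alpha> x z"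
proof -
  have red: "\<alpha> x y = (q - inverse q) * (y / (y - x))" for x y by (simp add: \<alpha>_def)
  have "y / (y - x) * (z / (z - y)) + x / (x - y) * (z / (z - x)) = z / (z - y) * (z / (z - x))"
    using assms by (simp add: divide_simps) (simp add: algebra_simps)
  then have "(q - inverse q)\<^sup>2 * (y / (y - x) * (z / (z - y)) + x / (x - y) * (z / (z - x)))
    = (q - inverse q)\<^sup>2 * (z / (z - y) * (z / (z - x)))" by simp
  then show "\<alpha> x y * \<alpha> y z + \<alpha> y x * \<alpha> x z = \<alpha> y z * \<alpha> x z"
    unfolding red power2_eq_square by (simp only: semiring_class.distrib_left mult_ac)
  have "y / (y - x) * (z / (z - x)) = z / (z - y) * (y / (y - x)) + y / (y - z) * (z / (z - x))"
    using assms by (simp add: divide_simps) (simp add: algebra_simps)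
  then have "(q - inverse q)\<^sup>2 * (y / (y - x) * (z / (z - x)))
    = (q - inverse q)\<^sup>2 * (z / (z - y) * (y / (y - x)) + y / (y - z) * (z / (z - x)))" by simp
  then show "\<alpha> x y * \<alpha> x z = \<alpha> y z * \<alpha> x y + \<alpha> z y * \<alpha> x z"
    unfolding red power2_eq_square by (simp only: semiring_class.distrib_left mult_ac)
qed

definition op :: "nat \<Rightarrow> ((nat \<Rightarrow> 'k) \<Rightarrow> 'k) \<Rightarrow> (nat \<Rightarrow> 'k) \<Rightarrow> 'k" where
  "op i g a = \<alpha> (a i) (a (Suc i)) * g a + \<beta> (a i) (a (Suc i)) * g (swap_at i a)"

lemma op_quadratic:
  assumes "a i \<noteq> a (Suc i)"
  shows "op i (op i g) a = (q - inverse q) * op i g a + g a"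
proof -
  let ?x = "a i" and ?y = "a (Suc i)"
  have "op i (op i g) a = (\<alpha> ?x ?y * \<alpha> ?x ?y + \<beta> ?x ?y * \<beta> ?y ?x) * g a
      + (\<alpha> ?x ?y + \<alpha> ?y ?x) * \<beta> ?x ?y * g (swap_at i a)"
    by (simp add: op_def swap_at_apply algebra_simps)
  also have "\<dots> = (\<alpha> ?x ?y * (\<alpha> ?x ?y + \<alpha> ?y ?x) + 1) * g a
      + (\<alpha> ?x ?y + \<alpha> ?y ?x) * \<beta> ?x ?y * g (swap_at i a)"
    unfolding \<beta>_product[OF assms] by (simp add: algebra_simps)
  also have "\<dots> = (q - inverse q) * op i g a + g a"
    unfolding \<alpha>_sum[OF assms] by (simp add: op_def algebra_simps)
  finally show ?thesis .
qed

text \<open>This is the recursion of the Jucys-Murphy elements: if the element of index i multiplies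
  by the entry i, the next one multiplies by the entry i + 1. The off-diagonal part cancels by
  \<open>\<alpha>_weighted\<close>.\<close>

lemma op_conjugate:
  assumes "a i \<noteq> a (Suc i)"
  shows "op i (\<lambda>b. b i * op i g b) a = a (Suc i) * g a"
proof -
  let ?x = "a i" and ?y = "a (Suc i)"
  have "op i (\<lambda>b. b i * op i g b) a = (?x * \<alpha> ?x ?y * \<alpha> ?x ?y + ?y * (\<beta> ?x ?y * \<beta> ?y ?x)) * g a
      + (?x * \<alpha> ?x ?y + ?y * \<alpha> ?y ?x) * \<beta> ?x ?y * g (swap_at i a)"
    by (simp add: op_def swap_at_apply algebra_simps)
  also have "\<dots> = (\<alpha> ?x ?y * (?x * \<alpha> ?x ?y + ?y * \<alpha> ?y ?x) + ?y) * g a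
      + (?x * \<alpha> ?x ?y + ?y * \<alpha> ?y ?x) * \<beta> ?x ?y * g (swap_at i a)"
    unfolding \<beta>_product[OF assms] by (simp add: algebra_simps)
  also have "\<dots> = a (Suc i) * g a"
    unfolding \<alpha>_weighted[OF assms] by simp
  finally show ?thesis .
qed

lemma op_commute:
  assumes "Suc i < j"
  shows "op i (op j g) a = op j (op i g) a"
  using assms by (simp add: op_def swap_at_apply swap_at_commute[OF assms] algebra_simps)

text \<open>Both sides are expanded over the six rearrangements of three entries. The coefficients
  of two and three exchanges coincide, those of one exchange are the two triple identities, and that
  of \<open>a\<close> itself combines these with \<open>\<beta>_product\<close>.\<close>

lemma op_braid:
  assumes "a i \<noteq> a (Suc i)" "a (Suc i) \<noteq> a (Suc (Suc i))" "a i \<noteq> a (Suc (Suc i))"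
  shows "op i (op (Suc i) (op i g)) a = op (Suc i) (op i (op (Suc i) g)) a"
proof -
  let ?x = "a i" and ?y = "a (Suc i)" and ?z = "a (Suc (Suc i))"
  let ?s = "swap_at i" and ?t = "swap_at (Suc i)"
  have L: "op i (op (Suc i) (op i g)) a =
      (\<alpha> ?x ?y * \<alpha> ?x ?y * \<alpha> ?y ?z + \<beta> ?x ?y * \<beta> ?y ?x * \<alpha> ?x ?z) * g a
    + \<beta> ?x ?y * (\<alpha> ?x ?y * \<alpha> ?y ?z + \<alpha> ?y ?x * \<alpha> ?x ?z) * g (?s a)
    + \<beta> ?y ?z * (\<alpha> ?x ?y * \<alpha> ?x ?z) * g (?t a)
    + \<alpha> ?x ?y * \<beta> ?y ?z * \<beta> ?x ?z * g (?s (?t a))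
    + \<beta> ?x ?y * \<beta> ?x ?z * \<alpha> ?y ?z * g (?t (?s a))
    + \<beta> ?x ?y * \<beta> ?x ?z * \<beta> ?y ?z * g (?s (?t (?s a)))"
    by (simp add: op_def swap_at_apply algebra_simps)
  have R: "op (Suc i) (op i (op (Suc i) g)) a =
      (\<alpha> ?y ?z * \<alpha> ?y ?z * \<alpha> ?x ?y + \<beta> ?y ?z * \<beta> ?z ?y * \<alpha> ?x ?z) * g a
    + \<beta> ?x ?y * (\<alpha> ?y ?z * \<alpha> ?x ?z) * g (?s a)
    + \<beta> ?y ?z * (\<alpha> ?y ?z * \<alpha> ?x ?y + \<alpha> ?z ?y * \<alpha> ?x ?z) * g (?t a)
    + \<alpha> ?x ?y * \<beta> ?y ?z * \<beta> ?x ?z * g (?s (?t a))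
    + \<beta> ?x ?y * \<beta> ?x ?z * \<alpha> ?y ?z * g (?t (?s a))
    + \<beta> ?x ?y * \<beta> ?x ?z * \<beta> ?y ?z * g (?t (?s (?t a)))"
    by (simp add: op_def swap_at_apply algebra_simps)
  have "\<alpha> ?x ?y * \<alpha> ?x ?y * \<alpha> ?y ?z + \<beta> ?x ?y * \<beta> ?y ?x * \<alpha> ?x ?z
      = \<alpha> ?x ?y * (\<alpha> ?x ?y * \<alpha> ?y ?z + \<alpha> ?y ?x * \<alpha> ?x ?z) + \<alpha> ?x ?z"
    unfolding \<beta>_product[OF assms(1)] by (simp add: algebra_simps)
  also have "\<dots> = \<alpha> ?y ?z * (\<alpha> ?x ?y * \<alpha> ?x ?z) + \<alpha> ?x ?z"
    unfolding \<alpha>_triple1[OF assms] by (simp add: algebra_simps)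
  also have "\<dots> = \<alpha> ?y ?z * \<alpha> ?y ?z * \<alpha> ?x ?y + \<beta> ?y ?z * \<beta> ?z ?y * \<alpha> ?x ?z"
    unfolding \<beta>_product[OF assms(2)] \<alpha>_triple2[OF assms] by (simp add: algebra_simps)
  finally have "\<alpha> ?x ?y * \<alpha> ?x ?y * \<alpha> ?y ?z + \<beta> ?x ?y * \<beta> ?y ?x * \<alpha> ?x ?z
    = \<alpha> ?y ?z * \<alpha> ?y ?z * \<alpha> ?x ?y + \<beta> ?y ?z * \<beta> ?z ?y * \<alpha> ?x ?z" .
  then show ?thesis
    unfolding L R \<alpha>_triple1[OF assms] \<alpha>_triple2[OF assms] swap_at_braid by simp
qed

lemma Cont_neq_0:
  assumes a: "a \<in> Cont n q v" and j: "1 \<le> j" "j \<le> n"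
  shows "a j \<noteq> 0"
  using j
proof (induction j rule: less_induct)
  case (less j)
  have "a j \<in> range v \<or> (\<exists>l\<in>{1..<j}. linked q (a l) (a j))"
    using Cont_linked[OF q a less.prems(2,1)] .
  then show ?case
  proof (elim disjE bexE)
    fix l assume l: "l \<in> {1..<j}" "linked q (a l) (a j)"
    then have "a l \<noteq> 0" using less by auto
    then show ?thesis using l(2) q by (auto simp: linked_def)
  qed (use v in auto)
qed

text \<open>By c3 the single entry in the middle would have to be both q^2 z and q^(-2) z for the
  nonzero outer value z, giving q^4 = 1.\<close>

lemma Cont_triple_distinct:
  assumes a: "a \<in> Cont n q v" and i: "1 \<le> i" "Suc i < n"
  shows "a i \<noteq> a (Suc (Suc i))"
proof
  assume eq: "a i = a (Suc (Suc i))"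
  let ?z = "a (Suc (Suc i))"
  have "Suc (Suc i) \<le> n" "i < Suc (Suc i)" using i by auto
  note between = Cont_between[OF q a this(1) i(1) this(2) eq]
  from between(1) obtain l where "i < l" "l < Suc (Suc i)" "a l = q\<^sup>2 * ?z" by blast
  moreover then have "l = Suc i" by simp
  moreover from between(2) obtain l' where "i < l'" "l' < Suc (Suc i)" "q\<^sup>2 * a l' = ?z" by blast
  moreover then have "l' = Suc i" by simp
  ultimately have "q\<^sup>2 * (q\<^sup>2 * ?z) = ?z" by simp
  then have "(q ^ 4 - 1) * ?z = 0" by (simp add: algebra_simps power2_eq_square power4_eq_xxxx)
  moreover have "?z \<noteq> 0" using Cont_neq_0[OF a, of "Suc (Suc i)"] i by simp
  ultimately show False using q4 i by simp
qed

section \<open>Matrices indexed by content strings\<close>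

lemma finite_strings: "finite (Cont n q v)"
  using finite_Cont[OF q n] .

definition d :: nat where "d = card (Cont n q v)"

definition str :: "nat \<Rightarrow> nat \<Rightarrow> 'k" where
  "str = (SOME f. bij_betw f {0..<d} (Cont n q v))"

definition idx :: "(nat \<Rightarrow> 'k) \<Rightarrow> nat" where
  "idx = inv_into {0..<d} str"

lemma str_bij: "bij_betw str {0..<d} (Cont n q v)"
  unfolding str_def d_def using someI_ex[OF ex_bij_betw_nat_finite[OF finite_strings]] .

lemma str_Cont: "r < d \<Longrightarrow> str r \<in> Cont n q v"
  using bij_betw_apply[OF str_bij] by simp

lemma idx_less: "a \<in> Cont n q v \<Longrightarrow> idx a < d"
  using bij_betw_apply[OF bij_betw_inv_into[OF str_bij]] by (simp add: idx_def)

lemma str_idx: "a \<in> Cont n q v \<Longrightarrow> str (idx a) = a"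
  unfolding idx_def by (rule bij_betw_inv_into_right[OF str_bij])

lemma idx_str: "r < d \<Longrightarrow> idx (str r) = r"
  unfolding idx_def by (rule bij_betw_inv_into_left[OF str_bij]) simp

lemma idx_eq_iff: "a \<in> Cont n q v \<Longrightarrow> r < d \<Longrightarrow> idx a = r \<longleftrightarrow> a = str r"
  using str_idx idx_str by metis

text \<open>Coordinates are labelled by an arbitrary enumeration of the content strings. Reading a
  vector as a function of strings keeps the enumeration out of the verification of the
  relations.\<close>

definition fun_of :: "'k vec \<Rightarrow> (nat \<Rightarrow> 'k) \<Rightarrow> 'k" where
  "fun_of w a = w $ idx a"

lemma vec_eqI:
  assumes "u \<in> carrier_vec d" "w \<in> carrier_vec d" "\<And>a. a \<in> Cont n q v \<Longrightarrow> fun_of u a = fun_of w a"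
  shows "u = w"
proof (rule eq_vecI)
  fix r assume "r < dim_vec w"
  then have "r < d" using assms by simp
  then show "u $ r = w $ r" using assms(3)[OF str_Cont] by (simp add: fun_of_def idx_str)
qed (use assms in auto)

text \<open>The column \<open>idx (swap_at i (str r))\<close> is meaningless if the exchanged string
  is not a content string, but then the pair is linked and the entry \<open>\<beta>\<close> is
  0.\<close>

definition gen :: "hecke_gen \<Rightarrow> 'k mat" where
  "gen g = (case g of
     Tau \<Rightarrow> mat d d (\<lambda>(r, c). if c = r then str r 1 else 0)
   | Sigma i \<Rightarrow> mat d d (\<lambda>(r, c). (if c = r then \<alpha> (str r i) (str r (Suc i)) else 0) +
       (if c = idx (swap_at i (str r)) then \<beta> (str r i) (str r (Suc i)) else 0)))"

lemma gen_carrier: "gen g \<in> carrier_mat d d"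
  by (simp add: gen_def split: hecke_gen.split)

lemma fun_of_diagonal:
  assumes "w \<in> carrier_vec d" "a \<in> Cont n q v"
  shows "fun_of (mat d d (\<lambda>(r, c). if c = r then f r else 0) *\<^sub>v w) a = f (idx a) * fun_of w a"
proof -
  have r: "idx a < d" using idx_less assms by blast
  have "fun_of (mat d d (\<lambda>(r, c). if c = r then f r else 0) *\<^sub>v w) a
    = (\<Sum>c\<in>{0..<d}. (if c = idx a then f (idx a) else 0) * w $ c)"
    using r assms(1) by (simp add: fun_of_def scalar_prod_def)
  also have "\<dots> = (\<Sum>c\<in>{0..<d}. if c = idx a then f (idx a) * w $ c else 0)"
    by (intro sum.cong) auto
  finally show ?thesis using r by (simp add: fun_of_def)
qed

lemma fun_of_Tau:
  "w \<in> carrier_vec d \<Longrightarrow> a \<in> Cont n q v \<Longrightarrow> fun_of (gen Tau *\<^sub>v w) a = a 1 * fun_of w a"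
  by (simp add: gen_def fun_of_diagonal str_idx)

lemma fun_of_Sigma:
  assumes w: "w \<in> carrier_vec d" and a: "a \<in> Cont n q v" and i: "1 \<le> i" "i < n"
  shows "fun_of (gen (Sigma i) *\<^sub>v w) a = op i (fun_of w) a"
proof -
  let ?\<alpha> = "\<alpha> (a i) (a (Suc i))" and ?\<beta> = "\<beta> (a i) (a (Suc i))"
  have r: "idx a < d" using idx_less a by blast
  have s: "?\<beta> \<noteq> 0 \<Longrightarrow> idx (swap_at i a) < d"
    using Cont_swap_at[OF q a i] by (intro idx_less) (auto simp: \<beta>_def split: if_splits)
  have "fun_of (gen (Sigma i) *\<^sub>v w) a
    = (\<Sum>c\<in>{0..<d}. ((if c = idx a then ?\<alpha> else 0) + (if c = idx (swap_at i a) then ?\<beta> else 0)) * w $ c)"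
    using r w a by (simp add: gen_def fun_of_def scalar_prod_def str_idx cong: if_cong)
  also have "\<dots> = (\<Sum>c\<in>{0..<d}. if c = idx a then ?\<alpha> * w $ c else 0)
      + (\<Sum>c\<in>{0..<d}. if c = idx (swap_at i a) then ?\<beta> * w $ c else 0)"
    unfolding sum.distrib[symmetric] by (intro sum.cong) (auto simp: algebra_simps)
  also have "\<dots> = op i (fun_of w) a"
    using r s by (cases "?\<beta> = 0") (simp_all add: op_def fun_of_def)
  finally show ?thesis .
qed

text \<open>\<open>\<beta>\<close> vanishes whenever the exchange could lead out of
  \<open>Cont\<close>, so only values at content strings enter. This allows several applications of
  \<open>fun_of_act_Sigma\<close> to be chained.\<close>

lemma op_cong:
  assumes a: "a \<in> Cont n q v" and i: "1 \<le> i" "i < n"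
    and "\<And>b. b \<in> Cont n q v \<Longrightarrow> g b = g' b"
  shows "op i g a = op i g' a"
  using Cont_swap_at[OF q a i] assms(4) a unfolding op_def \<beta>_def by auto

lemma fun_of_add: "u \<in> carrier_vec d \<Longrightarrow> w \<in> carrier_vec d \<Longrightarrow> a \<in> Cont n q v \<Longrightarrow>
    fun_of (u + w) a = fun_of u a + fun_of w a"
  and fun_of_smult: "w \<in> carrier_vec d \<Longrightarrow> a \<in> Cont n q v \<Longrightarrow> fun_of (c \<cdot>\<^sub>v w) a = c * fun_of w a"
  using idx_less[of a] by (auto simp: fun_of_def)

lemma mat_eqI:
  assumes M: "M \<in> carrier_mat d d" "N \<in> carrier_mat d d"
    and eq: "\<And>w a. w \<in> carrier_vec d \<Longrightarrow> a \<in> Cont n q v \<Longrightarrow> fun_of (M *\<^sub>v w) a = fun_of (N *\<^sub>v w) a"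
  shows "M = N"
proof (rule eq_matI)
  fix r c assume "r < dim_row N" "c < dim_col N"
  then have rc: "r < d" "c < d" using M by auto
  have "M *\<^sub>v unit_vec d c = N *\<^sub>v unit_vec d c"
    by (rule vec_eqI) (use M eq in \<open>auto intro: mult_mat_vec_carrier\<close>)
  then have "(M *\<^sub>v unit_vec d c) $ r = (N *\<^sub>v unit_vec d c) $ r" by simp
  then show "M $$ (r, c) = N $$ (r, c)" using M rc by (simp add: scalar_prod_right_unit)
qed (use M in auto)

abbreviation act :: "('k, hecke_gen) aterm \<Rightarrow> 'k vec \<Rightarrow> 'k vec" where
  "act t w \<equiv> mat_eval d gen t *\<^sub>v w"

lemma eval_carrier: "mat_eval d gen t \<in> carrier_mat d d"
  by (rule mat_eval_carrier[of UNIV]) (auto simp: gen_carrier aterms_def)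

lemma act_carrier: "w \<in> carrier_vec d \<Longrightarrow> act t w \<in> carrier_vec d"
  using eval_carrier by (rule mult_mat_vec_carrier)

lemma
  assumes "w \<in> carrier_vec d"
  shows act_Times: "act (x \<^bold>* y) w = act x (act y w)"
    and act_Plus: "act (x \<^bold>+ y) w = act x w + act y w"
    and act_Scalar: "act (Scalar c) w = c \<cdot>\<^sub>v w"
proof -
  show "act (x \<^bold>* y) w = act x (act y w)"
    using assms eval_carrier by (simp add: assoc_mult_mat_vec[of _ d d _ d])
  show "act (x \<^bold>+ y) w = act x w + act y w"
    using assms eval_carrier by (simp add: add_mult_distrib_mat_vec[of _ d d])
  show "act (Scalar c) w = c \<cdot>\<^sub>v w"
    using assms by (intro eq_vecI) auto
qed

lemma fun_of_act_Sigma: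
  assumes "u \<in> carrier_vec d" "1 \<le> i" "i < n" "a \<in> Cont n q v"
    and "\<And>b. b \<in> Cont n q v \<Longrightarrow> fun_of u b = g b"
  shows "fun_of (act (\<sigma>\<^sub>t i) u) a = op i g a"
  using fun_of_Sigma[OF assms(1,4,2,3)] op_cong[OF assms(4,2,3), of "fun_of u" g] assms(5) by simp

lemma fun_of_act_Tau:
  assumes "u \<in> carrier_vec d" "a \<in> Cont n q v" "fun_of u a = x"
  shows "fun_of (act \<tau>\<^sub>t u) a = a 1 * x"
  using fun_of_Tau[OF assms(1,2)] assms(3) by simp

lemma fun_of_jucys_murphy_term:
  assumes "1 \<le> i" "i \<le> n" "w \<in> carrier_vec d" "a \<in> Cont n q v"
  shows "fun_of (act (jucys_murphy_term i) w) a = a i * fun_of w a"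
  using assms
proof (induction i arbitrary: w a rule: nat_induct_at_least)
  case base
  then show ?case using fun_of_Tau by simp
next
  case (Suc i)
  obtain i0 where i0: "i = Suc i0" using Suc.hyps by (cases i) auto
  have i: "1 \<le> i" "i < n" using Suc.hyps Suc.prems by auto
  note w = Suc.prems(2)
  have neq: "a i \<noteq> a (Suc i)" by (rule Cont_adjacent_neq[OF q Suc.prems(3) i])
  have "fun_of (act (jucys_murphy_term (Suc i)) w) a
    = fun_of (act (\<sigma>\<^sub>t i) (act (jucys_murphy_term i) (act (\<sigma>\<^sub>t i) w))) a"
    unfolding i0 jucys_murphy_term.simps using w by (simp only: act_Times act_carrier)
  also have "\<dots> = op i (\<lambda>b. b i * op i (fun_of w) b) a"
  proof (rule fun_of_act_Sigma[OF _ i Suc.prems(3)])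
    show "act (jucys_murphy_term i) (act (\<sigma>\<^sub>t i) w) \<in> carrier_vec d"
      using act_carrier w by blast
    fix b assume b: "b \<in> Cont n q v"
    show "fun_of (act (jucys_murphy_term i) (act (\<sigma>\<^sub>t i) w)) b = b i * op i (fun_of w) b"
      using Suc.IH[OF _ act_carrier[OF w] b, of "\<sigma>\<^sub>t i"] fun_of_act_Sigma[OF w i b, of "fun_of w"] i by simp
  qed
  also have "\<dots> = a (Suc i) * fun_of w a" by (rule op_conjugate[OF neq])
  finally show ?case .
qed

section \<open>Verification of the defining relations\<close>

lemma act_eqI:
  assumes "\<And>w a. w \<in> carrier_vec d \<Longrightarrow> a \<in> Cont n q v \<Longrightarrow> fun_of (act t w) a = fun_of (act u w) a"
  shows "mat_eval d gen t = mat_eval d gen u"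
  using assms by (intro mat_eqI eval_carrier)

lemma cyclotomic_relation: "mat_eval d gen (cyclotomic_term v) = mat_eval d gen (Scalar 0)"
proof (rule eq_matI)
  fix r c assume "r < dim_row (mat_eval d gen (Scalar 0))" "c < dim_col (mat_eval d gen (Scalar 0))"
  then have rc: "r < d" "c < d" by simp_all
  have T: "gen Tau *\<^sub>v unit_vec d c = str c 1 \<cdot>\<^sub>v unit_vec d c"
  proof (rule vec_eqI)
    fix a assume a: "a \<in> Cont n q v"
    have "fun_of (unit_vec d c) a = (if a = str c then 1 else 0)"
      using idx_less[OF a] idx_eq_iff[OF a rc(2)] rc by (auto simp: fun_of_def)
    then show "fun_of (gen Tau *\<^sub>v unit_vec d c) a = fun_of (str c 1 \<cdot>\<^sub>v unit_vec d c) a"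
      using fun_of_Tau[OF _ a, of "unit_vec d c"] fun_of_smult[OF _ a, of "unit_vec d c"] by auto
  qed (auto intro: mult_mat_vec_carrier gen_carrier)
  have "str c 1 \<in> range v" using str_Cont[OF rc(2)] by (simp add: Cont_def)
  then have prod: "(\<Prod>k\<in>UNIV. str c 1 - v k) = 0" by auto
  have "act (cyclotomic_term v) (unit_vec d c) = (\<Prod>k\<in>UNIV. str c 1 - v k) \<cdot>\<^sub>v unit_vec d c"
    by (rule mat_eval_cyclotomic_term[of gen d "unit_vec d c" "str c 1" v, OF gen_carrier _ T]) simp
  then have "act (cyclotomic_term v) (unit_vec d c) $ r = 0" unfolding prod using rc by simp
  then show "mat_eval d gen (cyclotomic_term v) $$ (r, c) = mat_eval d gen (Scalar 0) $$ (r, c)"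
    using rc carrier_matD[OF eval_carrier] by (simp add: scalar_prod_right_unit)
qed (use carrier_matD[OF eval_carrier] in auto)

lemma hecke_relations:
  assumes "(t, u) \<in> hecke_rels n q v"
  shows "mat_eval d gen t = mat_eval d gen u"
proof -
  note carr = act_carrier and times = act_Times
  note Sig = fun_of_act_Sigma
  consider
      (braid) i where "1 \<le> i" "i + 1 < n" "t = \<sigma>\<^sub>t i \<^bold>* \<sigma>\<^sub>t (Suc i) \<^bold>* \<sigma>\<^sub>t i" "u = \<sigma>\<^sub>t (Suc i) \<^bold>* \<sigma>\<^sub>t i \<^bold>* \<sigma>\<^sub>t (Suc i)"
    | (commute) i j where "i \<in> {1..<n}" "j \<in> {1..<n}" "\<bar>int i - int j\<bar> > 1"
        "t = \<sigma>\<^sub>t i \<^bold>* \<sigma>\<^sub>t j" "u = \<sigma>\<^sub>t j \<^bold>* \<sigma>\<^sub>t i"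
    | (four) "1 < n" "t = \<tau>\<^sub>t \<^bold>* \<sigma>\<^sub>t 1 \<^bold>* \<tau>\<^sub>t \<^bold>* \<sigma>\<^sub>t 1" "u = \<sigma>\<^sub>t 1 \<^bold>* \<tau>\<^sub>t \<^bold>* \<sigma>\<^sub>t 1 \<^bold>* \<tau>\<^sub>t"
    | (tau) i where "1 < i" "i < n" "t = \<tau>\<^sub>t \<^bold>* \<sigma>\<^sub>t i" "u = \<sigma>\<^sub>t i \<^bold>* \<tau>\<^sub>t"
    | (quadratic) i where "i \<in> {1..<n}" "t = \<sigma>\<^sub>t i \<^bold>* \<sigma>\<^sub>t i" "u = Scalar (q - inverse q) \<^bold>* \<sigma>\<^sub>t i \<^bold>+ Scalar 1"
    | (cyclotomic) "t = cyclotomic_term v" "u = Scalar 0"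
    using assms unfolding hecke_rels_def by (auto simp del: Suc_eq_plus1 simp add: Suc_eq_plus1[symmetric])
  then show ?thesis
  proof cases
    case braid
    have i: "1 \<le> i" "i < n" "1 \<le> Suc i" "Suc i < n" using braid by auto
    show ?thesis
      unfolding braid(3,4)
    proof (rule act_eqI)
      fix w :: "'k vec" and a assume w: "w \<in> carrier_vec d" and a: "a \<in> Cont n q v"
      have "fun_of (act (\<sigma>\<^sub>t i) (act (\<sigma>\<^sub>t (Suc i)) (act (\<sigma>\<^sub>t i) w))) a = op i (op (Suc i) (op i (fun_of w))) a"
        by (intro Sig carr w a i HOL.refl)
      moreover have "fun_of (act (\<sigma>\<^sub>t (Suc i)) (act (\<sigma>\<^sub>t i) (act (\<sigma>\<^sub>t (Suc i)) w))) a
          = op (Suc i) (op i (op (Suc i) (fun_of w))) a"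
        by (intro Sig carr w a i HOL.refl)
      ultimately show "fun_of (act (\<sigma>\<^sub>t i \<^bold>* \<sigma>\<^sub>t (Suc i) \<^bold>* \<sigma>\<^sub>t i) w) a
          = fun_of (act (\<sigma>\<^sub>t (Suc i) \<^bold>* \<sigma>\<^sub>t i \<^bold>* \<sigma>\<^sub>t (Suc i)) w) a"
        using op_braid[OF Cont_adjacent_neq[OF q a i(1,2)] Cont_adjacent_neq[OF q a i(3,4)]
            Cont_triple_distinct[OF a i(1,4)], of "fun_of w"]
        by (simp only: times carr w)
    qed
  next
    case commute
    have i: "1 \<le> i" "i < n" "1 \<le> j" "j < n" using commute by auto
    show ?thesis
      unfolding commute(4,5)
    proof (rule act_eqI)
      fix w :: "'k vec" and a assume w: "w \<in> carrier_vec d" and a: "a \<in> Cont n q v"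
      have "fun_of (act (\<sigma>\<^sub>t i) (act (\<sigma>\<^sub>t j) w)) a = op i (op j (fun_of w)) a"
        by (intro Sig carr w a i HOL.refl)
      moreover have "fun_of (act (\<sigma>\<^sub>t j) (act (\<sigma>\<^sub>t i) w)) a = op j (op i (fun_of w)) a"
        by (intro Sig carr w a i HOL.refl)
      moreover have "Suc i < j \<or> Suc j < i" using commute by auto
      ultimately show "fun_of (act (\<sigma>\<^sub>t i \<^bold>* \<sigma>\<^sub>t j) w) a = fun_of (act (\<sigma>\<^sub>t j \<^bold>* \<sigma>\<^sub>t i) w) a"
        using op_commute[of i j "fun_of w" a] op_commute[of j i "fun_of w" a]
        by (auto simp only: times carr w)
    qed
  next
    case four
    have i: "1 \<le> (1::nat)" "1 < n" using four by auto
    \<comment> \<open>The product \<sigma>_1 \<tau> \<sigma>_1 is the second Jucys-Murphy element,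
      which acts diagonally. The four-term relation then says that two diagonal operators
      commute.\<close>
    have J2: "fun_of (act (\<sigma>\<^sub>t 1) (act \<tau>\<^sub>t (act (\<sigma>\<^sub>t 1) w))) a = a 2 * fun_of w a"
      if w: "w \<in> carrier_vec d" and a: "a \<in> Cont n q v" for w a
      using fun_of_jucys_murphy_term[of 2 w a] w a four(1)
      by (simp add: numeral_2_eq_2 times carr del: mat_eval.simps)
    show ?thesis
      unfolding four(2,3)
    proof (rule act_eqI)
      fix w :: "'k vec" and a assume w: "w \<in> carrier_vec d" and a: "a \<in> Cont n q v"
      have "fun_of (act \<tau>\<^sub>t (act (\<sigma>\<^sub>t 1) (act \<tau>\<^sub>t (act (\<sigma>\<^sub>t 1) w)))) a = a 1 * (a 2 * fun_of w a)"
        by (intro fun_of_act_Tau carr w a J2)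
      moreover have "fun_of (act (\<sigma>\<^sub>t 1) (act \<tau>\<^sub>t (act (\<sigma>\<^sub>t 1) (act \<tau>\<^sub>t w)))) a = a 2 * (a 1 * fun_of w a)"
        using J2[OF carr[OF w] a, of \<tau>\<^sub>t] fun_of_act_Tau[OF w a HOL.refl] by simp
      ultimately show "fun_of (act (\<tau>\<^sub>t \<^bold>* \<sigma>\<^sub>t 1 \<^bold>* \<tau>\<^sub>t \<^bold>* \<sigma>\<^sub>t 1) w) a
          = fun_of (act (\<sigma>\<^sub>t 1 \<^bold>* \<tau>\<^sub>t \<^bold>* \<sigma>\<^sub>t 1 \<^bold>* \<tau>\<^sub>t) w) a"
        by (simp only: times carr w mult.left_commute)
    qed
  next
    case tau
    have i: "1 \<le> i" "i < n" using tau by auto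
    show ?thesis
      unfolding tau(3,4)
    proof (rule act_eqI)
      fix w :: "'k vec" and a assume w: "w \<in> carrier_vec d" and a: "a \<in> Cont n q v"
      have "fun_of (act \<tau>\<^sub>t (act (\<sigma>\<^sub>t i) w)) a = a 1 * op i (fun_of w) a"
        by (intro fun_of_act_Tau Sig carr w a i HOL.refl)
      moreover have "fun_of (act (\<sigma>\<^sub>t i) (act \<tau>\<^sub>t w)) a = op i (\<lambda>b. b 1 * fun_of w b) a"
        by (intro fun_of_act_Tau Sig carr w a i HOL.refl)
      moreover have "op i (\<lambda>b. b 1 * fun_of w b) a = a 1 * op i (fun_of w) a"
        using tau(1) by (simp add: op_def swap_at_apply algebra_simps)
      ultimately show "fun_of (act (\<tau>\<^sub>t \<^bold>* \<sigma>\<^sub>t i) w) a = fun_of (act (\<sigma>\<^sub>t i \<^bold>* \<tau>\<^sub>t) w) a"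
        by (simp only: times carr w)
    qed
  next
    case quadratic
    have i: "1 \<le> i" "i < n" using quadratic by auto
    show ?thesis
      unfolding quadratic(2,3)
    proof (rule act_eqI)
      fix w :: "'k vec" and a assume w: "w \<in> carrier_vec d" and a: "a \<in> Cont n q v"
      have "fun_of (act (\<sigma>\<^sub>t i) (act (\<sigma>\<^sub>t i) w)) a = op i (op i (fun_of w)) a"
        by (intro Sig carr w a i HOL.refl)
      moreover have "fun_of (act (\<sigma>\<^sub>t i) w) a = op i (fun_of w) a"
        by (intro Sig carr w a i HOL.refl)
      ultimately show "fun_of (act (\<sigma>\<^sub>t i \<^bold>* \<sigma>\<^sub>t i) w) a
          = fun_of (act (Scalar (q - inverse q) \<^bold>* \<sigma>\<^sub>t i \<^bold>+ Scalar 1) w) a"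
        using op_quadratic[OF Cont_adjacent_neq[OF q a i], of "fun_of w"] w a carr[OF w, of "\<sigma>\<^sub>t i"]
        by (simp add: times act_Plus act_Scalar fun_of_add fun_of_smult del: mat_eval.simps)
    qed
  next
    case cyclotomic
    then show ?thesis using cyclotomic_relation by simp
  qed
qed

definition \<rho> :: "'k hecke_elem \<Rightarrow> 'k mat" where
  "\<rho> = rep_of d gen"

lemma rho_class: "t \<in> aterms (hecke_gens n) \<Longrightarrow>
    \<rho> (alg_cong (hecke_gens n) (hecke_rels n q v) `` {t}) = mat_eval d gen t"
  unfolding \<rho>_def by (rule rep_of_class) (auto intro: gen_carrier hecke_relations)

lemma rho_representation: "representation (hecke_algebra n q v) d \<rho>"
  unfolding \<rho>_def hecke_algebra_def
  by (rule representation_rep_of) (auto intro: gen_carrier hecke_relations)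

lemma rho_jucys_murphy: "i \<le> n \<Longrightarrow> \<rho> (jucys_murphy n q v i) = mat_eval d gen (jucys_murphy_term i)"
  by (simp add: jucys_murphy_class rho_class jucys_murphy_term_closed)

lemma rho_sigma: "i \<in> {1..<n} \<Longrightarrow> \<rho> (hecke_sigma n q v i) = mat_eval d gen (\<sigma>\<^sub>t i)"
  unfolding hecke_sigma_def by (rule rho_class) (simp add: hecke_gens_def)

lemma jucys_murphy_matrix:
  assumes "1 \<le> i" "i \<le> n"
  shows "mat_eval d gen (jucys_murphy_term i) = mat d d (\<lambda>(r, c). if c = r then str r i else 0)"
  by (rule mat_eqI) (use assms in \<open>auto simp: eval_carrier fun_of_jucys_murphy_term fun_of_diagonal str_idx\<close>)

lemma rho_jucys_murphy_diagonalizable: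
  assumes "1 \<le> i" "i \<le> n"
  shows "diagonalizable (\<rho> (jucys_murphy n q v i))"
proof -
  let ?D = "mat d d (\<lambda>(r, c). if c = r then str r i else 0)"
  have "diagonal_mat ?D" by (auto simp: diagonal_mat_def)
  moreover have "similar_mat ?D ?D" by (rule similar_mat_refl[of _ d]) simp
  ultimately show ?thesis
    using assms by (auto simp: diagonalizable_def rho_jucys_murphy jucys_murphy_matrix)
qed

section \<open>Diagonalizability aside: blocks of the local subalgebras and complete
  reducibility\<close>

abbreviation local_generators :: "nat \<Rightarrow> 'k hecke_elem set" where
  "local_generators i \<equiv> {jucys_murphy n q v i, jucys_murphy n q v (Suc i), hecke_sigma n q v i}"

text \<open>An involution whose orbits are the blocks of coordinates mixed by the i-th generator. On
  a linked pair \<open>\<beta>\<close> is 0, so the coordinate forms a block of its own.\<close>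

definition partner :: "nat \<Rightarrow> nat \<Rightarrow> nat" where
  "partner i r = (if linked q (str r i) (str r (Suc i)) then r else idx (swap_at i (str r)))"

definition supported :: "nat set \<Rightarrow> 'k vec set" where
  "supported R = {w \<in> carrier_vec d. \<forall>r<d. r \<notin> R \<longrightarrow> w $ r = 0}"

context
  fixes i :: nat
  assumes i: "1 \<le> i" "i < n"
begin

lemma str_partner:
  assumes "r < d" "\<not> linked q (str r i) (str r (Suc i))"
  shows "str (partner i r) = swap_at i (str r)"
  using Cont_swap_at[OF q str_Cont[OF assms(1)] i assms(2)] assms(2) by (simp add: partner_def str_idx)

lemma partner_less: "r < d \<Longrightarrow> partner i r < d"
  using Cont_swap_at[OF q str_Cont i] by (simp add: partner_def idx_less)

lemma partner_partner:
  assumes "r < d"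
  shows "partner i (partner i r) = r"
proof (cases "linked q (str r i) (str r (Suc i))")
  case True
  then show ?thesis by (simp add: partner_def)
next
  case False
  note sp = str_partner[OF assms False]
  have "\<not> linked q (str (partner i r) i) (str (partner i r) (Suc i))"
    using False linked_sym[of q "str r i"] by (simp add: sp swap_at_apply)
  then have "partner i (partner i r) = idx (swap_at i (swap_at i (str r)))"
    unfolding partner_def[of i "partner i r"] sp by simp
  then show ?thesis using idx_str[OF assms] by simp
qed

lemma str_neq: "r < d \<Longrightarrow> str r i \<noteq> str r (Suc i)"
  using Cont_adjacent_neq[OF q str_Cont i] .

lemma sigma_index:
  assumes w: "w \<in> carrier_vec d" and r: "r < d"
  shows "(\<rho> (hecke_sigma n q v i) *\<^sub>v w) $ r
    = \<alpha> (str r i) (str r (Suc i)) * w $ r + \<beta> (str r i) (str r (Suc i)) * w $ partner i r"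
proof -
  have "fun_of (gen (Sigma i) *\<^sub>v w) (str r) = op i (fun_of w) (str r)"
    by (rule fun_of_Sigma[OF w str_Cont[OF r] i])
  then show ?thesis
    using i r by (auto simp: rho_sigma fun_of_def idx_str op_def partner_def \<beta>_def simp del: index_mult_mat_vec)
qed

lemma jucys_murphy_index:
  assumes l: "1 \<le> l" "l \<le> n" and w: "w \<in> carrier_vec d" and r: "r < d"
  shows "(\<rho> (jucys_murphy n q v l) *\<^sub>v w) $ r = str r l * w $ r"
proof -
  have "fun_of (act (jucys_murphy_term l) w) (str r) = str r l * fun_of w (str r)"
    by (rule fun_of_jucys_murphy_term[OF l w str_Cont[OF r]])
  then show ?thesis
    using l r by (simp add: rho_jucys_murphy fun_of_def idx_str del: index_mult_mat_vec)
qed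

lemma local_carrier: "X \<in> \<rho> ` local_generators i \<Longrightarrow> X \<in> carrier_mat d d"
  using i eval_carrier by (auto simp: rho_jucys_murphy rho_sigma simp del: jucys_murphy.simps mat_eval.simps)

lemma supported_invariant:
  assumes R: "\<And>r. r \<in> R \<Longrightarrow> partner i r \<in> R"
  shows "invariant_subspace d (\<rho> ` local_generators i) (supported R)"
  unfolding invariant_subspace_iff
proof (intro conjI ballI allI)
  fix X w assume X: "X \<in> \<rho> ` local_generators i" and w: "w \<in> supported R"
  have wc: "w \<in> carrier_vec d" and w0: "\<And>r. r < d \<Longrightarrow> r \<notin> R \<Longrightarrow> w $ r = 0"
    using w by (auto simp: supported_def)
  have "(X *\<^sub>v w) $ r = 0" if r: "r < d" "r \<notin> R" for r
  proof -
    have "partner i r \<notin> R" using R partner_partner[OF r(1)] r(2) by metis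
    then have "w $ partner i r = 0" using w0 partner_less[OF r(1)] by blast
    moreover have "w $ r = 0" using w0 r by blast
    ultimately show ?thesis
      using X sigma_index[OF wc r(1)] jucys_murphy_index[OF _ _ wc r(1), of i]
        jucys_murphy_index[OF _ _ wc r(1), of "Suc i"] i
      by (auto simp del: index_mult_mat_vec jucys_murphy.simps)
  qed
  moreover have "X *\<^sub>v w \<in> carrier_vec d" using local_carrier[OF X] wc by (rule mult_mat_vec_carrier)
  ultimately show "X *\<^sub>v w \<in> supported R" by (auto simp: supported_def)
qed (auto simp: supported_def)

text \<open>Blocks are irreducible. If u has a nonzero coordinate at r, then J_i - y removes the
  partner coordinate, because the partner string has y at position i. Otherwise \<sigma>_i carries
  the partner coordinate to r with the factor \<open>\<beta>\<close>, which is nonzero on unlinked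
  pairs.\<close>

lemma block_generated:
  assumes U: "invariant_subspace d (\<rho> ` local_generators i) U" and u: "u \<in> U" "u \<noteq> 0\<^sub>v d"
    and r: "r < d" and supp: "u \<in> supported {r, partner i r}"
  shows "unit_vec d r \<in> U"
proof -
  note U' = U[unfolded invariant_subspace_iff]
  have add: "x + y \<in> U" if "x \<in> U" "y \<in> U" for x y using U' that by blast
  have smult: "c \<cdot>\<^sub>v x \<in> U" if "x \<in> U" for c x using U' that by blast
  have inv: "\<rho> Y *\<^sub>v x \<in> U" if "Y \<in> local_generators i" "x \<in> U" for x Y using U' that by blast
  have uc: "u \<in> carrier_vec d" and u0: "\<And>t. t < d \<Longrightarrow> t \<noteq> r \<Longrightarrow> t \<noteq> partner i r \<Longrightarrow> u $ t = 0"
    using supp by (auto simp: supported_def)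
  let ?p = "partner i r" and ?x = "str r i" and ?y = "str r (Suc i)"
  have p: "?p < d" by (rule partner_less[OF r])
  have xy: "?x \<noteq> ?y" by (rule str_neq[OF r])
  have unit: "unit_vec d r \<in> U" if "z \<in> U" "z $ r \<noteq> 0" "\<And>t. t < d \<Longrightarrow> t \<noteq> r \<Longrightarrow> z $ t = 0" for z
  proof -
    have zc: "z \<in> carrier_vec d" using U' that(1) by blast
    have "inverse (z $ r) \<cdot>\<^sub>v z = unit_vec d r"
      by (rule eq_vecI) (use zc that(2,3) r in auto)
    then show ?thesis using smult[OF that(1)] by metis
  qed
  show ?thesis
  proof (cases "?p = r")
    case True
    have "u $ r \<noteq> 0"
    proof
      assume "u $ r = 0"
      then have "u = 0\<^sub>v d" using uc u0 True by (intro eq_vecI) auto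
      with u(2) show False ..
    qed
    then show ?thesis using unit[OF u(1)] u0 True by metis
  next
    case False
    then have unl: "\<not> linked q ?x ?y" by (auto simp: partner_def)
    have sp: "str ?p i = ?y" "str ?p (Suc i) = ?x"
      using str_partner[OF r unl] by (simp_all add: swap_at_apply)
    show ?thesis
    proof (cases "u $ r = 0")
      case False
      let ?z = "\<rho> (jucys_murphy n q v i) *\<^sub>v u + (- ?y) \<cdot>\<^sub>v u"
      have zt: "?z $ t = (str t i - ?y) * u $ t" if "t < d" for t
        using jucys_murphy_index[OF _ _ uc that, of i] i uc that
        by (simp add: algebra_simps del: index_mult_mat_vec jucys_murphy.simps)
      show ?thesis
      proof (rule unit)
        show "?z \<in> U" by (intro add inv smult u(1)) simp
        show "?z $ r \<noteq> 0" using zt[OF r] xy False by simp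
        show "?z $ t = 0" if "t < d" "t \<noteq> r" for t
          using zt[OF that(1)] u0[OF that] sp by (cases "t = ?p") auto
      qed
    next
      case True
      have "u $ ?p \<noteq> 0"
      proof
        assume "u $ ?p = 0"
        then have "u $ t = 0" if "t < d" for t using u0[OF that] True by metis
        then have "u = 0\<^sub>v d" using uc by (intro eq_vecI) auto
        with u(2) show False ..
      qed
      \<comment> \<open>\<open>\<alpha> ?y ?x\<close> is the diagonal coefficient of the generator
        at the partner coordinate, so its subtraction leaves the coordinate r only.\<close>
      let ?z = "\<rho> (hecke_sigma n q v i) *\<^sub>v u + (- \<alpha> ?y ?x) \<cdot>\<^sub>v u"
      have zt: "?z $ t = (\<alpha> (str t i) (str t (Suc i)) - \<alpha> ?y ?x) * u $ t
          + \<beta> (str t i) (str t (Suc i)) * u $ partner i t" if "t < d" for t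
        using sigma_index[OF uc that] uc that
        by (simp add: algebra_simps del: index_mult_mat_vec)
      show ?thesis
      proof (rule unit)
        show "?z \<in> U" by (intro add inv smult u(1)) simp
        show "?z $ r \<noteq> 0" using zt[OF r] True \<open>u $ ?p \<noteq> 0\<close> \<beta>_neq_0[OF unl xy] by simp
        show "?z $ t = 0" if t: "t < d" "t \<noteq> r" for t
        proof (cases "t = ?p")
          case True
          then show ?thesis
            using zt[OF t(1)] sp partner_partner[OF r] \<open>u $ r = 0\<close> by simp
        next
          case False
          have "partner i t \<noteq> ?p" "partner i t \<noteq> r"
            using partner_partner[OF r] partner_partner[OF t(1)] False t(2) by metis+
          then show ?thesis
            using zt[OF t(1)] u0[OF t False] u0[OF partner_less[OF t(1)]] by simp
        qed
      qed
    qed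
  qed
qed

lemma unit_vecs_generate:
  fixes U :: "'k vec set"
  assumes U: "invariant_subspace d \<A> U" and unit: "\<And>r. r < d \<Longrightarrow> unit_vec d r \<in> U"
  shows "carrier_vec d \<subseteq> U"
proof
  note U' = U[unfolded invariant_subspace_iff]
  fix w :: "'k vec" assume w: "w \<in> carrier_vec d"
  have "vec d (\<lambda>r. if r < k then w $ r else 0) \<in> U" if "k \<le> d" for k
    using that
  proof (induction k)
    case 0
    have "vec d (\<lambda>r. if r < 0 then w $ r else 0) = 0\<^sub>v d" by (rule eq_vecI) auto
    then show ?case using U' by metis
  next
    case (Suc k)
    have "vec d (\<lambda>r. if r < Suc k then w $ r else 0)
      = vec d (\<lambda>r. if r < k then w $ r else 0) + w $ k \<cdot>\<^sub>v unit_vec d k"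
      by (rule eq_vecI) (use Suc.prems in \<open>auto simp: less_Suc_eq\<close>)
    moreover have "w $ k \<cdot>\<^sub>v unit_vec d k \<in> U" using U' unit[of k] Suc.prems by simp
    ultimately show ?case using U' Suc by simp
  qed
  from this[of d] have "vec d (\<lambda>r. if r < d then w $ r else 0) \<in> U" by simp
  moreover have "vec d (\<lambda>r. if r < d then w $ r else 0) = w" by (rule eq_vecI) (use w in auto)
  ultimately show "w \<in> U" by simp
qed

text \<open>The complement of an invariant subspace \<open>W\<close> is spanned by a maximal set of blocks
  \<open>{r, partner i r}\<close> that meets \<open>W\<close> trivially.\<close>

lemma rho_completely_reducible:
  "completely_reducible d (\<rho> ` subalgebra_generated (hecke_algebra n q v) (local_generators i))"
  unfolding completely_reducible_def
proof (intro allI impI)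
  let ?A = "\<rho> ` subalgebra_generated (hecke_algebra n q v) (local_generators i)"
  let ?B = "\<rho> ` local_generators i"
  interpret H: hecke_representation n q v d \<rho>
    by (rule hecke_representation.intro) (rule rho_representation)
  fix W assume WA: "invariant_subspace d ?A W"
  have "?B \<subseteq> ?A" by (rule image_mono) (blast intro: subalgebra_generated.incl)
  then have W: "invariant_subspace d ?B W"
    using WA unfolding invariant_subspace_def by blast
  note W' = W[unfolded invariant_subspace_iff]
  define F where "F = {R. R \<subseteq> {..<d} \<and> (\<forall>r\<in>R. partner i r \<in> R) \<and> W \<inter> supported R \<subseteq> {0\<^sub>v d}}"
  have "supported {} \<subseteq> {0\<^sub>v d}" by (auto simp: supported_def intro!: eq_vecI)
  then have "{} \<in> F" by (auto simp: F_def)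
  moreover have "finite F" by (rule finite_subset[of _ "Pow {..<d}"]) (auto simp: F_def)
  ultimately obtain R where R: "R \<in> F" and max: "\<And>R'. R' \<in> F \<Longrightarrow> R \<subseteq> R' \<Longrightarrow> R' = R"
    using finite_has_maximal[of F] by blast
  have Rd: "R \<subseteq> {..<d}" and closed: "\<And>r. r \<in> R \<Longrightarrow> partner i r \<in> R"
    and triv: "W \<inter> supported R \<subseteq> {0\<^sub>v d}" using R by (auto simp: F_def)
  have S: "invariant_subspace d ?B (supported R)" by (rule supported_invariant[OF closed])
  note S' = S[unfolded invariant_subspace_iff]
  define U where "U = {w + w' | w w'. w \<in> W \<and> w' \<in> supported R}"
  have U: "invariant_subspace d ?B U"
    unfolding invariant_subspace_iff
  proof (intro conjI ballI allI)
    have carr: "w \<in> carrier_vec d" if "w \<in> W \<or> w \<in> supported R" for w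
      using that W' S' by blast
    show "U \<subseteq> carrier_vec d" using carr by (auto simp: U_def)
    have "0\<^sub>v d = 0\<^sub>v d + (0\<^sub>v d :: 'k vec)" by (intro eq_vecI) auto
    then show "0\<^sub>v d \<in> U" unfolding U_def using W' S' by blast
    fix x assume "x \<in> U"
    then obtain w w' where x: "x = w + w'" "w \<in> W" "w' \<in> supported R" unfolding U_def by blast
    have xc: "w \<in> carrier_vec d" "w' \<in> carrier_vec d" using x carr by auto
    show "c \<cdot>\<^sub>v x \<in> U" for c
    proof -
      have "c \<cdot>\<^sub>v x = c \<cdot>\<^sub>v w + c \<cdot>\<^sub>v w'" using xc x(1) by (simp add: smult_add_distrib_vec[of _ d])
      then show ?thesis unfolding U_def using W' S' x by blast
    qed
    show "X *\<^sub>v x \<in> U" if X: "X \<in> ?B" for X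
    proof -
      have "X *\<^sub>v x = X *\<^sub>v w + X *\<^sub>v w'"
        using local_carrier[OF X] xc x(1) by (simp add: mult_add_distrib_mat_vec[of _ d d])
      moreover have "X *\<^sub>v w \<in> W" "X *\<^sub>v w' \<in> supported R" using W' S' x X by blast+
      ultimately show ?thesis unfolding U_def by blast
    qed
    fix y assume "y \<in> U"
    then obtain u u' where y: "y = u + u'" "u \<in> W" "u' \<in> supported R" unfolding U_def by blast
    have yc: "u \<in> carrier_vec d" "u' \<in> carrier_vec d" using y carr by auto
    have "x + y = (w + u) + (w' + u')"
      unfolding x(1) y(1) by (rule eq_vecI) (use xc yc in auto)
    moreover have "w + u \<in> W" "w' + u' \<in> supported R" using W' S' x y by blast+
    ultimately show "x + y \<in> U" unfolding U_def by blast
  qed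
  have WU: "w \<in> U" if "w \<in> W" for w
  proof -
    have "w = w + 0\<^sub>v d" using W' that by (intro eq_vecI) auto
    then show ?thesis unfolding U_def using S' that by blast
  qed
  have SU: "w \<in> U" if "w \<in> supported R" for w
  proof -
    have "w = 0\<^sub>v d + w" using S' that by (intro eq_vecI) auto
    then show ?thesis unfolding U_def using W' that by blast
  qed
  have "unit_vec d r \<in> U" if r: "r < d" for r
  proof (cases "r \<in> R")
    case True
    then have "unit_vec d r \<in> supported R" using r by (auto simp: supported_def)
    then show ?thesis by (rule SU)
  next
    case False
    let ?R = "R \<union> {r, partner i r}"
    have "?R \<noteq> R" using False by blast
    then have "?R \<notin> F" using max by blast
    moreover have "?R \<subseteq> {..<d}" using Rd r partner_less[OF r] by simp
    moreover have "\<forall>t\<in>?R. partner i t \<in> ?R" using closed partner_partner[OF r] by auto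
    ultimately obtain w where w: "w \<in> W" "w \<in> supported ?R" "w \<noteq> 0\<^sub>v d"
      unfolding F_def by blast
    have wc: "w \<in> carrier_vec d" using W' w by blast
    \<comment> \<open>By maximality of \<open>R\<close> the enlarged support meets \<open>W\<close>
      in some w \<noteq> 0. Clearing the coordinates in \<open>R\<close> stays inside
      \<open>U\<close> and leaves a vector of the block of r; it is nonzero since otherwise w would
      lie in \<open>W\<close> and in \<open>supported R\<close>.\<close>
    let ?s = "vec d (\<lambda>t. if t \<in> R then - (w $ t) else 0)"
    have s: "?s \<in> supported R" by (auto simp: supported_def)
    have "w + ?s \<in> U" unfolding U_def using w(1) s by blast
    moreover have "w + ?s \<in> supported {r, partner i r}"
      using w(2) wc by (auto simp: supported_def)
    moreover have "w + ?s \<noteq> 0\<^sub>v d"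
    proof
      assume eq: "w + ?s = 0\<^sub>v d"
      have "w $ t = 0" if "t < d" "t \<notin> R" for t
        using arg_cong[OF eq, of "\<lambda>x. x $ t"] that wc by simp
      then have "w \<in> supported R" using wc by (simp add: supported_def)
      then show False using triv w by blast
    qed
    ultimately show ?thesis using block_generated[OF U _ _ r] by blast
  qed
  then have "carrier_vec d \<subseteq> U" by (rule unit_vecs_generate[OF U])
  moreover have "U \<subseteq> carrier_vec d" using U unfolding invariant_subspace_iff by blast
  ultimately have "U = carrier_vec d" by blast
  moreover have "invariant_subspace d ?A (supported R)"
    using H.subalgebra_invariant[OF H.local_generators_closed S] i by simp
  moreover have "W \<inter> supported R = {0\<^sub>v d}" using triv W' S' by blast
  ultimately show "\<exists>W'. invariant_subspace d ?A W' \<and> W \<inter> W' = {0\<^sub>v d} \<and>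
      {w + w' | w w'. w \<in> W \<and> w' \<in> W'} = carrier_vec d"
    unfolding U_def by blast
qed

end

lemma rho_C_representation: "C_representation n q v d \<rho>"
  using rho_representation rho_jucys_murphy_diagonalizable rho_completely_reducible
  by (simp add: C_representation_def del: jucys_murphy.simps)

theorem Spec_eq_Cont: "Spec n q v = Cont n q v"
proof
  show "Spec n q v \<subseteq> Cont n q v" by (rule Spec_subset_Cont[OF n q v q2 q4])
  show "Cont n q v \<subseteq> Spec n q v"
  proof
    fix a assume a: "a \<in> Cont n q v"
    let ?e = "unit_vec d (idx a)"
    have r: "idx a < d" by (rule idx_less[OF a])
    have "?e $ idx a \<noteq> 0\<^sub>v d $ idx a" using r by simp
    then have "?e \<noteq> 0\<^sub>v d" by metis
    moreover have "\<rho> (jucys_murphy n q v l) *\<^sub>v ?e = a l \<cdot>\<^sub>v ?e" if l: "l \<in> {1..n}" for l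
    proof -
      have "act (jucys_murphy_term l) ?e = a l \<cdot>\<^sub>v ?e"
      proof (rule vec_eqI)
        fix b assume b: "b \<in> Cont n q v"
        have "fun_of ?e b = (if b = a then 1 else 0)"
          using idx_less[OF b] idx_eq_iff[OF b r] r str_idx[OF a] by (auto simp: fun_of_def)
        then show "fun_of (act (jucys_murphy_term l) ?e) b = fun_of (a l \<cdot>\<^sub>v ?e) b"
          using fun_of_jucys_murphy_term[of l ?e b] fun_of_smult[OF _ b, of ?e "a l"] l b by auto
      qed (auto intro: act_carrier)
      then show ?thesis using l by (simp add: rho_jucys_murphy del: jucys_murphy.simps)
    qed
    moreover have "a \<in> {1..n} \<rightarrow>\<^sub>E UNIV" using a by (simp add: Cont_def)
    ultimately show "a \<in> Spec n q v"
      unfolding Spec_def using rho_C_representation by (blast intro: unit_vec_carrier)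
  qed
qed

end

section \<open>Generic and admissible parameters\<close>

lemma generic_q_power: "generic_q ^ k = Fract (Poly_Mapping.single 0 ([:0, 1:] ^ k)) 1"
proof (induction k)
  case 0
  show ?case by (simp add: One_fract_def)
next
  case (Suc k)
  then show ?case by (simp add: generic_q_def mult_single)
qed

lemma generic_q_neq_0: "(generic_q :: 'm::linorder generic_field) \<noteq> 0"
  by (simp add: generic_q_def Zero_fract_def eq_fract)
    (metis lookup_single_eq lookup_zero pCons_eq_0_iff zero_neq_one)

lemma generic_v_neq_0: "generic_v k \<noteq> 0"
  by (simp add: generic_v_def Zero_fract_def eq_fract)
    (metis lookup_single_eq lookup_zero zero_neq_one)

lemma generic_q_power_neq_1:
  assumes "1 \<le> i"
  shows "(generic_q :: 'm::linorder generic_field) ^ i \<noteq> 1"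
proof
  assume "(generic_q :: 'm generic_field) ^ i = 1"
  then have "Poly_Mapping.single (0 :: 'm \<Rightarrow>\<^sub>0 nat) ([:0, 1:] ^ i :: complex poly) = 1"
    by (simp add: generic_q_power One_fract_def eq_fract)
  then have "([:0, 1:] ^ i :: complex poly) = 1" by (metis lookup_single_eq single_one)
  then have "degree ([:0, 1:] ^ i :: complex poly) = 0" by simp
  then show False using assms by (simp add: degree_power_eq)
qed

text \<open>Both sides are polynomials, and the monomial v_k has coefficient 0 on the left and 1 on
  the right.\<close>

lemma generic_separated_nat:
  assumes "j \<noteq> k"
  shows "generic_q ^ i * generic_v j \<noteq> generic_v k"
proof
  assume "generic_q ^ i * generic_v j = generic_v k"
  then have "Poly_Mapping.single (Poly_Mapping.single j 1) ([:0, 1:] ^ i :: complex poly)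
    = Poly_Mapping.single (Poly_Mapping.single k (1::nat)) 1"
    by (simp add: generic_q_power generic_v_def eq_fract mult_single)
  then have "Poly_Mapping.lookup (Poly_Mapping.single (Poly_Mapping.single j (1::nat)) ([:0, 1:] ^ i :: complex poly)) (Poly_Mapping.single k 1) = 1"
    by simp
  moreover have "Poly_Mapping.single j (1::nat) \<noteq> Poly_Mapping.single k 1"
    using assms by (metis lookup_single_eq lookup_single_not_eq zero_neq_one)
  ultimately show False by (simp add: lookup_single when_def)
qed

text \<open>A negative power is cleared by multiplication, which exchanges the roles of j and
  k.\<close>

lemma generic_separated:
  assumes "j \<noteq> k"
  shows "generic_q powi (2 * z) * generic_v j \<noteq> generic_v k"
proof (cases "z \<ge> 0")
  case True
  then have "generic_q powi (2 * z) = (generic_q :: 'a generic_field) ^ nat (2 * z)"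
    by (simp add: power_int_def)
  then show ?thesis using generic_separated_nat[OF assms, of "nat (2 * z)"] by simp
next
  case False
  then have eq: "generic_q powi (2 * z) = inverse ((generic_q :: 'a generic_field) ^ nat (- (2 * z)))"
    by (simp add: power_int_def power_inverse)
  show ?thesis
  proof
    let ?x = "(generic_q :: 'a generic_field) ^ nat (- (2 * z))"
    assume "generic_q powi (2 * z) * generic_v j = generic_v k"
    then have vk: "inverse ?x * generic_v j = generic_v k" unfolding eq .
    have "?x \<noteq> 0" by (simp add: generic_q_neq_0)
    then have "generic_v j = ?x * (inverse ?x * generic_v j)" by (simp add: generic_q_neq_0 mult.assoc[symmetric])
    then have "?x * generic_v k = generic_v j" unfolding vk by simp
    with generic_separated_nat[of k j] assms show False by blast
  qed
qed

text \<open>The second parameter \<open>q'\<close> is needed for \<open>n = 1\<close>, where \<open>q\<^sup>2 = 1\<close> is allowed but content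
  strings do not depend on \<open>q\<close>.\<close>

lemma bij_Spec_Cont_tableaux:
  fixes q :: "'k::field" and v :: "'m::{finite,linorder} \<Rightarrow> 'k"
  assumes "seminormal n q v" and "separated_parameters n q' v" and "Cont n q v = Cont n q' v"
  shows "(\<exists>f. bij_betw f (Spec n q v) (Cont n q v)) \<and> (\<exists>g. bij_betw g (Cont n q v)
    (standard_tableaux n :: (('m \<Rightarrow> nat list) \<times> ('m \<times> nat \<times> nat \<Rightarrow> nat)) set))"
proof -
  have "bij_betw id (Spec n q v) (Cont n q v)"
    using seminormal.Spec_eq_Cont[OF assms(1)] by (simp add: bij_betw_def)
  then show ?thesis
    using bij_betw_Cont_standard_tableaux[OF assms(2)] unfolding assms(3) by blast
qed

lemma Cont_1: "Cont 1 q v = Cont 1 q' v"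
  by (auto simp: Cont_def)

text \<open>q^(2i) - 1 is q^2 - 1 times the geometric sum with N = i - 1, which is nonzero for
  admissible parameters.\<close>

lemma admissible_q_power:
  assumes "admissible n q v" "q\<^sup>2 \<noteq> 1" "1 \<le> i" "i \<le> n"
  shows "q ^ (2 * i) \<noteq> 1"
proof
  assume eq: "q ^ (2 * i) = 1"
  have "(\<Sum>l\<le>i - 1. q ^ (2 * l)) \<noteq> 0" using assms by (auto simp: admissible_def)
  moreover have "{..i - 1} = {..<i}" using assms(3) by auto
  moreover have "(q\<^sup>2 - 1) * (\<Sum>l<i. q ^ (2 * l)) = q ^ (2 * i) - 1"
    using power_diff_1_eq[of "q\<^sup>2" i] by (simp add: power_mult)
  ultimately show False using eq assms(2) by simp
qed

theorem proposition12:
  fixes n :: nat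
  assumes "n \<ge> 1"
  shows
    "((\<exists>f. bij_betw f
          (Spec n generic_q (generic_v :: 'm::{finite,linorder} \<Rightarrow> 'm generic_field))
          (Cont n generic_q (generic_v :: 'm \<Rightarrow> 'm generic_field))) \<and>
      (\<exists>g. bij_betw g
          (Cont n generic_q (generic_v :: 'm \<Rightarrow> 'm generic_field))
          (standard_tableaux n :: (('m \<Rightarrow> nat list) \<times> ('m \<times> nat \<times> nat \<Rightarrow> nat)) set))) \<and>
     (\<forall>(q :: complex) (v :: 'm \<Rightarrow> complex).
        admissible n q v \<and> (n \<ge> 2 \<longrightarrow> q\<^sup>2 \<noteq> 1) \<longrightarrow>
          (\<exists>f. bij_betw f (Spec n q v) (Cont n q v)) \<and>
          (\<exists>g. bij_betw g (Cont n q v)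
            (standard_tableaux n :: (('m \<Rightarrow> nat list) \<times> ('m \<times> nat \<times> nat \<Rightarrow> nat)) set)))"
proof (intro conjI[OF _ allI[OF allI[OF impI]]])
  have sem: "seminormal n generic_q (generic_v :: 'm \<Rightarrow> 'm generic_field)"
    by unfold_locales (use assms in \<open>simp_all add: generic_q_neq_0 generic_v_neq_0 generic_q_power_neq_1\<close>)
  have sep: "separated_parameters n generic_q (generic_v :: 'm \<Rightarrow> 'm generic_field)"
    by unfold_locales
      (use assms in \<open>simp_all add: generic_q_neq_0 generic_v_neq_0 generic_q_power_neq_1 generic_separated\<close>)
  show "(\<exists>f. bij_betw f
          (Spec n generic_q (generic_v :: 'm \<Rightarrow> 'm generic_field))
          (Cont n generic_q (generic_v :: 'm \<Rightarrow> 'm generic_field))) \<and>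
      (\<exists>g. bij_betw g
          (Cont n generic_q (generic_v :: 'm \<Rightarrow> 'm generic_field))
          (standard_tableaux n :: (('m \<Rightarrow> nat list) \<times> ('m \<times> nat \<times> nat \<Rightarrow> nat)) set))"
    by (rule bij_Spec_Cont_tableaux[OF sem sep HOL.refl])
next
  fix q :: complex and v :: "'m \<Rightarrow> complex"
  assume asm: "admissible n q v \<and> (n \<ge> 2 \<longrightarrow> q\<^sup>2 \<noteq> 1)"
  then have adm: "admissible n q v" and q2: "2 \<le> n \<Longrightarrow> q\<^sup>2 \<noteq> 1" by auto
  have q0: "q \<noteq> 0" and v0: "\<And>k. v k \<noteq> 0" using adm by (auto simp: admissible_def)
  have sep: "q powi (2 * z) * v j \<noteq> v k" if "j \<noteq> k" "- int n < z" "z < int n" for j k z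
    using adm that by (auto simp: admissible_def)
  have sem: "seminormal n q v"
  proof
    show "q ^ 4 \<noteq> 1" if "2 \<le> n"
      using admissible_q_power[OF adm q2[OF that], of 2] that by simp
  qed (use assms q0 v0 q2 in auto)
  show "(\<exists>f. bij_betw f (Spec n q v) (Cont n q v)) \<and>
      (\<exists>g. bij_betw g (Cont n q v)
        (standard_tableaux n :: (('m \<Rightarrow> nat list) \<times> ('m \<times> nat \<times> nat \<Rightarrow> nat)) set))"
  proof (cases "2 \<le> n")
    case True
    have "separated_parameters n q v"
      by unfold_locales (use assms q0 v0 sep admissible_q_power[OF adm q2[OF True]] in auto)
    then show ?thesis by (rule bij_Spec_Cont_tableaux[OF sem _ HOL.refl])
  next
    case False
    with assms have n1: "n = 1" by simp
    \<comment> \<open>Any nonzero number with square different from 1 can take the place of 2. The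
      separation condition for n = 1 concerns z = 0 only, where q does not occur.\<close>
    have "separated_parameters 1 2 v"
    proof
      show "2 powi (2 * z) * v j \<noteq> v k" if "j \<noteq> k" "- int 1 < z" "z < int 1" for j k z
      proof -
        have "z = 0" using that(2,3) by simp
        then show ?thesis using sep[OF that(1), of 0] n1 by simp
      qed
    qed (use v0 in \<open>auto simp: le_Suc_eq\<close>)
    then show ?thesis using bij_Spec_Cont_tableaux[of n q v 2] sem Cont_1[of q v 2] n1 by simp
  qed
qed

end
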